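(* Let $(\mathcal{C},\mathcal{D})$ be a regular $C^*$-inclusion. Then $\mathcal{E}^1(\mathcal{C})=\Gamma$, and the range and source maps, the involution, and the topology on these two sets are all the same.
   Context: Let $\mathcal{C}$ be a unital $C^*$-algebra and $\mathcal{D}\subseteq\mathcal{C}$ an abelian $C^*$-subalgebra containing the unit. $\mathcal{N}(\mathcal{C})=\{v\in\mathcal{C}:v\mathcal{D}v^*\cup v^*\mathcal{D}v\subseteq\mathcal{D}\}$ is the set of normalizers. $\mathcal{D}$ has the extension property in $\mathcal{C}$ if every pure state of $\mathcal{D}$ has a unique extension to a state of $\mathcal{C}$ and no pure state of $\mathcal{C}$ annihilates $\mathcal{D}$. $(\mathcal{C},\mathcal{D})$ is a regular $C^*$-inclusion if $\mathcal{D}$ is a maximal abelian $C^*$-subalgebra of the unital $C^*$-algebra $\mathcal{C}$, $\mathcal{D}$ has the extension property in $\mathcal{C}$, and the closed linear span of $\mathcal{N}(\mathcal{C})$ is $\mathcal{C}$. In that case there is a unique conditional expectation $E:\mathcal{C}\to\mathcal{D}$. $\hat{\mathcal{D}}$ is the character space of $\mathcal{D}$; each $\rho\in\hat{\mathcal{D}}$ is also regarded as the state $\rho\circ E$ of $\mathcal{C}$. $\mathcal{E}^1(\mathcal{C})$: an eigenfunctional on $\mathcal{C}$ is a nonzero bounded linear functional $\phi$ such that for every $d\in\mathcal{D}$ the functionals $x\mapsto\phi(dx)$ and $x\mapsto\phi(xd)$ are scalar multiples of $\phi$; there are then unique $r(\phi),s(\phi)\in\hat{\mathcal{D}}$ with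 $\phi(dx)=r(\phi)(d)\phi(x)$, $\phi(xd)=\phi(x)s(\phi)(d)$ (range and source). $\mathcal{E}^1(\mathcal{C})$ is the set of norm-one eigenfunctionals, with the relative weak-$*$ topology and the involution $\phi^*(x)=\overline{\phi(x^* )}$. $\Gamma$ (Kumjian's twist): for $v\in\mathcal{N}(\mathcal{C})$ and $\rho\in\hat{\mathcal{D}}$ with $\rho(v^*v)>0$ put $[v,\rho](x)=\rho(v^*x)/\rho(v^*v)^{1/2}$ ($x\in\mathcal{C}$). $\Gamma$ is the set of all such functionals $[v,\rho]$, with the relative weak-$*$ topology, source map $[v,\rho]\mapsto\rho$, range map $[v,\rho]\mapsto\beta_v(\rho)$, where $\beta_v(\rho)(d)=\rho(v^*dv)/\rho(v^*v)$, and involution (groupoid inverse) $[v,\rho]\mapsto[v^*,\beta_v(\rho)]$. *)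

theory Defs
  imports "HOL-Analysis.Analysis" "HOL-Library.Complex_Order"
begin

text \<open>
  A unital C*-algebra is here a type carrying a complete normed algebra structure over the reals
  (with \<open>norm 1 = 1\<close>, so the zero algebra is excluded), a compatible complex scalar
  multiplication, and an involution satisfying the C*-identity.
\<close>

class unital_cstar_algebra = real_normed_algebra_1 + banach +
  fixes scaleC :: "complex \<Rightarrow> 'a \<Rightarrow> 'a"  (infixr "*\<^sub>C" 75)
    and star :: "'a \<Rightarrow> 'a"
  assumes scaleC_add_right: "c *\<^sub>C (x + y) = c *\<^sub>C x + c *\<^sub>C y"
    and scaleC_add_left: "(b + c) *\<^sub>C x = b *\<^sub>C x + c *\<^sub>C x"
    and scaleC_scaleC: "b *\<^sub>C (c *\<^sub>C x) = (b * c) *\<^sub>C x"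
    and scaleC_of_real: "complex_of_real r *\<^sub>C x = r *\<^sub>R x"
    and mult_scaleC_left: "(c *\<^sub>C x) * y = c *\<^sub>C (x * y)"
    and mult_scaleC_right: "x * (c *\<^sub>C y) = c *\<^sub>C (x * y)"
    and norm_scaleC: "norm (c *\<^sub>C x) = cmod c * norm x"
    and star_add: "star (x + y) = star x + star y"
    and star_scaleC: "star (c *\<^sub>C x) = cnj c *\<^sub>C star x"
    and star_mult: "star (x * y) = star y * star x"
    and star_star: "star (star x) = x"
    and cstar_identity: "norm (star x * x) = (norm x)\<^sup>2"

global_interpretation complex_vector:
  vector_space "scaleC :: complex \<Rightarrow> 'a \<Rightarrow> 'a::unital_cstar_algebra"
  defines cspan = complex_vector.span
  by unfold_locales
     (use scaleC_of_real[of 1] in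
        \<open>auto simp: scaleC_add_right scaleC_add_left scaleC_scaleC\<close>)

definition cstar_subalgebra :: "'a::unital_cstar_algebra set \<Rightarrow> bool" where
  "cstar_subalgebra A \<longleftrightarrow>
     0 \<in> A \<and> closed A \<and>
     (\<forall>x\<in>A. \<forall>y\<in>A. x + y \<in> A \<and> x * y \<in> A) \<and>
     (\<forall>x\<in>A. star x \<in> A \<and> (\<forall>c. c *\<^sub>C x \<in> A))"

definition abelian_cstar_subalgebra :: "'a::unital_cstar_algebra set \<Rightarrow> bool" where
  "abelian_cstar_subalgebra A \<longleftrightarrow>
     cstar_subalgebra A \<and> (\<forall>x\<in>A. \<forall>y\<in>A. x * y = y * x)"

definition maximal_abelian :: "'a::unital_cstar_algebra set \<Rightarrow> bool" where
  "maximal_abelian D \<longleftrightarrow>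
     abelian_cstar_subalgebra D \<and>
     (\<forall>B. abelian_cstar_subalgebra B \<longrightarrow> D \<subseteq> B \<longrightarrow> B = D)"

text \<open>
  A functional on a subalgebra \<open>A\<close> is an element of \<^term>\<open>extensional A\<close>, so
  that two functionals on \<open>A\<close> are equal as soon as they agree on \<open>A\<close>.  In the
  order of \<^theory>\<open>HOL-Library.Complex_Order\<close>, \<open>0 \<le> z\<close> for complex \<open>z\<close>
  means that \<open>z\<close> is real and nonnegative.
\<close>

definition linear_functional_on ::
    "'a::unital_cstar_algebra set \<Rightarrow> ('a \<Rightarrow> complex) \<Rightarrow> bool" where
  "linear_functional_on A f \<longleftrightarrow>
     f \<in> extensional A \<and>
     (\<forall>x\<in>A. \<forall>y\<in>A. f (x + y) = f x + f y) \<and>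
     (\<forall>x\<in>A. \<forall>c. f (c *\<^sub>C x) = c * f x)"

text \<open>States are only considered on C*-subalgebras that contain the unit.\<close>

definition states :: "'a::unital_cstar_algebra set \<Rightarrow> ('a \<Rightarrow> complex) set" where
  "states A = {f. linear_functional_on A f \<and> (\<forall>x\<in>A. 0 \<le> f (star x * x)) \<and> f 1 = 1}"

definition pure_states :: "'a::unital_cstar_algebra set \<Rightarrow> ('a \<Rightarrow> complex) set" where
  "pure_states A =
     {f \<in> states A. \<forall>g\<in>states A. \<forall>h\<in>states A. \<forall>t::real. 0 < t \<and> t < 1 \<longrightarrow>
        (\<forall>x\<in>A. f x = of_real t * g x + of_real (1 - t) * h x) \<longrightarrow> g = f \<and> h = f}"

definition characters :: "'a::unital_cstar_algebra set \<Rightarrow> ('a \<Rightarrow> complex) set" where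
  "characters D =
     {\<rho>. linear_functional_on D \<rho> \<and> (\<forall>x\<in>D. \<forall>y\<in>D. \<rho> (x * y) = \<rho> x * \<rho> y) \<and>
         (\<exists>x\<in>D. \<rho> x \<noteq> 0)}"

definition normalizers :: "'a::unital_cstar_algebra set \<Rightarrow> 'a set" where
  "normalizers D = {v. \<forall>d\<in>D. v * d * star v \<in> D \<and> star v * d * v \<in> D}"

definition extension_property :: "'a::unital_cstar_algebra set \<Rightarrow> bool" where
  "extension_property D \<longleftrightarrow>
     (\<forall>f\<in>pure_states D. \<exists>!g. g \<in> states UNIV \<and> (\<forall>d\<in>D. g d = f d)) \<and>
     \<not> (\<exists>g\<in>pure_states UNIV. \<forall>d\<in>D. g d = 0)"

definition regular_inclusion :: "'a::unital_cstar_algebra set \<Rightarrow> bool" where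
  "regular_inclusion D \<longleftrightarrow>
     1 \<in> D \<and> maximal_abelian D \<and> extension_property D \<and>
     closure (cspan (normalizers D)) = UNIV"

text \<open>
  By a theorem of Tomiyama, positivity and the bimodule property already follow from being a
  contractive projection onto \<open>D\<close>.
\<close>

definition conditional_expectation ::
    "'a::unital_cstar_algebra set \<Rightarrow> ('a \<Rightarrow> 'a) \<Rightarrow> bool" where
  "conditional_expectation D E \<longleftrightarrow>
     Vector_Spaces.linear scaleC scaleC E \<and>
     range E \<subseteq> D \<and> (\<forall>d\<in>D. E d = d) \<and>
     (\<forall>x. norm (E x) \<le> norm x) \<and>
     (\<forall>x. \<exists>y\<in>D. E (star x * x) = star y * y) \<and>
     (\<forall>d\<in>D. \<forall>x. E (d * x) = d * E x \<and> E (x * d) = E x * d)"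

text \<open>
  For a regular inclusion there is exactly one conditional expectation; only then is the
  definite description meaningful.
\<close>

definition cond_exp :: "'a::unital_cstar_algebra set \<Rightarrow> 'a \<Rightarrow> 'a" where
  "cond_exp D = (THE E. conditional_expectation D E)"

definition bounded_functionals :: "('a::unital_cstar_algebra \<Rightarrow> complex) set" where
  "bounded_functionals = {\<phi>. bounded_linear \<phi> \<and> (\<forall>c x. \<phi> (c *\<^sub>C x) = c * \<phi> x)}"

definition weak_star_topology :: "('a::unital_cstar_algebra \<Rightarrow> complex) topology" where
  "weak_star_topology =
     subtopology (product_topology (\<lambda>_. euclidean) UNIV) bounded_functionals"

definition eigenfunctionals ::
    "'a::unital_cstar_algebra set \<Rightarrow> ('a \<Rightarrow> complex) set" where
  "eigenfunctionals D =
     {\<phi> \<in> bounded_functionals. (\<exists>x. \<phi> x \<noteq> 0) \<and>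
        (\<forall>d\<in>D. (\<exists>c. \<forall>x. \<phi> (d * x) = c * \<phi> x) \<and> (\<exists>c. \<forall>x. \<phi> (x * d) = c * \<phi> x))}"

definition unit_eigenfunctionals ::
    "'a::unital_cstar_algebra set \<Rightarrow> ('a \<Rightarrow> complex) set" where
  "unit_eigenfunctionals D = {\<phi> \<in> eigenfunctionals D. onorm \<phi> = 1}"

text \<open>
  For an eigenfunctional the characters described in \<open>eigen_range\<close> and
  \<open>eigen_source\<close> exist and are unique.
\<close>

definition eigen_range ::
    "'a::unital_cstar_algebra set \<Rightarrow> ('a \<Rightarrow> complex) \<Rightarrow> 'a \<Rightarrow> complex" where
  "eigen_range D \<phi> =
     (THE r. r \<in> characters D \<and> (\<forall>d\<in>D. \<forall>x. \<phi> (d * x) = r d * \<phi> x))"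

definition eigen_source ::
    "'a::unital_cstar_algebra set \<Rightarrow> ('a \<Rightarrow> complex) \<Rightarrow> 'a \<Rightarrow> complex" where
  "eigen_source D \<phi> =
     (THE s. s \<in> characters D \<and> (\<forall>d\<in>D. \<forall>x. \<phi> (x * d) = \<phi> x * s d))"

definition eigen_star :: "('a::unital_cstar_algebra \<Rightarrow> complex) \<Rightarrow> 'a \<Rightarrow> complex" where
  "eigen_star \<phi> = (\<lambda>x. cnj (\<phi> (star x)))"

definition unit_eigenfunctional_topology ::
    "'a::unital_cstar_algebra set \<Rightarrow> ('a \<Rightarrow> complex) topology" where
  "unit_eigenfunctional_topology D = subtopology weak_star_topology (unit_eigenfunctionals D)"

text \<open>
  \<open>twist_functional D v \<rho>\<close> is Kumjian's \<open>[v, \<rho>]\<close>.  Since a functional may be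
  represented by several pairs, the structure maps of \<open>twist D\<close> are given on pairs in
  \<open>twist_pairs D\<close>: source \<open>\<rho>\<close>, range \<open>twist_beta D v \<rho>\<close>, and inverse
  \<open>[star v, twist_beta D v \<rho>]\<close>.
\<close>

definition twist_functional ::
    "'a::unital_cstar_algebra set \<Rightarrow> 'a \<Rightarrow> ('a \<Rightarrow> complex) \<Rightarrow> 'a \<Rightarrow> complex" where
  "twist_functional D v \<rho> = (\<lambda>x. \<rho> (cond_exp D (star v * x)) / csqrt (\<rho> (star v * v)))"

definition twist_beta ::
    "'a::unital_cstar_algebra set \<Rightarrow> 'a \<Rightarrow> ('a \<Rightarrow> complex) \<Rightarrow> 'a \<Rightarrow> complex" where
  "twist_beta D v \<rho> = (\<lambda>d\<in>D. \<rho> (star v * d * v) / \<rho> (star v * v))"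

definition twist_pairs ::
    "'a::unital_cstar_algebra set \<Rightarrow> ('a \<times> ('a \<Rightarrow> complex)) set" where
  "twist_pairs D = {(v, \<rho>). v \<in> normalizers D \<and> \<rho> \<in> characters D \<and> 0 < \<rho> (star v * v)}"

definition twist :: "'a::unital_cstar_algebra set \<Rightarrow> ('a \<Rightarrow> complex) set" where
  "twist D = {twist_functional D v \<rho> | v \<rho>. (v, \<rho>) \<in> twist_pairs D}"

definition twist_topology ::
    "'a::unital_cstar_algebra set \<Rightarrow> ('a \<Rightarrow> complex) topology" where
  "twist_topology D = subtopology weak_star_topology (twist D)"

end

theory Submission
  imports Defs
begin

text \<open>
  Everything rests on one consequence of the extension property.  Write \<open>\<sigma>'\<close> for the unique
  state extending a character \<open>\<sigma>\<close> of \<open>D\<close>.  By a Hahn-Banach argument, the possible values at a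
  self-adjoint \<open>h\<close> of states extending \<open>\<sigma>\<close> fill the gap between \<open>\<sigma> c\<close> for \<open>c \<le> h\<close> in \<open>D\<close> and
  \<open>\<sigma> d\<close> for \<open>d \<ge> h\<close> in \<open>D\<close>.  Uniqueness closes this gap: for every \<open>\<epsilon> > 0\<close> there are
  \<open>c \<le> h \<le> d\<close> in \<open>D\<close> with \<open>\<sigma> (d - c) < \<epsilon>\<close> (\<open>ex_sandwich\<close>).  Two things follow.

  First, \<open>\<sigma> \<mapsto> \<sigma>' h\<close> is locally close to Gelfand transforms of elements of \<open>D\<close>, hence is itself
  such a transform.  This produces the conditional expectation, characterised by
  \<open>\<sigma> (E x) = \<sigma>' x\<close>; it is unique because \<open>\<sigma> \<circ> E\<close> is always a state extending \<open>\<sigma>\<close>.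

  Second, a bounded functional \<open>\<psi>\<close> with \<open>\<psi> (d x) = \<sigma> d \<psi> x = \<psi> (x d)\<close> must be \<open>\<psi> 1 \<sigma>'\<close>
  (\<open>central_functional_eq\<close>).  Indeed, if \<open>e\<close> in \<open>D\<close> peaks at \<open>\<sigma>\<close>, that is \<open>\<sigma> e = 1\<close> and
  \<open>e (d - c) e\<close> has small norm, then \<open>\<psi> (h - c) = \<psi> (e (h - c) e)\<close> is small, because
  \<open>0 \<le> e (h - c) e \<le> e (d - c) e\<close>.

  That every \<open>[v, \<rho>]\<close> is a norm-one eigenfunctional is the Cauchy-Schwarz inequality together
  with a peak element at \<open>\<rho>\<close>.  Conversely, a norm-one eigenfunctional \<open>\<phi>\<close> with source \<open>\<sigma>\<close> is
  nonzero at some normalizer \<open>v\<close>, since the normalizers span a dense subspace.  A peak element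
  shows \<open>\<sigma> (v\<^sup>* v) > 0\<close>, and \<open>x \<mapsto> \<phi> (v x)\<close> turns out to be a functional as above, so it is
  \<open>\<phi> v \<sigma>'\<close>.  Replacing \<open>x\<close> by \<open>v\<^sup>* x\<close> exhibits \<open>\<phi>\<close> as a multiple of \<open>[v, \<sigma>]\<close>; comparing norms,
  the factor has modulus one and is absorbed into \<open>v\<close>.  Both topologies are the topology of
  pointwise convergence, so they agree once the sets do.

  The C*-theory used on the way is developed without spectra.  An element is positive if it
  satisfies a norm inequality that is visibly stable under sums; a power series supplies square
  roots, and with them come the order and the positivity of \<open>x\<^sup>* x\<close>.  Characters and states both
  arise from maximal cones: a maximal proper cone in an Archimedean ordered module is a half
  space, and the functional it determines is multiplicative when the cone is a module over the
  positive elements of a commutative algebra.  The same existence result replaces compactness of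
  the character space.
\<close>

section \<open>The involution and square roots\<close>

lemma star_zero [simp]: "star (0::'a::unital_cstar_algebra) = 0"
  using star_add[of "0::'a" 0] by simp

lemma star_minus [simp]: "star (- x::'a::unital_cstar_algebra) = - star x"
  using star_add[of x "-x"] by (simp add: eq_neg_iff_add_eq_0 add.commute)

lemma star_diff: "star (x - y::'a::unital_cstar_algebra) = star x - star y"
  using star_add[of x "-y"] by simp

lemma star_one [simp]: "star (1::'a::unital_cstar_algebra) = 1"
  by (metis mult.left_neutral mult.right_neutral star_mult star_star)

lemma star_scaleR: "star (r *\<^sub>R x::'a::unital_cstar_algebra) = r *\<^sub>R star x"
  by (metis complex_cnj_complex_of_real scaleC_of_real star_scaleC)

lemma star_of_real [simp]: "star (of_real r::'a::unital_cstar_algebra) = of_real r"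
  by (simp add: of_real_def star_scaleR)

lemma star_power: "star (x ^ n::'a::unital_cstar_algebra) = star x ^ n"
  by (induction n) (simp_all add: star_mult power_commutes)

lemma norm_star [simp]: "norm (star x::'a::unital_cstar_algebra) = norm x"
proof -
  have *: "norm y \<le> norm (star y)" for y :: 'a
  proof (cases "y = 0")
    case False
    have "(norm y)\<^sup>2 \<le> norm (star y) * norm y"
      by (metis cstar_identity norm_mult_ineq)
    with False show ?thesis by (simp add: power2_eq_square)
  qed simp
  show ?thesis using *[of x] *[of "star x"] by (simp add: star_star)
qed

lemma bounded_linear_star: "bounded_linear (star :: 'a::unital_cstar_algebra \<Rightarrow> 'a)"
  by (rule bounded_linear_intro[where K=1]) (simp_all add: star_add star_scaleR)

lemma norm_selfadjoint_square:
  "star x = x \<Longrightarrow> norm (x * x::'a::unital_cstar_algebra) = (norm x)\<^sup>2"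
  using cstar_identity[of x] by simp

lemma selfadjoint_square_eq_0: "star x = x \<Longrightarrow> x * x = 0 \<Longrightarrow> (x::'a::unital_cstar_algebra) = 0"
  using norm_selfadjoint_square[of x] by simp

text \<open>
  Complex scalars and the involution are left out on purpose: commutants of single elements then
  qualify, so that membership in all closed subalgebras containing \<open>k\<close> also says that an element
  commutes with whatever commutes with \<open>k\<close>.
\<close>

definition closed_subalgebra :: "'a::unital_cstar_algebra set \<Rightarrow> bool" where
  "closed_subalgebra B \<longleftrightarrow> closed B \<and> 1 \<in> B \<and>
     (\<forall>x\<in>B. \<forall>y\<in>B. x + y \<in> B \<and> x * y \<in> B) \<and> (\<forall>x\<in>B. \<forall>r. r *\<^sub>R x \<in> B)"

lemma closed_subalgebra_commutant:
  "closed_subalgebra {y. y * x = x * (y::'a::unital_cstar_algebra)}"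
proof -
  have "closed {y. y * x = x * y}"
    by (intro closed_Collect_eq continuous_intros)
  moreover have "a * b * x = x * (a * b)" if "a * x = x * a" "b * x = x * b" for a b
    using that by (simp only: mult.assoc) (simp only: mult.assoc[symmetric])
  ultimately show ?thesis
    unfolding closed_subalgebra_def by (simp add: distrib_left distrib_right)
qed

lemma closed_subalgebra_suminf:
  assumes "closed_subalgebra B" "k \<in> B" "summable (\<lambda>n. c n *\<^sub>R k ^ n)"
  shows "(\<Sum>n. c n *\<^sub>R k ^ n) \<in> B"
proof -
  have pw: "k ^ n \<in> B" for n
    using assms by (induction n) (auto simp: closed_subalgebra_def)
  have zero: "0 \<in> B"
    using assms(1,2) unfolding closed_subalgebra_def by (metis scaleR_zero_left)
  have "(\<Sum>n<N. c n *\<^sub>R k ^ n) \<in> B" for N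
    using assms(1) pw zero by (induction N) (auto simp: closed_subalgebra_def)
  then show ?thesis
    using closed_sequentially[OF _ _ summable_LIMSEQ[OF assms(3)], of B] assms(1)
    by (simp add: closed_subalgebra_def)
qed

text \<open>
  The coefficients of the binomial series of \<open>sqrt (1 - t)\<close>.
\<close>

definition sqrt_coeff :: "nat \<Rightarrow> real" where
  "sqrt_coeff n = (-1) ^ n * ((1/2) gchoose n)"

lemma sqrt_coeff_0 [simp]: "sqrt_coeff 0 = 1"
  by (simp add: sqrt_coeff_def)

lemma sqrt_coeff_Suc: "sqrt_coeff (Suc n) = sqrt_coeff n * (real n - 1/2) / (real n + 1)"
  by (simp add: sqrt_coeff_def gbinomial_Suc_rec field_simps
      del: of_nat_Suc)

lemma sqrt_coeff_nonpos: "sqrt_coeff (Suc n) \<le> 0"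
proof (induction n)
  case 0
  show ?case by (simp add: sqrt_coeff_Suc)
next
  case (Suc n)
  then show ?case
    by (subst sqrt_coeff_Suc) (auto intro!: divide_nonpos_pos mult_nonpos_nonneg)
qed

lemma sqrt_coeff_sums:
  assumes "0 \<le> t" "t < 1"
  shows "(\<lambda>n. sqrt_coeff n * t ^ n) sums (sqrt (1 - t))"
proof -
  have "(\<lambda>n. ((1/2) gchoose n) * (- t) ^ n) sums ((1 + - t) powr (1/2))"
    using assms by (intro gen_binomial_real) auto
  moreover have "((1/2) gchoose n) * (- t) ^ n = sqrt_coeff n * t ^ n" for n
    by (subst power_minus) (simp add: sqrt_coeff_def)
  ultimately show ?thesis
    using assms by (simp add: powr_half_sqrt)
qed

text \<open>
  For \<open>0 \<le> t < 1\<close> the terms are nonnegative and add up to \<open>1 - sqrt (1 - t)\<close>; the bound for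
  \<open>t = 1\<close> follows by letting \<open>t\<close> tend to 1.
\<close>

lemma sqrt_coeff_partial_sum: "(\<Sum>n<N. - sqrt_coeff (Suc n)) \<le> 1"
proof -
  have le: "(\<Sum>n<N. - sqrt_coeff (Suc n) * t ^ Suc n) \<le> 1" if t: "0 \<le> t" "t < 1" for t
  proof -
    have "(\<lambda>n. sqrt_coeff (Suc n) * t ^ Suc n) sums (sqrt (1 - t) - 1)"
      using sqrt_coeff_sums[OF t] by (subst sums_Suc_iff) simp
    then have s: "(\<lambda>n. - sqrt_coeff (Suc n) * t ^ Suc n) sums (1 - sqrt (1 - t))"
      using sums_minus by fastforce
    have "(\<Sum>n<N. - sqrt_coeff (Suc n) * t ^ Suc n) \<le> 1 - sqrt (1 - t)"
      unfolding sums_unique[OF s]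
      by (rule sum_le_suminf)
        (use s t sqrt_coeff_nonpos in \<open>auto simp: sums_iff intro!: mult_nonpos_nonneg\<close>)
    also have "\<dots> \<le> 1" using t by simp
    finally show ?thesis .
  qed
  have "((\<lambda>t. \<Sum>n<N. - sqrt_coeff (Suc n) * t ^ Suc n) \<longlongrightarrow>
          (\<Sum>n<N. - sqrt_coeff (Suc n) * 1 ^ Suc n)) (at_left 1)"
    by (intro tendsto_intros)
  moreover have "\<forall>\<^sub>F t in at_left (1::real). (\<Sum>n<N. - sqrt_coeff (Suc n) * t ^ Suc n) \<le> 1"
    by (rule eventually_at_leftI[of 0]) (use le in auto)
  ultimately have "(\<Sum>n<N. - sqrt_coeff (Suc n) * 1 ^ Suc n) \<le> 1"
    by (intro tendsto_upperbound[where F="at_left (1::real)"]) auto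
  then show ?thesis by simp
qed

lemma sqrt_coeff_summable: "summable (\<lambda>n. \<bar>sqrt_coeff n\<bar>)"
  and sqrt_coeff_suminf_le: "(\<Sum>n. \<bar>sqrt_coeff (Suc n)\<bar>) \<le> 1"
proof -
  have eq: "\<bar>sqrt_coeff (Suc n)\<bar> = - sqrt_coeff (Suc n)" for n
    using sqrt_coeff_nonpos[of n] by simp
  have s: "summable (\<lambda>n. \<bar>sqrt_coeff (Suc n)\<bar>)"
  proof (rule summableI_nonneg_bounded[where x=1])
    show "(\<Sum>i<n. \<bar>sqrt_coeff (Suc i)\<bar>) \<le> 1" for n
      using sqrt_coeff_partial_sum[of n] by (simp add: eq)
  qed simp
  then show "summable (\<lambda>n. \<bar>sqrt_coeff n\<bar>)"
    by (subst (asm) summable_Suc_iff)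
  show "(\<Sum>n. \<bar>sqrt_coeff (Suc n)\<bar>) \<le> 1"
    by (rule suminf_le_const[OF s]) (use sqrt_coeff_partial_sum in \<open>simp add: eq\<close>)
qed

lemma sqrt_coeff_convolution:
  "(\<Sum>i\<le>n. sqrt_coeff i * sqrt_coeff (n - i)) = (if n = 0 then 1 else if n = 1 then -1 else 0)"
proof -
  have "(\<Sum>i\<le>n. sqrt_coeff i * sqrt_coeff (n - i)) =
        (\<Sum>i\<le>n. (-1) ^ n * (((1/2) gchoose i) * ((1/2) gchoose (n - i))))"
    by (rule sum.cong) (auto simp: sqrt_coeff_def mult_ac simp flip: power_add)
  also have "\<dots> = (-1) ^ n * (1 gchoose n)"
    using gbinomial_Vandermonde[of "1/2::real" "1/2" n]
    by (simp flip: sum_distrib_left add: atMost_atLeast0)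
  also have "1 gchoose n = (of_nat (1 choose n) :: real)"
    by (metis binomial_gbinomial of_nat_1)
  also have "(-1) ^ n * real (1 choose n) = (if n = 0 then 1 else if n = 1 then -1 else 0)"
    by (cases n) auto
  finally show ?thesis .
qed

text \<open>
  Since the coefficients are absolutely summable, the series converges even on the boundary of
  the unit ball.  All coefficients but the first have absolute values adding up to at most 1,
  whence the bound on \<open>1 - s\<close>, which will make the root positive.
\<close>

lemma ex_sqrt_one_minus:
  fixes k :: "'a::unital_cstar_algebra"
  assumes sa: "star k = k" and le: "norm k \<le> 1"
  obtains s where "star s = s" "norm (1 - s) \<le> 1" "s * s = 1 - k"
    "\<And>B. closed_subalgebra B \<Longrightarrow> k \<in> B \<Longrightarrow> s \<in> B"
proof -
  define f where "f n = sqrt_coeff n *\<^sub>R k ^ n" for n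
  have nf: "norm (f n) \<le> \<bar>sqrt_coeff n\<bar>" for n
  proof -
    have "norm (k ^ n) \<le> 1"
      using norm_power_ineq[of k n] power_le_one[OF norm_ge_zero le, of n] by linarith
    then show ?thesis
      by (simp add: f_def mult_left_le)
  qed
  have sn: "summable (\<lambda>n. norm (f n))"
    by (rule summable_comparison_test'[OF sqrt_coeff_summable]) (use nf in auto)
  have sf: "summable f" by (rule summable_norm_cancel[OF sn])
  define s where "s = suminf f"
  have "star s = (\<Sum>n. star (f n))"
    unfolding s_def by (rule bounded_linear.suminf[OF bounded_linear_star sf])
  then have 1: "star s = s"
    unfolding s_def f_def by (simp add: star_scaleR star_power sa)
  have "s - 1 = (\<Sum>n. f (Suc n))"
    using suminf_split_head[OF sf] by (simp add: s_def f_def)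
  moreover have "norm (\<Sum>n. f (Suc n)) \<le> (\<Sum>n. \<bar>sqrt_coeff (Suc n)\<bar>)"
    using nf sqrt_coeff_summable by (intro norm_suminf_le) (auto intro: summable_Suc_iff[THEN iffD2])
  ultimately have 2: "norm (1 - s) \<le> 1"
    using sqrt_coeff_suminf_le by (simp add: norm_minus_commute[of 1 s])
  have "s * s = (\<Sum>n. \<Sum>i\<le>n. f i * f (n - i))"
    unfolding s_def by (rule Cauchy_product[OF sn sn])
  also have "\<dots> = (\<Sum>n. (if n = 0 then 1 else if n = 1 then -1 else 0) *\<^sub>R k ^ n)"
  proof (rule suminf_cong)
    fix n
    have "(\<Sum>i\<le>n. f i * f (n - i)) = (\<Sum>i\<le>n. sqrt_coeff i * sqrt_coeff (n - i)) *\<^sub>R k ^ n"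
      unfolding scaleR_sum_left
      by (rule sum.cong) (auto simp: f_def simp flip: power_add)
    then show "(\<Sum>i\<le>n. f i * f (n - i)) = (if n = 0 then 1 else if n = 1 then -1 else 0) *\<^sub>R k ^ n"
      by (simp only: sqrt_coeff_convolution)
  qed
  also have "\<dots> = (\<Sum>n\<in>{0,1}. (if n = 0 then 1 else if n = 1 then -1 else 0) *\<^sub>R k ^ n)"
    by (rule suminf_finite) auto
  also have "\<dots> = 1 - k" by simp
  finally have 3: "s * s = 1 - k" .
  have "s \<in> B" if "closed_subalgebra B" "k \<in> B" for B
    using closed_subalgebra_suminf[OF that, of sqrt_coeff] sf unfolding s_def f_def by simp
  then show ?thesis
    using that[OF 1 2 3] by blast
qed

section \<open>The order of a C*-algebra\<close>

lemma scaleC_one [simp]: "1 *\<^sub>C (x::'a::unital_cstar_algebra) = x"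
  using scaleC_of_real[of 1 x] by simp

lemma scaleC_i_i [simp]: "\<i> *\<^sub>C \<i> *\<^sub>C (x::'a::unital_cstar_algebra) = - x"
  by (simp add: scaleC_scaleC complex_vector.scale_minus_left)

lemma scaleC_scaleR: "c *\<^sub>C r *\<^sub>R (x::'a::unital_cstar_algebra) = r *\<^sub>R c *\<^sub>C x"
  unfolding scaleC_of_real[symmetric] scaleC_scaleC by (simp add: mult.commute)

text \<open>
  The element \<open>u = x + i y\<close> is normal with \<open>u\<^sup>* u = x\<^sup>2 + y\<^sup>2\<close>, and \<open>x\<close> is its real part.
\<close>

lemma norm_sq_le_norm_sum_squares:
  fixes x y :: "'a::unital_cstar_algebra"
  assumes "star x = x" "star y = y" "x * y = y * x"
  shows "(norm x)\<^sup>2 \<le> norm (x * x + y * y)"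
proof -
  define u where "u = x + \<i> *\<^sub>C y"
  have su: "star u = x - \<i> *\<^sub>C y"
    using assms by (simp add: u_def star_add star_scaleC complex_vector.scale_minus_left)
  have "star u * u = x * x + y * y"
    unfolding su unfolding u_def using assms(3)
    by (simp add: algebra_simps mult_scaleC_left mult_scaleC_right)
  then have n: "norm (x * x + y * y) = (norm u)\<^sup>2"
    using cstar_identity[of u] by simp
  have "2 *\<^sub>R x = u + star u"
    unfolding su by (simp add: u_def scaleR_2)
  then have "2 * norm x \<le> norm u + norm u"
    by (metis norm_triangle_ineq norm_star norm_scaleR abs_numeral real_norm_def)
  then show ?thesis
    unfolding n by (intro power_mono) auto
qed

text \<open>
  For self-adjoint \<open>h\<close> this says that the spectrum of \<open>h\<close> lies in \<open>[0, 2 t]\<close>.  In this form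
  stability under sums is just the triangle inequality.
\<close>

definition positive :: "'a::unital_cstar_algebra \<Rightarrow> bool" where
  "positive h \<longleftrightarrow> star h = h \<and> (\<exists>t\<ge>0. norm (of_real t - h) \<le> t)"

lemma positive_selfadjoint: "positive h \<Longrightarrow> star h = h"
  by (simp add: positive_def)

lemma positive_scaleR:
  fixes h :: "'a::unital_cstar_algebra"
  assumes "0 \<le> r" "positive h"
  shows "positive (r *\<^sub>R h)"
proof -
  obtain t where t: "t \<ge> 0" "norm (of_real t - h) \<le> t"
    using assms by (auto simp: positive_def)
  have "of_real (r * t) - r *\<^sub>R h = r *\<^sub>R (of_real t - h)"
    by (simp add: of_real_def scaleR_diff_right)
  then have "norm (of_real (r * t) - r *\<^sub>R h) \<le> r * t"
    using t assms by (simp add: mult_left_mono)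
  then show ?thesis
    using t assms unfolding positive_def star_scaleR by (metis mult_nonneg_nonneg)
qed

lemma positive_add:
  fixes h k :: "'a::unital_cstar_algebra"
  assumes "positive h" "positive k"
  shows "positive (h + k)"
proof -
  obtain t where t: "t \<ge> 0" "norm (of_real t - h) \<le> t"
    using assms by (auto simp: positive_def)
  obtain s where s: "s \<ge> 0" "norm (of_real s - k) \<le> s"
    using assms by (auto simp: positive_def)
  have "norm (of_real (t + s) - (h + k)) = norm ((of_real t - h) + (of_real s - k))"
    by (simp add: algebra_simps)
  also have "\<dots> \<le> t + s"
    using norm_triangle_ineq[of "of_real t - h" "of_real s - k"] t s by linarith
  finally have "norm (of_real (t + s) - (h + k)) \<le> t + s" .
  then show ?thesis
    using t s assms unfolding positive_def star_add by (metis add_nonneg_nonneg)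
qed

lemma positive_0 [simp]: "positive 0"
  unfolding positive_def by (auto intro: exI[of _ 0])

lemma positive_of_real: "0 \<le> r \<Longrightarrow> positive (of_real r)"
  unfolding positive_def by (auto intro!: exI[of _ r])

lemma positive_1 [simp]: "positive 1"
  using positive_of_real[of 1] by simp

lemma positive_norm_minus:
  fixes h :: "'a::unital_cstar_algebra"
  assumes "star h = h" "norm h \<le> r"
  shows "positive (of_real r - h)" "positive (of_real r + h)"
proof -
  have "0 \<le> r" using assms(2) norm_ge_zero[of h] by linarith
  then show "positive (of_real r - h)" "positive (of_real r + h)"
    using assms by (auto simp: positive_def star_diff star_add intro!: exI[of _ r])
qed

lemma ex_positive_sqrt:
  fixes h :: "'a::unital_cstar_algebra"
  assumes "positive h"
  obtains s where "positive s" "s * s = h"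
    "\<And>B. closed_subalgebra B \<Longrightarrow> h \<in> B \<Longrightarrow> s \<in> B"
proof -
  obtain t where t: "t \<ge> 0" "norm (of_real t - h) \<le> t"
    using assms by (auto simp: positive_def)
  show ?thesis
  proof (cases "t = 0")
    case True
    then have "h = 0" using t by simp
    then show ?thesis using that[of 0] by simp
  next
    case False
    then have tpos: "t > 0" using t by simp
    define k where "k = 1 - (1/t) *\<^sub>R h"
    have "t *\<^sub>R k = of_real t - h"
      using tpos by (simp add: k_def of_real_def scaleR_diff_right)
    then have "t * norm k \<le> t * 1"
      using t(2) tpos by (metis abs_of_pos mult.right_neutral norm_scaleR)
    then have nk: "norm k \<le> 1" using tpos by simp
    have sk: "star k = k"
      using assms by (simp add: k_def star_diff star_scaleR positive_selfadjoint)
    obtain s0 where s0: "star s0 = s0" "norm (1 - s0) \<le> 1" "s0 * s0 = 1 - k"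
      and B: "\<And>B. closed_subalgebra B \<Longrightarrow> k \<in> B \<Longrightarrow> s0 \<in> B"
      using ex_sqrt_one_minus[OF sk nk] by blast
    have "positive s0"
      unfolding positive_def using s0 by (auto intro!: exI[of _ 1])
    then have 1: "positive (sqrt t *\<^sub>R s0)"
      using tpos by (intro positive_scaleR) auto
    have 2: "(sqrt t *\<^sub>R s0) * (sqrt t *\<^sub>R s0) = h"
      using tpos s0(3) by (simp add: k_def)
    have 3: "sqrt t *\<^sub>R s0 \<in> B" if B': "closed_subalgebra B" "h \<in> B" for B
    proof -
      have "1 + (-1/t) *\<^sub>R h \<in> B" using B' unfolding closed_subalgebra_def by blast
      then have "k \<in> B" by (simp add: k_def)
      then show ?thesis using B[OF B'(1)] B'(1) by (simp add: closed_subalgebra_def)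
    qed
    show ?thesis by (rule that[OF 1 2 3])
  qed
qed

text \<open>
  After scaling to a \<open>y\<close> of norm 1, the element \<open>y + i sqrt (1 - y\<^sup>2)\<close> is unitary, so the root has
  norm at most 1, and therefore so has its square \<open>1 - y\<^sup>2\<close>.
\<close>

lemma positive_square:
  fixes x :: "'a::unital_cstar_algebra"
  assumes sx: "star x = x"
  shows "positive (x * x)"
proof (cases "x = 0")
  case False
  define n where "n = norm x"
  have n: "n > 0" using False by (simp add: n_def)
  define y where "y = (1/n) *\<^sub>R x"
  have sy: "star y = y" by (simp add: y_def star_scaleR sx)
  have ny: "norm y = 1" using n by (simp add: y_def n_def)
  have nk: "norm (y * y) \<le> 1" using norm_selfadjoint_square[OF sy] ny by simp
  obtain s where s: "star s = s" "s * s = 1 - y * y"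
    and B: "\<And>B. closed_subalgebra B \<Longrightarrow> y * y \<in> B \<Longrightarrow> s \<in> B"
    using ex_sqrt_one_minus[OF _ nk] sy star_mult by metis
  have "s * y = y * s"
    using B[OF closed_subalgebra_commutant[of y]] by (simp add: mult.assoc)
  then have "(norm s)\<^sup>2 \<le> norm (s * s + y * y)"
    by (intro norm_sq_le_norm_sum_squares s sy)
  also have "\<dots> = 1" using s by simp
  finally have "norm (1 - y * y) \<le> 1"
    using norm_selfadjoint_square[OF s(1)] s(2) by simp
  then have "positive (y * y)"
    unfolding positive_def using sy by (auto simp: star_mult intro!: exI[of _ 1])
  then have "positive ((n * n) *\<^sub>R (y * y))"
    by (intro positive_scaleR) auto
  moreover have "(n * n) *\<^sub>R (y * y) = x * x"
    using n by (simp add: y_def)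
  ultimately show ?thesis by simp
qed simp

lemma positive_mult_commuting:
  fixes a b :: "'a::unital_cstar_algebra"
  assumes "positive a" "positive b" and ab: "a * b = b * a"
  shows "positive (a * b)"
proof -
  obtain s where s: "positive s" "s * s = a" and sB: "\<And>B. closed_subalgebra B \<Longrightarrow> a \<in> B \<Longrightarrow> s \<in> B"
    using ex_positive_sqrt[OF assms(1)] by blast
  obtain r where r: "positive r" "r * r = b" and rB: "\<And>B. closed_subalgebra B \<Longrightarrow> b \<in> B \<Longrightarrow> r \<in> B"
    using ex_positive_sqrt[OF assms(2)] by blast
  have "s * b = b * s" using sB[OF closed_subalgebra_commutant[of b]] ab by simp
  then have c: "r * s = s * r" using rB[OF closed_subalgebra_commutant[of s]] by simp
  have "positive ((s * r) * (s * r))"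
    by (rule positive_square) (use s r c in \<open>simp add: star_mult positive_selfadjoint\<close>)
  also have "(s * r) * (s * r) = a * b"
    unfolding s(2)[symmetric] r(2)[symmetric] using c by (metis mult.assoc)
  finally show ?thesis .
qed

text \<open>
  With \<open>a = x\<^sup>2\<close> and \<open>t - a = y\<^sup>2\<close> for commuting \<open>x\<close> and \<open>y\<close>, the norm of \<open>x + i y\<close> is \<open>sqrt t\<close>.
\<close>

lemma positive_norm_le:
  fixes a :: "'a::unital_cstar_algebra"
  assumes "positive a" "positive (of_real t - a)" "0 \<le> t"
  shows "norm a \<le> t"
proof -
  obtain x where x: "positive x" "x * x = a" and xB: "\<And>B. closed_subalgebra B \<Longrightarrow> a \<in> B \<Longrightarrow> x \<in> B"
    using ex_positive_sqrt[OF assms(1)] by blast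
  obtain y where y: "positive y" "y * y = of_real t - a"
    and yB: "\<And>B. closed_subalgebra B \<Longrightarrow> of_real t - a \<in> B \<Longrightarrow> y \<in> B"
    using ex_positive_sqrt[OF assms(2)] by blast
  have "(of_real t - a) * x = x * (of_real t - a)"
    using x(2) by (auto simp: left_diff_distrib right_diff_distrib of_real_def mult.assoc)
  then have "y * x = x * y" using yB[OF closed_subalgebra_commutant[of x]] by simp
  then have "(norm x)\<^sup>2 \<le> norm (x * x + y * y)"
    using x y by (intro norm_sq_le_norm_sum_squares) (auto simp: positive_selfadjoint)
  also have "\<dots> = t" using x y assms(3) by simp
  finally show ?thesis
    using norm_selfadjoint_square[of x] x by (simp add: positive_selfadjoint)
qed

lemma positive_antisym:
  assumes "positive a" "positive (- a)"
  shows "a = 0"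
  using positive_norm_le[of a 0] assms by simp

text \<open>
  The product of the two positive elements is \<open>t\<^sup>2 - k\<^sup>2\<close>, which reduces the claim to the positive
  element \<open>k\<^sup>2\<close>.
\<close>

lemma norm_le_if_positive:
  fixes k :: "'a::unital_cstar_algebra"
  assumes sk: "star k = k" and p: "positive (of_real t - k)" "positive (of_real t + k)" and t: "0 \<le> t"
  shows "norm k \<le> t"
proof -
  have eq: "(of_real t - k) * (of_real t + k) = of_real (t * t) - k * k"
    "(of_real t + k) * (of_real t - k) = of_real (t * t) - k * k"
    by (simp_all add: algebra_simps of_real_def)
  have "positive (of_real (t * t) - k * k)"
    using positive_mult_commuting[OF p] unfolding eq by simp
  then have "norm (k * k) \<le> t * t"
    using positive_square[OF sk] t by (intro positive_norm_le) auto
  then have "(norm k)\<^sup>2 \<le> t\<^sup>2"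
    using norm_selfadjoint_square[OF sk] by (simp add: power2_eq_square)
  then show ?thesis using t by (simp add: power2_le_iff_abs_le)
qed

lemma ex_modulus:
  fixes h :: "'a::unital_cstar_algebra"
  assumes "star h = h"
  obtains m where "positive m" "m * m = h * h" "\<And>B. closed_subalgebra B \<Longrightarrow> h \<in> B \<Longrightarrow> m \<in> B"
proof -
  obtain m where m: "positive m" "m * m = h * h"
      and B: "\<And>B. closed_subalgebra B \<Longrightarrow> h * h \<in> B \<Longrightarrow> m \<in> B"
    using ex_positive_sqrt[OF positive_square[OF assms]] by blast
  have "m \<in> B" if "closed_subalgebra B" "h \<in> B" for B
    using B that by (auto simp: closed_subalgebra_def)
  with m show ?thesis by (rule that)
qed

text \<open>
  Here \<open>m\<close> stands for the modulus of \<open>h\<close> and \<open>n = m - h\<close> for twice its negative part.  From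
  \<open>n\<^sup>2 = 2 m n\<close> one gets \<open>n\<^sup>4 = 2 (m n\<^sup>2) n = 0\<close>, and a self-adjoint nilpotent element vanishes.
\<close>

lemma positive_if_annihilated:
  fixes h :: "'a::unital_cstar_algebra"
  assumes "star h = h" "positive m" "m * m = h * h" "m * h = h * m"
    and z: "m * ((m - h) * (m - h)) = 0"
  shows "positive h"
proof -
  define n where "n = m - h"
  have sn: "star n = n" using assms by (simp add: n_def star_diff positive_selfadjoint)
  have "n * n = 2 *\<^sub>R (m * n)"
    using assms(3,4) by (simp add: n_def algebra_simps scaleR_2)
  then have "(n * n) * (n * n) = (2 *\<^sub>R (m * n)) * (n * n)"
    by simp
  also have "\<dots> = 2 *\<^sub>R ((m * (n * n)) * n)"
    by (simp add: mult.assoc)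
  also have "\<dots> = 0" using z by (simp add: n_def)
  finally have "n * n = 0"
    using selfadjoint_square_eq_0[of "n * n"] sn by (simp add: star_mult)
  then have "n = 0" using selfadjoint_square_eq_0[OF sn] by simp
  with assms show ?thesis by (simp add: n_def)
qed

text \<open>
  In terms of the real part \<open>u\<close> and the imaginary part \<open>w\<close> of \<open>z\<close> the sum equals \<open>2 (u\<^sup>2 + w\<^sup>2)\<close>.
\<close>

lemma positive_star_mult_add:
  fixes z :: "'a::unital_cstar_algebra"
  shows "positive (star z * z + z * star z)"
proof -
  define u w where "u = (1/2) *\<^sub>R (z + star z)" and "w = (1/2) *\<^sub>R (\<i> *\<^sub>C (star z - z))"
  have "star u = u" by (simp add: u_def star_scaleR star_add star_star add.commute)
  moreover have "star w = w"
    by (simp add: w_def star_scaleR star_scaleC star_diff star_star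
        complex_vector.scale_minus_left complex_vector.scale_right_diff_distrib)
  ultimately have "positive (2 *\<^sub>R (u * u + w * w))"
    by (intro positive_scaleR positive_add positive_square) auto
  also have "2 *\<^sub>R (u * u + w * w) = star z * z + z * star z"
  proof -
    have "4 *\<^sub>R (u * u) = (z + star z) * (z + star z)"
      by (simp add: u_def)
    moreover have "4 *\<^sub>R (w * w) = - ((star z - z) * (star z - z))"
      by (simp add: w_def mult_scaleC_left mult_scaleC_right scaleC_scaleR)
    ultimately have "4 *\<^sub>R (u * u + w * w) = 2 *\<^sub>R (star z * z + z * star z)"
      by (simp add: scaleR_add_right algebra_simps scaleR_2)
    then have "(1/2) *\<^sub>R (4 *\<^sub>R (u * u + w * w)) = (1/2) *\<^sub>R (2 *\<^sub>R (star z * z + z * star z))"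
      by simp
    then show ?thesis by (simp only: scaleR_scaleR) simp
  qed
  finally show ?thesis .
qed

text \<open>
  Put \<open>z = y g\<close>.  Then \<open>z\<^sup>* z = - g\<^sup>4\<close> and \<open>z z\<^sup>* = - (y y\<^sup>*)\<^sup>2\<close> are both negative, although their sum
  is positive; hence \<open>g\<^sup>4 = 0\<close>.
\<close>

lemma star_mult_negative_eq_0:
  fixes y g :: "'a::unital_cstar_algebra"
  assumes sg: "star g = g" and y: "star y * y = - (g * g)"
  shows "g = 0"
proof -
  define z where "z = y * g"
  define b where "b = y * star y"
  have "star z * z = g * (star y * y) * g"
    by (simp add: z_def star_mult sg mult.assoc)
  then have zz: "star z * z = - ((g * g) * (g * g))"
    by (simp add: y mult.assoc)
  have "z * star z = y * (g * g) * star y"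
    by (simp add: z_def star_mult sg mult.assoc)
  also have "g * g = - (star y * y)" by (simp add: y)
  finally have zz': "z * star z = - (b * b)"
    by (simp add: b_def mult.assoc)
  have sb: "star b = b" by (simp add: b_def star_mult star_star)
  have sgg: "star (g * g) = g * g" by (simp add: star_mult sg)
  have "positive (- (b * b) + - ((g * g) * (g * g)))"
    using positive_star_mult_add[of z] zz zz' by (simp add: add.commute)
  from positive_add[OF positive_square[OF sb] this]
  have "positive (- ((g * g) * (g * g)))" by simp
  then have "(g * g) * (g * g) = 0"
    using positive_square[OF sgg] positive_antisym by blast
  then show ?thesis
    using selfadjoint_square_eq_0 sg sgg by blast
qed

text \<open>
  Kaplansky's theorem.  Let \<open>h = x\<^sup>* x\<close>, let \<open>m\<close> be its modulus and \<open>n = m - h\<close>, so that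
  \<open>n h = - m n\<close>.  Compressing by \<open>n\<close> gives \<open>(x n)\<^sup>* (x n) = n h n = - m n\<^sup>2 = - g\<^sup>2\<close> with
  \<open>g = sqrt m n\<close>, which is impossible unless \<open>g = 0\<close>, and then \<open>h\<close> has no negative part.
\<close>

theorem positive_star_mult:
  fixes x :: "'a::unital_cstar_algebra"
  shows "positive (star x * x)"
proof -
  define h where "h = star x * x"
  have sh: "star h = h" by (simp add: h_def star_mult star_star)
  obtain m where m: "positive m" "m * m = h * h"
    and mB: "\<And>B. closed_subalgebra B \<Longrightarrow> h \<in> B \<Longrightarrow> m \<in> B"
    using ex_modulus[OF sh] by blast
  have mh: "m * h = h * m"
    using mB[OF closed_subalgebra_commutant[of h]] by simp
  define n where "n = m - h"
  have sn: "star n = n" using m sh by (simp add: n_def star_diff positive_selfadjoint)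
  have mn: "m * n = n * m" using mh by (simp add: n_def algebra_simps)
  obtain r where r: "positive r" "r * r = m"
    and rB: "\<And>B. closed_subalgebra B \<Longrightarrow> m \<in> B \<Longrightarrow> r \<in> B"
    using ex_positive_sqrt[OF m(1)] by blast
  have rn: "r * n = n * r"
    using rB[OF closed_subalgebra_commutant[of n]] mn by simp
  define g where "g = r * n"
  have sg: "star g = g" by (simp add: g_def star_mult sn positive_selfadjoint[OF r(1)] rn)
  have gg: "g * g = m * (n * n)"
    unfolding g_def r(2)[symmetric] by (metis rn mult.assoc)
  have "n * h = - (m * n)"
    using m(2) mh by (simp add: n_def algebra_simps)
  moreover have "star (x * n) * (x * n) = (n * h) * n"
    by (simp add: h_def star_mult sn mult.assoc)
  ultimately have "star (x * n) * (x * n) = - (g * g)"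
    by (simp add: gg mult.assoc)
  then have "g = 0" using star_mult_negative_eq_0[OF sg] by blast
  then have "m * (n * n) = 0" using gg by simp
  then have "positive h"
    unfolding n_def by (intro positive_if_annihilated[OF sh m mh])
  then show ?thesis by (simp add: h_def)
qed

lemma positive_conjugate:
  fixes a e :: "'a::unital_cstar_algebra"
  assumes "positive a"
  shows "positive (star e * a * e)"
proof -
  obtain s where s: "positive s" "s * s = a"
    using ex_positive_sqrt[OF assms] by blast
  have "star e * a * e = star (s * e) * (s * e)"
    using s by (simp add: star_mult positive_selfadjoint flip: s(2)) (simp add: mult.assoc)
  then show ?thesis by (simp add: positive_star_mult)
qed

text \<open>
  One constant \<open>t\<close> works in the defining inequality of all \<open>k + e\<close> with small \<open>e\<close>, so the inequality
  survives the limit \<open>e \<rightarrow> 0\<close>.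
\<close>

lemma positive_closed:
  fixes k :: "'a::unital_cstar_algebra"
  assumes sk: "star k = k" and pos: "\<And>e. e > 0 \<Longrightarrow> positive (k + of_real e)"
  shows "positive k"
proof -
  \<comment> \<open>Then \<open>2 t\<close> bounds the norm of \<open>k + e\<close> for all \<open>e < 1\<close>.\<close>
  define t where "t = norm k + 1"
  have near: "norm (of_real t - k) \<le> t + 2 * e" if e: "0 < e" "e < 1" for e
  proof -
    define h where "h = k + of_real e"
    have h: "positive h" unfolding h_def by (rule pos) fact
    have "norm h \<le> norm k + e"
      unfolding h_def using norm_triangle_ineq[of k "of_real e"] e by simp
    then have "norm h \<le> 2 * t" using e norm_ge_zero[of k] unfolding t_def by argo
    then have "positive (of_real (2 * t) - h)"
      by (intro positive_norm_minus positive_selfadjoint h)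
    then have "positive (of_real t + (of_real t - h))"
      by (simp add: algebra_simps of_real_def flip: scaleR_add_left)
    moreover have "0 \<le> t" by (simp add: t_def)
    ultimately have "norm (of_real t - h) \<le> t"
      using h by (intro norm_le_if_positive) (auto simp: star_diff positive_selfadjoint)
    moreover have eq: "of_real t - k = (of_real t - h) + of_real e" by (simp add: h_def)
    have "norm (of_real t - k) \<le> norm (of_real t - h) + e"
      unfolding eq using norm_triangle_ineq[of "of_real t - h" "of_real e"] e by simp
    ultimately show ?thesis using e by linarith
  qed
  then have "norm (of_real t - k) \<le> t + e" if "e > 0" for e
  proof -
    have "norm (of_real t - k) \<le> t + 2 * min (e / 2) (1 / 2)"
      by (rule near) (use that in auto)
    then show ?thesis by linarith
  qed
  then have "norm (of_real t - k) \<le> t" by (rule field_le_epsilon)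
  then show ?thesis
    using sk unfolding positive_def t_def by (auto intro!: exI[of _ "norm k + 1"])
qed

section \<open>Positive functionals on Archimedean cones\<close>

text \<open>
  A real vector space \<open>V\<close> with order unit 1, ordered by a cone \<open>M0\<close> that is stable under a
  commutative semiring \<open>S\<close> of multipliers containing the nonnegative scalars.  With \<open>S\<close> equal to
  the nonnegative scalars this is the setting of the Hahn-Banach theorem for positive functionals;
  with \<open>S\<close> the positive elements of a commutative algebra it leads to characters.
  The order unit estimate is required in the form \<open>s a \<le> N s\<close>, with one \<open>N\<close> for all multipliers.
\<close>

locale archimedean_cone =
  fixes V S M0 :: "'a::real_algebra_1 set"
  assumes V_one: "1 \<in> V"
    and V_add: "a \<in> V \<Longrightarrow> b \<in> V \<Longrightarrow> a + b \<in> V"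
    and V_scaleR: "a \<in> V \<Longrightarrow> r *\<^sub>R a \<in> V"
    and S_V: "s \<in> S \<Longrightarrow> a \<in> V \<Longrightarrow> s * a \<in> V"
    and S_of_real: "0 \<le> r \<Longrightarrow> of_real r \<in> S"
    and S_add: "s \<in> S \<Longrightarrow> t \<in> S \<Longrightarrow> s + t \<in> S"
    and S_mult: "s \<in> S \<Longrightarrow> t \<in> S \<Longrightarrow> s * t \<in> S"
    and S_comm: "s \<in> S \<Longrightarrow> t \<in> S \<Longrightarrow> s * t = t * s"
    and M0_V: "M0 \<subseteq> V"
    and M0_one: "1 \<in> M0"
    and M0_add: "a \<in> M0 \<Longrightarrow> b \<in> M0 \<Longrightarrow> a + b \<in> M0"
    and M0_S: "s \<in> S \<Longrightarrow> a \<in> M0 \<Longrightarrow> s * a \<in> M0"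
    and M0_bound: "a \<in> V \<Longrightarrow> \<exists>N\<ge>0. \<forall>s\<in>S. N *\<^sub>R s - s * a \<in> M0"
    and M0_proper: "- 1 \<notin> M0"
begin

definition cones :: "'a set set" where
  "cones = {M. M0 \<subseteq> M \<and> M \<subseteq> V \<and> - 1 \<notin> M \<and>
     (\<forall>a\<in>M. \<forall>b\<in>M. a + b \<in> M) \<and> (\<forall>s\<in>S. \<forall>a\<in>M. s * a \<in> M)}"

lemma V_uminus: "a \<in> V \<Longrightarrow> - a \<in> V"
  using V_scaleR[of a "-1"] by simp

lemma V_diff: "a \<in> V \<Longrightarrow> b \<in> V \<Longrightarrow> a - b \<in> V"
  using V_add[of a "-b"] V_uminus by simp

lemma V_of_real: "of_real r \<in> V"
  using V_scaleR[OF V_one] by (simp add: of_real_def)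

lemma ex_maximal_cone: "\<exists>M\<in>cones. \<forall>X\<in>cones. M \<subseteq> X \<longrightarrow> X = M"
proof (rule subset_Zorn_nonempty)
  show "cones \<noteq> {}"
    using M0_V M0_add M0_S M0_proper by (auto simp: cones_def intro!: exI[of _ M0])
next
  fix \<C> assume ne: "\<C> \<noteq> {}" and "subset.chain cones \<C>"
  then have sub: "\<C> \<subseteq> cones" and chain: "\<And>X Y. X \<in> \<C> \<Longrightarrow> Y \<in> \<C> \<Longrightarrow> X \<subseteq> Y \<or> Y \<subseteq> X"
    by (auto simp: subset_chain_def)
  have "a + b \<in> \<Union>\<C>" if "a \<in> \<Union>\<C>" "b \<in> \<Union>\<C>" for a b
  proof -
    obtain X Y where "X \<in> \<C>" "Y \<in> \<C>" "a \<in> X" "b \<in> Y" using \<open>a \<in> \<Union>\<C>\<close> \<open>b \<in> \<Union>\<C>\<close> by blast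
    then obtain Z where "Z \<in> \<C>" "a \<in> Z" "b \<in> Z" using chain by blast
    then show ?thesis using sub by (auto simp: cones_def)
  qed
  moreover have "s * a \<in> \<Union>\<C>" if "s \<in> S" "a \<in> \<Union>\<C>" for s a
    using that sub by (fastforce simp: cones_def)
  moreover obtain X where "X \<in> \<C>" using ne by blast
  then have "M0 \<subseteq> \<Union>\<C>" using sub unfolding cones_def by blast
  moreover have "\<Union>\<C> \<subseteq> V" "- 1 \<notin> \<Union>\<C>"
    using sub by (auto simp: cones_def)
  ultimately show "\<Union>\<C> \<in> cones" by (simp add: cones_def)
qed

context
  fixes M assumes M: "M \<in> cones" and maximal: "\<And>X. X \<in> cones \<Longrightarrow> M \<subseteq> X \<Longrightarrow> X = M"
begin

lemma M_add: "a \<in> M \<Longrightarrow> b \<in> M \<Longrightarrow> a + b \<in> M"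
  and M_S: "s \<in> S \<Longrightarrow> a \<in> M \<Longrightarrow> s * a \<in> M"
  and M_V: "a \<in> M \<Longrightarrow> a \<in> V"
  and M0_M: "a \<in> M0 \<Longrightarrow> a \<in> M"
  and M_proper: "- 1 \<notin> M"
  using M by (auto simp: cones_def)

lemma M_one: "1 \<in> M" by (rule M0_M[OF M0_one])

lemma S_M: "s \<in> S \<Longrightarrow> s \<in> M"
  using M_S[OF _ M_one] by simp

lemma M_scaleR: "0 \<le> r \<Longrightarrow> a \<in> M \<Longrightarrow> r *\<^sub>R a \<in> M"
  using M_S[OF S_of_real] by (simp add: of_real_def)

lemma M_nonneg_of_real: "of_real r \<in> M \<Longrightarrow> 0 \<le> r"
proof (rule ccontr)
  assume "of_real r \<in> M" "\<not> 0 \<le> r"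
  then have "(- inverse r) *\<^sub>R of_real r \<in> M" by (intro M_scaleR) auto
  with \<open>\<not> 0 \<le> r\<close> show False using M_proper by (simp add: of_real_def)
qed

text \<open>
  Otherwise \<open>M + S a\<close> would be a larger cone.
\<close>

lemma ex_minus_one_decomposition:
  assumes "a \<in> V" "a \<notin> M"
  shows "\<exists>m\<in>M. \<exists>s\<in>S. - 1 = m + s * a"
proof (rule ccontr)
  assume neg: "\<not> ?thesis"
  define X where "X = {m + s * a | m s. m \<in> M \<and> s \<in> S}"
  have zero: "0 \<in> S" using S_of_real[of 0] by simp
  have MX: "M \<subseteq> X" unfolding X_def using zero by force
  have "0 \<in> M" using S_M[OF zero] .
  moreover have "1 \<in> S" using S_of_real[of 1] by simp
  ultimately have aX: "a \<in> X" unfolding X_def by force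
  have "X \<in> cones"
    unfolding cones_def
  proof (intro CollectI conjI ballI)
    show "M0 \<subseteq> X" using MX M0_M by blast
    show "X \<subseteq> V" using M_V S_V V_add assms(1) by (auto simp: X_def)
    show "- 1 \<notin> X" using neg by (auto simp: X_def)
  next
    fix x y assume "x \<in> X" "y \<in> X"
    then obtain m n s t where *: "x = m + s * a" "y = n + t * a" "m \<in> M" "n \<in> M" "s \<in> S" "t \<in> S"
      by (auto simp: X_def)
    then have "x + y = (m + n) + (s + t) * a" by (simp add: distrib_right)
    with * show "x + y \<in> X" unfolding X_def using M_add S_add by blast
  next
    fix t x assume "t \<in> S" "x \<in> X"
    then obtain m s where *: "x = m + s * a" "m \<in> M" "s \<in> S" by (auto simp: X_def)
    then have "t * x = t * m + (t * s) * a" by (simp add: distrib_left mult.assoc)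
    with * \<open>t \<in> S\<close> show "t * x \<in> X" unfolding X_def using M_S S_mult by blast
  qed
  then show False using maximal MX aX assms(2) by blast
qed

text \<open>
  Suppose neither \<open>a\<close> nor \<open>- a\<close> belongs to \<open>M\<close>, so that \<open>- 1 = m1 + p1 a = m2 - p2 a\<close>.  Eliminating
  \<open>a\<close> shows \<open>- (p1 + p2) \<in> M\<close>, hence \<open>- p1 \<in> M\<close>.  Because \<open>p1 a \<ge> - N p1\<close>, the element
  \<open>- 1 = m1 + p1 a\<close> then lies in \<open>M\<close> as well.
\<close>

lemma M_total:
  assumes a: "a \<in> V"
  shows "a \<in> M \<or> - a \<in> M"
proof (rule ccontr)
  assume neg: "\<not> ?thesis"
  obtain m1 p1 where 1: "m1 \<in> M" "p1 \<in> S" "- 1 = m1 + p1 * a"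
    using ex_minus_one_decomposition[OF a] neg by blast
  obtain m2 p2 where 2: "m2 \<in> M" "p2 \<in> S" "- 1 = m2 + p2 * (- a)"
    using ex_minus_one_decomposition[OF V_uminus[OF a]] neg by blast
  have m1: "m1 = - 1 - p1 * a" and m2: "m2 = - 1 + p2 * a"
    using 1 2 by (auto simp: algebra_simps)
  have "p2 * m1 + p1 * m2 = - p1 - p2"
    unfolding m1 m2 using S_comm[OF 1(2) 2(2)]
    by (simp add: algebra_simps) (simp add: mult.assoc[symmetric])
  then have "- p1 - p2 \<in> M" using M_add M_S 1 2 by metis
  then have p1: "- p1 \<in> M" using M_add[OF _ S_M[OF 2(2)]] by fastforce
  obtain N where N: "N \<ge> 0" "\<forall>s\<in>S. N *\<^sub>R s - s * (- a) \<in> M0"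
    using M0_bound[OF V_uminus[OF a]] by blast
  then have "N *\<^sub>R p1 + p1 * a \<in> M" using M0_M 1 by fastforce
  moreover have "N *\<^sub>R (- p1) \<in> M" using M_scaleR N p1 by blast
  ultimately have "m1 + ((N *\<^sub>R p1 + p1 * a) + N *\<^sub>R (- p1)) \<in> M"
    using M_add 1 by blast
  then show False using M_proper by (simp add: m1)
qed

text \<open>
  Since \<open>M\<close> is a half space, every \<open>a\<close> determines a cut of the real line into those \<open>r\<close> with
  \<open>r - a \<in> M\<close> and those with \<open>a - r \<in> M\<close>; the functional assigns this cut to \<open>a\<close>.
\<close>

definition cone_value :: "'a \<Rightarrow> real" where
  "cone_value a = Inf {r. of_real r - a \<in> M}"

lemma M_shift:
  assumes "of_real r - a \<in> M" "r \<le> r'"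
  shows "of_real r' - a \<in> M"
  using M_add[OF assms(1) M_scaleR[OF _ M_one, of "r' - r"]] assms(2)
  by (simp add: of_real_def algebra_simps)

lemma M_bound: "a \<in> V \<Longrightarrow> \<exists>N. of_real N - a \<in> M"
  using M0_bound[of a] M0_M S_of_real[of 1] by (force simp: of_real_def)

lemma M_lower:
  assumes "a \<in> V" obtains N where "\<And>r. of_real r - a \<in> M \<Longrightarrow> N \<le> r"
proof -
  obtain N where "of_real N - (- a) \<in> M" using M_bound[OF V_uminus[OF assms]] by blast
  then have "of_real r - a \<in> M \<Longrightarrow> - N \<le> r" for r
    using M_add[of "of_real N - (- a)" "of_real r - a"] M_nonneg_of_real[of "N + r"] by simp
  then show ?thesis by (rule that)
qed

lemma above_cone_value:
  assumes "a \<in> V" "cone_value a < r"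
  shows "of_real r - a \<in> M"
proof -
  have "{r. of_real r - a \<in> M} \<noteq> {}" using M_bound[OF assms(1)] by blast
  from cInf_lessD[OF this assms(2)[unfolded cone_value_def]]
  obtain r' where "of_real r' - a \<in> M" "r' < r" by auto
  then show ?thesis using M_shift by (metis less_imp_le)
qed

lemma cone_value_le:
  assumes "a \<in> V" "of_real r - a \<in> M"
  shows "cone_value a \<le> r"
  unfolding cone_value_def
  by (rule cInf_lower) (use assms M_lower[OF assms(1)] in \<open>auto simp: bdd_below_def\<close>)

lemma below_cone_value:
  assumes "a \<in> V" "r < cone_value a"
  shows "a - of_real r \<in> M"
proof -
  have "of_real r - a \<notin> M" using cone_value_le[OF assms(1)] assms(2) by force
  then show ?thesis
    using M_total[OF V_diff[OF V_of_real assms(1)], of r] by simp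
qed

lemma cone_value_ge:
  assumes "a \<in> V" "a - of_real r \<in> M"
  shows "r \<le> cone_value a"
proof (rule ccontr)
  assume "\<not> ?thesis"
  then obtain r' where r': "cone_value a < r'" "r' < r" using dense by (metis not_le)
  have "(of_real r' - a) + (a - of_real r) \<in> M"
    using above_cone_value[OF assms(1) r'(1)] assms(2) M_add by blast
  then have "of_real (r' - r) \<in> M" by simp
  then show False using M_nonneg_of_real[of "r' - r"] r'(2) by simp
qed

lemma cone_value_add:
  assumes a: "a \<in> V" and b: "b \<in> V"
  shows "cone_value (a + b) = cone_value a + cone_value b"
proof (rule antisym)
  note V_add[OF a b]
  show "cone_value (a + b) \<le> cone_value a + cone_value b"
  proof (rule field_le_epsilon)
    fix e :: real assume "e > 0"
    then have "(of_real (cone_value a + e/2) - a) + (of_real (cone_value b + e/2) - b) \<in> M"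
      by (intro M_add above_cone_value a b) auto
    also have "(of_real (cone_value a + e/2) - a) + (of_real (cone_value b + e/2) - b)
       = of_real (cone_value a + cone_value b + e) - (a + b)"
      by (simp add: of_real_def algebra_simps flip: scaleR_add_left)
    finally show "cone_value (a + b) \<le> cone_value a + cone_value b + e"
      by (intro cone_value_le V_add a b)
  qed
  show "cone_value a + cone_value b \<le> cone_value (a + b)"
  proof (rule field_le_epsilon)
    fix e :: real assume "e > 0"
    then have "(a - of_real (cone_value a - e/2)) + (b - of_real (cone_value b - e/2)) \<in> M"
      by (intro M_add below_cone_value a b) auto
    also have "(a - of_real (cone_value a - e/2)) + (b - of_real (cone_value b - e/2))
       = (a + b) - of_real (cone_value a + cone_value b - e)"
      by (simp add: of_real_def algebra_simps flip: scaleR_add_left)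
    finally have "cone_value a + cone_value b - e \<le> cone_value (a + b)"
      by (intro cone_value_ge V_add a b)
    then show "cone_value a + cone_value b \<le> cone_value (a + b) + e" by simp
  qed
qed

lemma cone_value_nonneg: "a \<in> M \<Longrightarrow> 0 \<le> cone_value a"
  using cone_value_ge[OF M_V, of a 0] by simp

lemma cone_value_of_real: "cone_value (of_real r) = r"
proof -
  have "0 \<in> M" using S_M[OF S_of_real[of 0]] by simp
  then show ?thesis
    using cone_value_ge[OF V_of_real, of r r] cone_value_le[OF V_of_real, of r r] by simp
qed

lemma cone_value_uminus: "a \<in> V \<Longrightarrow> cone_value (- a) = - cone_value a"
  using cone_value_add[of a "-a"] V_uminus cone_value_of_real[of 0] by simp

lemma cone_value_scaleR_pos:
  assumes "a \<in> V" "0 < r"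
  shows "cone_value (r *\<^sub>R a) = r * cone_value a"
proof -
  have le: "cone_value (s *\<^sub>R b) \<le> s * cone_value b" if b: "b \<in> V" and s: "0 < s" for s b
  proof (rule field_le_epsilon)
    fix e :: real assume e: "e > 0"
    have "s *\<^sub>R (of_real (cone_value b + e / s) - b) \<in> M"
      using e s b by (intro M_scaleR above_cone_value) auto
    also have "s *\<^sub>R (of_real (cone_value b + e / s) - b) = of_real (s * cone_value b + e) - s *\<^sub>R b"
      using s by (simp add: of_real_def algebra_simps)
    finally show "cone_value (s *\<^sub>R b) \<le> s * cone_value b + e"
      by (intro cone_value_le V_scaleR b)
  qed
  have "cone_value (inverse r *\<^sub>R (r *\<^sub>R a)) \<le> inverse r * cone_value (r *\<^sub>R a)"
    by (rule le) (use assms V_scaleR in auto)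
  then have "r * cone_value a \<le> cone_value (r *\<^sub>R a)"
    using assms by (simp add: field_simps)
  with le[OF assms] show ?thesis by simp
qed

lemma cone_value_scaleR:
  assumes "a \<in> V"
  shows "cone_value (r *\<^sub>R a) = r * cone_value a"
proof -
  consider "r > 0" | "r = 0" | "r < 0" by linarith
  then show ?thesis
  proof cases
    case 3
    then show ?thesis
      using cone_value_scaleR_pos[OF assms, of "-r"] cone_value_uminus[OF V_scaleR[OF assms, of r]]
      by simp
  qed (use cone_value_scaleR_pos assms cone_value_of_real[of 0] in auto)
qed

end

text \<open>
  The cone \<open>M\<close> is part of the conclusion because multiplicativity of \<open>f\<close> will be derived from its
  stability under \<open>S\<close>.
\<close>

theorem ex_positive_functional:
  obtains f :: "'a \<Rightarrow> real" and M where
    "\<And>a b. a \<in> V \<Longrightarrow> b \<in> V \<Longrightarrow> f (a + b) = f a + f b"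
    "\<And>a r. a \<in> V \<Longrightarrow> f (r *\<^sub>R a) = r * f a"
    "f 1 = 1" "M0 \<subseteq> M" "\<And>a. a \<in> M \<Longrightarrow> 0 \<le> f a" "\<And>a. a \<in> V \<Longrightarrow> 0 < f a \<Longrightarrow> a \<in> M"
    "\<And>a b. a \<in> M \<Longrightarrow> b \<in> M \<Longrightarrow> a + b \<in> M" "\<And>s a. s \<in> S \<Longrightarrow> a \<in> M \<Longrightarrow> s * a \<in> M"
proof -
  obtain M where M: "M \<in> cones" "\<And>X. X \<in> cones \<Longrightarrow> M \<subseteq> X \<Longrightarrow> X = M"
    using ex_maximal_cone by blast
  show ?thesis
  proof (rule that[of "cone_value M" M])
    show "cone_value M 1 = 1" using cone_value_of_real[OF M, of 1] by simp
    show "a \<in> M" if "a \<in> V" "0 < cone_value M a" for a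
      using below_cone_value[OF M that(1), of 0] that by simp
    show "M0 \<subseteq> M" using M0_M[OF M] by blast
  qed (use cone_value_add[OF M] cone_value_scaleR[OF M] cone_value_nonneg[OF M] M_add[OF M] M_S[OF M] in blast)+
qed

end

section \<open>Functionals on unital C*-subalgebras\<close>

definition re_part :: "'a::unital_cstar_algebra \<Rightarrow> 'a" where
  "re_part x = (1/2) *\<^sub>R (x + star x)"

definition im_part :: "'a::unital_cstar_algebra \<Rightarrow> 'a" where
  "im_part x = (1/2) *\<^sub>R (\<i> *\<^sub>C (star x - x))"

lemma star_re_part: "star (re_part x) = re_part x"
  by (simp add: re_part_def star_scaleR star_add star_star add.commute)

lemma star_im_part: "star (im_part x) = im_part x"
  by (simp add: im_part_def star_scaleR star_scaleC star_diff star_star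
      complex_vector.scale_minus_left complex_vector.scale_right_diff_distrib)

lemma re_part_plus_im_part: "re_part x + \<i> *\<^sub>C im_part x = x"
proof -
  have "re_part x + \<i> *\<^sub>C im_part x = (1/2) *\<^sub>R ((x + star x) - (star x - x))"
    by (simp add: re_part_def im_part_def scaleC_scaleR algebra_simps)
  also have "\<dots> = x" by (simp flip: scaleR_2)
  finally show ?thesis .
qed

lemma star_cartesian:
  "star a = a \<Longrightarrow> star b = b \<Longrightarrow> star (a + \<i> *\<^sub>C b) = a - \<i> *\<^sub>C b"
  by (simp add: star_add star_scaleC complex_vector.scale_minus_left)

lemma cartesian_parts:
  assumes "star a = a" "star b = b"
  shows "re_part (a + \<i> *\<^sub>C b) = a" "im_part (a + \<i> *\<^sub>C b) = b"
proof -
  show "re_part (a + \<i> *\<^sub>C b) = a"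
    unfolding re_part_def star_cartesian[OF assms] by (simp flip: scaleR_2)
  have "im_part (a + \<i> *\<^sub>C b) = (1/2) *\<^sub>R (b + b)"
    unfolding im_part_def star_cartesian[OF assms]
    by (simp add: complex_vector.scale_right_diff_distrib complex_vector.scale_right_distrib)
  then show "im_part (a + \<i> *\<^sub>C b) = b" by (simp flip: scaleR_2)
qed

lemma scaleC_cartesian:
  "c *\<^sub>C (a + \<i> *\<^sub>C b) = (Re c *\<^sub>R a - Im c *\<^sub>R b) + \<i> *\<^sub>C (Im c *\<^sub>R a + Re c *\<^sub>R b)"
proof -
  have c: "c = of_real (Re c) + \<i> * of_real (Im c)" by (simp add: complex_eq)
  have *: "c *\<^sub>C x = Re c *\<^sub>R x + \<i> *\<^sub>C (Im c *\<^sub>R x)" for x :: 'a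
    by (subst c) (simp only: scaleC_add_left scaleC_scaleC[symmetric] scaleC_of_real)
  show ?thesis
    unfolding * by (simp add: complex_vector.scale_right_distrib scaleC_scaleR algebra_simps)
qed

locale unital_subalgebra =
  fixes A :: "'a::unital_cstar_algebra set"
  assumes subalgebra: "cstar_subalgebra A" and one_mem [simp]: "1 \<in> A"
begin

lemma zero_mem [simp]: "0 \<in> A"
  and closed: "closed A"
  and add_mem [simp]: "x \<in> A \<Longrightarrow> y \<in> A \<Longrightarrow> x + y \<in> A"
  and mult_mem [simp]: "x \<in> A \<Longrightarrow> y \<in> A \<Longrightarrow> x * y \<in> A"
  and star_mem [simp]: "x \<in> A \<Longrightarrow> star x \<in> A"
  and scaleC_mem [simp]: "x \<in> A \<Longrightarrow> c *\<^sub>C x \<in> A"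
  using subalgebra by (auto simp: cstar_subalgebra_def)

lemma scaleR_mem [simp]: "x \<in> A \<Longrightarrow> r *\<^sub>R x \<in> A"
  using scaleC_mem[of x "of_real r"] by (simp add: scaleC_of_real)

lemma uminus_mem [simp]: "x \<in> A \<Longrightarrow> - x \<in> A"
  using scaleR_mem[of x "-1"] by simp

lemma diff_mem [simp]: "x \<in> A \<Longrightarrow> y \<in> A \<Longrightarrow> x - y \<in> A"
  using add_mem[of x "-y"] by simp

lemma of_real_mem [simp]: "of_real r \<in> A"
  by (simp add: of_real_def)

lemma parts_mem [simp]: "x \<in> A \<Longrightarrow> re_part x \<in> A" "x \<in> A \<Longrightarrow> im_part x \<in> A"
  by (simp_all add: re_part_def im_part_def)

lemma closed_subalgebra: "closed_subalgebra A"
  using closed by (simp add: closed_subalgebra_def)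

lemma ex_sqrt_mem:
  assumes "positive h" "h \<in> A"
  obtains s where "s \<in> A" "positive s" "s * s = h"
  using ex_positive_sqrt[OF assms(1)] closed_subalgebra assms(2) by metis

lemma functional_add: "linear_functional_on A f \<Longrightarrow> x \<in> A \<Longrightarrow> y \<in> A \<Longrightarrow> f (x + y) = f x + f y"
  and functional_scaleC: "linear_functional_on A f \<Longrightarrow> x \<in> A \<Longrightarrow> f (c *\<^sub>C x) = c * f x"
  by (auto simp: linear_functional_on_def)

lemma functional_scaleR:
  "linear_functional_on A f \<Longrightarrow> x \<in> A \<Longrightarrow> f (r *\<^sub>R x) = of_real r * f x"
  using functional_scaleC[of f x "of_real r"] by (simp add: scaleC_of_real)

lemma functional_zero: "linear_functional_on A f \<Longrightarrow> f 0 = 0"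
  using functional_scaleC[of f 0 0] by simp

lemma functional_uminus: "linear_functional_on A f \<Longrightarrow> x \<in> A \<Longrightarrow> f (- x) = - f x"
  using functional_scaleR[of f x "-1"] by simp

lemma functional_diff:
  "linear_functional_on A f \<Longrightarrow> x \<in> A \<Longrightarrow> y \<in> A \<Longrightarrow> f (x - y) = f x - f y"
  using functional_add[of f x "-y"] by (simp add: functional_uminus)

lemmas functional_simps = functional_add functional_scaleC functional_scaleR functional_zero
  functional_uminus functional_diff

lemma functional_eqI:
  "linear_functional_on A f \<Longrightarrow> linear_functional_on A g \<Longrightarrow> (\<And>x. x \<in> A \<Longrightarrow> f x = g x) \<Longrightarrow> f = g"
  unfolding linear_functional_on_def by (blast intro: extensionalityI)

lemma state_linear: "f \<in> states A \<Longrightarrow> linear_functional_on A f"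
  and state_one: "f \<in> states A \<Longrightarrow> f 1 = 1"
  and state_star_mult: "f \<in> states A \<Longrightarrow> x \<in> A \<Longrightarrow> 0 \<le> f (star x * x)"
  by (auto simp: states_def)

lemma functional_of_real: "linear_functional_on A f \<Longrightarrow> f 1 = 1 \<Longrightarrow> f (of_real r) = of_real r"
  using functional_scaleR[of f 1 r] by (simp add: of_real_def)

lemma state_positive: "f \<in> states A \<Longrightarrow> x \<in> A \<Longrightarrow> positive x \<Longrightarrow> 0 \<le> f x"
  using ex_sqrt_mem state_star_mult positive_selfadjoint by metis

lemma state_star:
  assumes f: "f \<in> states A" and x: "x \<in> A"
  shows "f (star x) = cnj (f x)"
proof -
  note L = state_linear[OF f]
  have *: "Im (f (star y)) = - Im (f y)" if y: "y \<in> A" for y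
  proof -
    have "f (star (y + 1) * (y + 1)) = f (star y * y) + f (star y) + f y + 1"
      using y by (simp add: star_add algebra_simps functional_simps[OF L] state_one[OF f])
    then have "Im (f (star y * y) + f (star y) + f y + 1) = 0"
      using state_star_mult[OF f, of "y + 1"] y by (simp add: less_eq_complex_def)
    moreover have "Im (f (star y * y)) = 0"
      using state_star_mult[OF f y] by (simp add: less_eq_complex_def)
    ultimately show ?thesis by simp
  qed
  have "Re (f (star x)) = Re (f x)"
    using *[of "\<i> *\<^sub>C x"] x by (simp add: star_scaleC functional_simps[OF L])
  with *[OF x] show ?thesis by (simp add: complex_eq_iff)
qed

lemma state_Cauchy_Schwarz:
  assumes f: "f \<in> states A" and x: "x \<in> A" and y: "y \<in> A"
  shows "(cmod (f (star x * y)))\<^sup>2 \<le> Re (f (star x * x)) * Re (f (star y * y))"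
proof -
  note L = state_linear[OF f]
  define X Y where "X = Re (f (star x * x))" and "Y = Re (f (star y * y))"
  define b where "b = f (star x * y)"
  define B where "B = (cmod b)\<^sup>2"
  have X: "f (star x * x) = of_real X" "0 \<le> X" and Y: "f (star y * y) = of_real Y" "0 \<le> Y"
    using state_star_mult[OF f x] state_star_mult[OF f y]
    by (auto simp: X_def Y_def less_eq_complex_def complex_eq_iff)
  have b': "f (star y * x) = cnj b"
    using state_star[OF f, of "star x * y"] x y by (simp add: b_def star_mult star_star)
  have bb: "cnj b * b = of_real B" "b * cnj b = of_real B"
    using complex_norm_square[of b] by (simp_all add: B_def mult.commute)
  \<comment> \<open>Positivity at \<open>y - t b x\<close>; the choice \<open>t = 1 / X\<close> is optimal, and for \<open>X = 0\<close> large \<open>t\<close> force \<open>b = 0\<close>.\<close>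
  have quad: "0 \<le> Y - 2 * t * B + t\<^sup>2 * B * X" for t
  proof -
    define c where "c = of_real t * b"
    have "f (star (y - c *\<^sub>C x) * (y - c *\<^sub>C x)) =
        f (star y * y) - c * f (star y * x) - cnj c * f (star x * y) + cnj c * c * f (star x * x)"
      using x y by (simp add: star_diff star_scaleC algebra_simps mult_scaleC_left
          mult_scaleC_right scaleC_scaleC functional_simps[OF L])
    also have "\<dots> = of_real Y - of_real t * (b * cnj b) - of_real t * (cnj b * b)
        + of_real (t * t) * (cnj b * b) * of_real X"
      unfolding X Y b' b_def[symmetric] c_def by (simp add: algebra_simps)
    also have "\<dots> = of_real (Y - 2 * t * B + t\<^sup>2 * B * X)"
      unfolding bb by (simp add: power2_eq_square)
    finally show ?thesis
      using state_star_mult[OF f, of "y - c *\<^sub>C x"] x y by (simp add: less_eq_complex_def)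
  qed
  have "B \<le> X * Y"
  proof (cases "X = 0")
    case False
    then have "X > 0" using X by simp
    have "0 \<le> X * (Y - 2 * (1/X) * B + (1/X)\<^sup>2 * B * X)"
      using quad[of "1/X"] \<open>X > 0\<close> by simp
    also have "\<dots> = X * Y - B" using \<open>X > 0\<close> by (simp add: field_simps power2_eq_square)
    finally show ?thesis by simp
  next
    case True
    have "B = 0"
    proof (rule ccontr)
      assume "B \<noteq> 0"
      then have "B > 0" by (simp add: B_def)
      then have "Y - 2 * ((Y + 1) / (2 * B)) * B < 0" by (simp add: field_simps)
      then show False using quad[of "(Y + 1) / (2 * B)"] True by simp
    qed
    then show ?thesis using True by simp
  qed
  then show ?thesis by (simp add: B_def b_def X_def Y_def)
qed

lemma state_norm_le:
  assumes f: "f \<in> states A" and x: "x \<in> A"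
  shows "cmod (f x) \<le> norm x"
proof -
  have "positive (of_real ((norm x)\<^sup>2) - star x * x)"
    by (intro positive_norm_minus) (simp_all add: star_mult star_star cstar_identity)
  then have "0 \<le> f (of_real ((norm x)\<^sup>2) - star x * x)"
    by (intro state_positive[OF f]) (use x in \<open>simp_all del: of_real_power\<close>)
  then have "Re (f (star x * x)) \<le> (norm x)\<^sup>2"
    using x functional_of_real[OF state_linear[OF f] state_one[OF f], of "(norm x)\<^sup>2"]
    by (simp add: functional_simps[OF state_linear[OF f]] less_eq_complex_def del: of_real_power)
  moreover have "(cmod (f x))\<^sup>2 \<le> Re (f (star x * x))"
    using state_Cauchy_Schwarz[OF f one_mem x] state_one[OF f] by simp
  ultimately show ?thesis by (meson norm_ge_zero order_trans power2_le_imp_le)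
qed

lemma complexification:
  fixes f :: "'a \<Rightarrow> real"
  assumes add: "\<And>x y. x \<in> A \<Longrightarrow> star x = x \<Longrightarrow> y \<in> A \<Longrightarrow> star y = y \<Longrightarrow> f (x + y) = f x + f y"
    and scale: "\<And>x r. x \<in> A \<Longrightarrow> star x = x \<Longrightarrow> f (r *\<^sub>R x) = r * f x"
  obtains F where "linear_functional_on A F"
    "\<And>x. x \<in> A \<Longrightarrow> F x = Complex (f (re_part x)) (f (im_part x))"
    "\<And>x. x \<in> A \<Longrightarrow> star x = x \<Longrightarrow> F x = of_real (f x)"
proof -
  define F where "F = (\<lambda>x\<in>A. Complex (f (re_part x)) (f (im_part x)))"
  have diff: "f (x - y) = f x - f y" if "x \<in> A" "star x = x" "y \<in> A" "star y = y" for x y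
    using add[of x "- y"] scale[of y "-1"] that by simp
  have F: "F (a + \<i> *\<^sub>C b) = Complex (f a) (f b)"
    if "a \<in> A" "b \<in> A" "star a = a" "star b = b" for a b
    using that by (simp add: F_def cartesian_parts)
  have F_add: "F (x + y) = F x + F y" if xy: "x \<in> A" "y \<in> A" for x y
  proof -
    have "x + y = (re_part x + re_part y) + \<i> *\<^sub>C (im_part x + im_part y)"
      using re_part_plus_im_part[of x] re_part_plus_im_part[of y]
      by (metis (no_types, lifting) add.assoc add.left_commute complex_vector.scale_right_distrib)
    then have "F (x + y) = Complex (f (re_part x + re_part y)) (f (im_part x + im_part y))"
      using xy by (simp add: F star_add star_re_part star_im_part)
    then show ?thesis
      using xy by (simp add: F_def add star_re_part star_im_part complex_eq_iff)
  qed
  have F_scale: "F (c *\<^sub>C x) = c * F x" if x: "x \<in> A" for c x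
  proof -
    have "c *\<^sub>C x = c *\<^sub>C (re_part x + \<i> *\<^sub>C im_part x)" by (simp add: re_part_plus_im_part)
    then have "F (c *\<^sub>C x) = Complex (f (Re c *\<^sub>R re_part x - Im c *\<^sub>R im_part x))
        (f (Im c *\<^sub>R re_part x + Re c *\<^sub>R im_part x))"
      unfolding scaleC_cartesian
      using x by (simp add: F star_add star_diff star_scaleR star_re_part star_im_part)
    then show ?thesis
      using x by (simp add: F_def add diff scale star_scaleR star_re_part star_im_part complex_eq_iff)
  qed
  show ?thesis
  proof (rule that)
    show "linear_functional_on A F"
      using F_add F_scale by (simp add: linear_functional_on_def F_def)
    show "F x = Complex (f (re_part x)) (f (im_part x))" if "x \<in> A" for x
      using that by (simp add: F_def)
    show "F x = of_real (f x)" if "x \<in> A" "star x = x" for x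
      using F[OF that(1) zero_mem that(2)] scale[of 0 0] by (simp add: complex_of_real_def)
  qed
qed

end

lemma unital_subalgebra_UNIV: "unital_subalgebra (UNIV :: 'a::unital_cstar_algebra set)"
  by unfold_locales (auto simp: cstar_subalgebra_def)

section \<open>Gelfand theory of a commutative C*-algebra\<close>

locale abelian_subalgebra = unital_subalgebra D for D :: "'a::unital_cstar_algebra set" +
  assumes commute: "x \<in> D \<Longrightarrow> y \<in> D \<Longrightarrow> x * y = y * x"
begin

lemma character_linear: "\<rho> \<in> characters D \<Longrightarrow> linear_functional_on D \<rho>"
  and character_mult: "\<rho> \<in> characters D \<Longrightarrow> x \<in> D \<Longrightarrow> y \<in> D \<Longrightarrow> \<rho> (x * y) = \<rho> x * \<rho> y"
  by (auto simp: characters_def)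

lemma character_one: "\<rho> \<in> characters D \<Longrightarrow> \<rho> 1 = 1"
proof -
  assume r: "\<rho> \<in> characters D"
  then obtain x where x: "x \<in> D" "\<rho> x \<noteq> 0" by (auto simp: characters_def)
  have "\<rho> x * \<rho> 1 = \<rho> x" using character_mult[OF r x(1) one_mem] by simp
  with x show ?thesis by simp
qed

lemma character_of_real: "\<rho> \<in> characters D \<Longrightarrow> \<rho> (of_real r) = of_real r"
  by (intro functional_of_real character_linear character_one)

lemmas character_simps = functional_simps[OF character_linear] character_mult character_one
  character_of_real

text \<open>
  The Neumann series.
\<close>

lemma ex_inverse_one_minus:
  assumes k: "k \<in> D" "norm k < 1"
  obtains y where "y \<in> D" "y * (1 - k) = 1"
proof -
  have s: "summable (\<lambda>n. k ^ n)"
    using k by (intro summable_norm_cancel[OF summable_comparison_test'[OF summable_geometric[of "norm k"]]])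
      (auto simp: norm_power_ineq)
  define y where "y = (\<Sum>n. k ^ n)"
  have "y \<in> D"
    using closed_subalgebra_suminf[OF closed_subalgebra k(1), of "\<lambda>_. 1"] s by (simp add: y_def)
  moreover have "y = 1 + y * k"
    using suminf_split_head[OF s] suminf_mult2[OF s, of k]
    by (simp add: y_def power_commutes algebra_simps)
  then have "y * (1 - k) = 1" by (simp add: algebra_simps)
  ultimately show ?thesis by (rule that)
qed

text \<open>
  If \<open>\<bar>\<rho> x\<bar> > norm x\<close>, then \<open>1 - x / \<rho> x\<close> is invertible in \<open>D\<close>, although \<open>\<rho>\<close> annihilates it.
\<close>

lemma character_norm_le:
  assumes r: "\<rho> \<in> characters D" and x: "x \<in> D"
  shows "cmod (\<rho> x) \<le> norm x"
proof (rule ccontr)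
  assume neg: "\<not> ?thesis"
  then have nz: "\<rho> x \<noteq> 0" by auto
  define k where "k = (1 / \<rho> x) *\<^sub>C x"
  have k: "k \<in> D" "norm k < 1"
    using x neg nz by (auto simp: k_def norm_scaleC norm_divide field_simps)
  obtain y where "y \<in> D" "y * (1 - k) = 1" using ex_inverse_one_minus[OF k] .
  moreover have "\<rho> k = 1" using x nz by (simp add: k_def character_simps[OF r])
  ultimately show False
    using character_mult[OF r, of y "1 - k"] k by (simp add: character_simps[OF r])
qed

text \<open>
  Arens' trick: for real \<open>t\<close> the number \<open>\<rho> (x + i t)\<close> is bounded by the norm of \<open>x + i t\<close>, whose
  square is at most \<open>(norm x)\<^sup>2 + t\<^sup>2\<close>.  An imaginary part \<open>b\<close> of \<open>\<rho> x\<close> would contribute the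
  unbounded term \<open>2 b t\<close>.
\<close>

lemma character_selfadjoint:
  assumes r: "\<rho> \<in> characters D" and x: "x \<in> D" "star x = x"
  shows "Im (\<rho> x) = 0"
proof (rule ccontr)
  define a b where "a = Re (\<rho> x)" and "b = Im (\<rho> x)"
  assume "Im (\<rho> x) \<noteq> 0"
  then have b: "b \<noteq> 0" by (simp add: b_def)
  have le: "2 * b * t \<le> (norm x)\<^sup>2" for t
  proof -
    define y where "y = x + \<i> *\<^sub>C of_real t"
    have y: "y \<in> D" using x by (simp add: y_def)
    have "\<rho> y = Complex a (b + t)"
      using x by (simp add: y_def character_simps[OF r] complex_eq_iff a_def b_def)
    then have "a\<^sup>2 + (b + t)\<^sup>2 \<le> (norm y)\<^sup>2"
      using character_norm_le[OF r y] by (metis cmod_power2 complex.sel norm_ge_zero power_mono)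
    moreover have "(norm y)\<^sup>2 = norm (star y * y)" by (simp add: cstar_identity)
    moreover have "star y * y = x * x + of_real (t * t)"
      unfolding y_def star_cartesian[OF x(2) star_of_real]
      by (simp add: algebra_simps mult_scaleC_left mult_scaleC_right of_real_def scaleC_scaleR)
    moreover have "norm (x * x + of_real (t * t)) \<le> (norm x)\<^sup>2 + t\<^sup>2"
      using norm_triangle_ineq[of "x * x" "of_real (t * t)"] norm_selfadjoint_square[OF x(2)]
      by (simp add: power2_eq_square abs_mult del: of_real_mult)
    ultimately have "a\<^sup>2 + (b + t)\<^sup>2 \<le> (norm x)\<^sup>2 + t\<^sup>2" by simp
    then show ?thesis using zero_le_power2[of a] zero_le_power2[of b]
      unfolding power2_sum by argo
  qed
  have "(norm x)\<^sup>2 + 1 \<le> (norm x)\<^sup>2"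
    using le[of "((norm x)\<^sup>2 + 1) / (2 * b)"] b by simp
  then show False by simp
qed

lemma character_star:
  assumes r: "\<rho> \<in> characters D" and x: "x \<in> D"
  shows "\<rho> (star x) = cnj (\<rho> x)"
proof -
  have "\<rho> (re_part x) \<in> \<real>" "\<rho> (im_part x) \<in> \<real>"
    using character_selfadjoint[OF r] x by (simp_all add: star_re_part star_im_part complex_is_Real_iff)
  then obtain a b where ab: "\<rho> (re_part x) = of_real a" "\<rho> (im_part x) = of_real b"
    by (metis Reals_cases)
  have "\<rho> (re_part x + \<i> *\<^sub>C im_part x) = of_real a + \<i> * of_real b"
    using x ab by (simp add: character_simps[OF r])
  moreover have "\<rho> (star (re_part x + \<i> *\<^sub>C im_part x)) = of_real a - \<i> * of_real b"
    unfolding star_cartesian[OF star_re_part star_im_part]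
    using x ab by (simp add: character_simps[OF r])
  ultimately show ?thesis by (simp add: re_part_plus_im_part)
qed

lemma character_state:
  assumes r: "\<rho> \<in> characters D"
  shows "\<rho> \<in> states D"
proof -
  have "0 \<le> \<rho> (star x * x)" if "x \<in> D" for x
    using that by (simp add: character_simps[OF r] character_star[OF r] less_eq_complex_def)
  then show ?thesis by (simp add: states_def character_simps[OF r] character_linear[OF r])
qed

lemma state_kernel_mult:
  assumes f: "f \<in> states D" and x: "x \<in> D" "f (star x * x) = 0"
  shows "f x = 0"
  using state_Cauchy_Schwarz[OF f one_mem x(1)] x(2) by simp

text \<open>
  If \<open>\<rho>\<close> is a proper convex combination of states and \<open>\<rho> y = 0\<close>, then these states vanish at
  \<open>y\<^sup>* y\<close>, hence at \<open>y\<close>; so their kernels contain that of \<open>\<rho>\<close>.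
\<close>

lemma character_pure:
  assumes r: "\<rho> \<in> characters D"
  shows "\<rho> \<in> pure_states D"
  unfolding pure_states_def
proof (intro CollectI conjI ballI allI impI)
  show rs: "\<rho> \<in> states D" by (rule character_state[OF r])
  have main: "g = \<rho>" if g: "g \<in> states D" and h: "h \<in> states D" and t: "0 < t"  "t < 1"
    and eq: "\<forall>x\<in>D. \<rho> x = of_real t * g x + of_real (1 - t) * h x" for g h and t :: real
  proof (rule functional_eqI[OF state_linear[OF g] state_linear[OF rs]])
    fix x assume x: "x \<in> D"
    define y where "y = x - \<rho> x *\<^sub>C 1"
    have y: "y \<in> D" using x by (simp add: y_def)
    have "\<rho> y = 0" using x by (simp add: y_def character_simps[OF r])
    then have "\<rho> (star y * y) = 0" using y by (simp add: character_simps[OF r])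
    then have "t * Re (g (star y * y)) + (1 - t) * Re (h (star y * y)) = 0"
      using eq y by (metis (no_types, lifting) Re_complex_of_real mult_mem plus_complex.simps(1) star_mem
          times_complex.simps(1) Im_complex_of_real mult_zero_left diff_zero zero_complex.simps(1))
    moreover have "0 \<le> g (star y * y)" "0 \<le> h (star y * y)"
      using state_star_mult g h y by auto
    ultimately have "g (star y * y) = 0"
      using t by (auto simp: less_eq_complex_def complex_eq_iff)
        (smt (verit) mult_nonneg_nonneg mult_pos_pos)
    then have "g y = 0" by (rule state_kernel_mult[OF g y])
    then show "g x = \<rho> x"
      using x by (simp add: y_def functional_simps[OF state_linear[OF g]] state_one[OF g])
  qed
  fix g h and t :: real
  assume *: "g \<in> states D" "h \<in> states D" "0 < t \<and> t < 1"
    "\<forall>x\<in>D. \<rho> x = of_real t * g x + of_real (1 - t) * h x"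
  show "g = \<rho>" by (rule main[of g h t]) (use * in auto)
  show "h = \<rho>" by (rule main[of h g "1 - t"]) (use * in auto)
qed

abbreviation positives :: "'a set" where
  "positives \<equiv> {x \<in> D. positive x}"

text \<open>
  The functional \<open>f\<close> given by a maximal cone \<open>M\<close> is multiplicative for the following reason.  If
  \<open>f a = 0\<close>, then \<open>d - a\<close> and \<open>d + a\<close> lie in \<open>M\<close> for all \<open>d > 0\<close>.  Multiply them by the positive
  elements \<open>N + b\<close> and \<open>N - b\<close> and add: \<open>2 d N - 2 b a\<close> lies in \<open>M\<close>, so \<open>f (b a) \<le> d N\<close>.  Thus the
  kernel of \<open>f\<close> is an ideal.
\<close>

lemma ex_character_nonneg:
  assumes M0: "M0 \<subseteq> {x \<in> D. star x = x}" "positives \<subseteq> M0"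
    and add: "\<And>a b. a \<in> M0 \<Longrightarrow> b \<in> M0 \<Longrightarrow> a + b \<in> M0"
    and mult: "\<And>s a. s \<in> positives \<Longrightarrow> a \<in> M0 \<Longrightarrow> s * a \<in> M0"
    and proper: "- 1 \<notin> M0"
  obtains \<rho> where "\<rho> \<in> characters D" "\<And>a. a \<in> M0 \<Longrightarrow> 0 \<le> Re (\<rho> a)"
proof -
  define V where "V = {x \<in> D. star x = x}"
  have bound: "\<exists>N\<ge>0. \<forall>s\<in>positives. N *\<^sub>R s - s * a \<in> M0" if a: "a \<in> V" for a
  proof (intro exI[of _ "norm a"] conjI ballI)
    fix s assume s: "s \<in> positives"
    have "of_real (norm a) - a \<in> positives"
      using positive_norm_minus[of a "norm a"] a by (simp add: V_def)
    then have "s * (of_real (norm a) - a) \<in> M0" using mult[OF s] M0 by blast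
    then show "norm a *\<^sub>R s - s * a \<in> M0" by (simp add: right_diff_distrib of_real_def)
  qed simp
  interpret archimedean_cone V positives M0
  proof
    show "s * a \<in> V" if "s \<in> positives" "a \<in> V" for s a
      using that commute[of s a] by (auto simp: V_def star_mult positive_selfadjoint)
    show "s * t \<in> positives" if "s \<in> positives" "t \<in> positives" for s t
      using that positive_mult_commuting[of s t] commute[of s t] by (metis (no_types, lifting) mem_Collect_eq mult_mem)
    show "s * t = t * s" if "s \<in> positives" "t \<in> positives" for s t
      using that by (intro commute) auto
    show "1 \<in> M0" using M0(2) by auto
    show "\<exists>N\<ge>0. \<forall>s\<in>positives. N *\<^sub>R s - s * a \<in> M0" if "a \<in> V" for a
      by (rule bound[OF that])
    show "M0 \<subseteq> V" using M0(1) by (simp add: V_def)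
  qed (simp_all add: V_def star_add star_scaleR positive_add positive_of_real add mult proper)
  show ?thesis
  proof (rule ex_positive_functional)
    fix f :: "'a \<Rightarrow> real" and M
    assume f_add: "\<And>a b. a \<in> V \<Longrightarrow> b \<in> V \<Longrightarrow> f (a + b) = f a + f b"
      and f_scale: "\<And>a r. a \<in> V \<Longrightarrow> f (r *\<^sub>R a) = r * f a"
      and f1: "f 1 = 1" and MM: "M0 \<subseteq> M" and f_nn: "\<And>a. a \<in> M \<Longrightarrow> 0 \<le> f a"
      and f_pos: "\<And>a. a \<in> V \<Longrightarrow> 0 < f a \<Longrightarrow> a \<in> M"
      and M_add: "\<And>a b. a \<in> M \<Longrightarrow> b \<in> M \<Longrightarrow> a + b \<in> M"
      and M_S: "\<And>s a. s \<in> positives \<Longrightarrow> a \<in> M \<Longrightarrow> s * a \<in> M"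
    have V_mult: "a * b \<in> V" if "a \<in> V" "b \<in> V" for a b
      using that commute[of a b] by (auto simp: V_def star_mult)
    have f_of_real: "f (of_real r) = r" for r
      using f_scale[OF V_one, of r] f1 by (simp add: of_real_def)
    have f_diff: "f (a - b) = f a - f b" if "a \<in> V" "b \<in> V" for a b
      using f_add[of a "- b"] f_scale[of b "-1"] that V_uminus by simp
    have upper: "f (b * a) \<le> e" if a: "a \<in> V" "f a = 0" and b: "b \<in> V" and e: "e > 0" for a b e
    proof -
      \<comment> \<open>The summand 1 allows division by \<open>N\<close>.\<close>
      define N where "N = norm b + 1"
      define d where "d = e / N"
      have N: "N > 0" unfolding N_def using norm_ge_zero[of b] by argo
      have d: "d > 0" "d * N = e" using N e by (auto simp: d_def)
      have "of_real N - b \<in> positives" "of_real N + b \<in> positives"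
        using positive_norm_minus[of b N] b by (auto simp: V_def N_def)
      moreover have "of_real d - a \<in> M" "of_real d + a \<in> M"
        by (rule f_pos; use a d V_add V_diff V_of_real f_add f_diff f_of_real in simp)+
      ultimately have "(of_real N + b) * (of_real d - a) + (of_real N - b) * (of_real d + a) \<in> M"
        using M_add M_S by blast
      also have "(of_real N + b) * (of_real d - a) + (of_real N - b) * (of_real d + a)
          = of_real (2 * (d * N)) - 2 *\<^sub>R (b * a)"
      proof -
        have "(of_real N + b) * (of_real d - a) + (of_real N - b) * (of_real d + a)
            = (of_real (N * d) + of_real (N * d)) - (b * a + b * a)"
          by (simp add: algebra_simps)
        then show ?thesis by (simp only: scaleR_2 mult_2 mult.commute[of d N] of_real_add)
      qed
      finally have "of_real (2 * e) - 2 *\<^sub>R (b * a) \<in> M" unfolding d .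
      from f_nn[OF this] show ?thesis
        using f_diff[OF V_of_real V_scaleR[OF V_mult[OF b a(1)]]] f_of_real f_scale V_mult[OF b a(1)]
        by (simp del: of_real_mult)
    qed
    have f_kernel: "f (b * a) = 0" if a: "a \<in> V" "f a = 0" and b: "b \<in> V" for a b
    proof (rule antisym)
      show "f (b * a) \<le> 0" using upper[OF that] by (rule field_le_epsilon) simp
      have "f ((- b) * a) \<le> 0" using upper[OF a V_uminus[OF b]] by (rule field_le_epsilon) simp
      then show "0 \<le> f (b * a)"
        using f_scale[OF V_mult[OF b a(1)], of "-1"] by simp
    qed
    have f_mult: "f (a * b) = f a * f b" if a: "a \<in> V" and b: "b \<in> V" for a b
    proof -
      have "f (a * (b - of_real (f b))) = 0"
        by (rule f_kernel) (use a b V_diff V_of_real f_diff f_of_real in auto)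
      moreover have "a * (b - of_real (f b)) = a * b - f b *\<^sub>R a"
        by (simp add: right_diff_distrib of_real_def)
      ultimately show ?thesis
        using f_diff[OF V_mult[OF a b] V_scaleR[OF a]] f_scale[OF a] by simp
    qed
    obtain F where F: "linear_functional_on D F"
      and Fp: "\<And>x. x \<in> D \<Longrightarrow> F x = Complex (f (re_part x)) (f (im_part x))"
      and Fs: "\<And>x. x \<in> D \<Longrightarrow> star x = x \<Longrightarrow> F x = of_real (f x)"
      using complexification[of f] f_add f_scale by (auto simp: V_def)
    have "F (x * y) = F x * F y" if x: "x \<in> D" and y: "y \<in> D" for x y
    proof -
      define a b c d where "a = re_part x" and "b = im_part x" and "c = re_part y" and "d = im_part y"
      have V: "a \<in> V" "b \<in> V" "c \<in> V" "d \<in> V"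
        using x y by (auto simp: a_def b_def c_def d_def V_def star_re_part star_im_part)
      have xy: "x = a + \<i> *\<^sub>C b" "y = c + \<i> *\<^sub>C d"
        by (simp_all add: a_def b_def c_def d_def re_part_plus_im_part)
      have eq: "x * y = (a * c - b * d) + \<i> *\<^sub>C (a * d + b * c)"
        by (simp add: xy algebra_simps mult_scaleC_left mult_scaleC_right complex_vector.scale_right_distrib)
      have "star (a * c - b * d) = a * c - b * d" "star (a * d + b * c) = a * d + b * c"
        using V_add V_diff V_mult V by (auto simp: V_def)
      note p = cartesian_parts[OF this]
      have "F (x * y) = Complex (f (a * c - b * d)) (f (a * d + b * c))"
        using Fp[of "x * y"] x y unfolding eq p by (simp flip: eq)
      also have "\<dots> = Complex (f a * f c - f b * f d) (f a * f d + f b * f c)"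
        using V by (simp add: f_diff f_add f_mult V_mult)
      also have "\<dots> = F x * F y"
        using x y by (simp add: Fp a_def b_def c_def d_def complex_eq_iff)
      finally show ?thesis .
    qed
    moreover have "F 1 \<noteq> 0" using Fs[of 1] f1 by simp
    ultimately have "F \<in> characters D"
      using F one_mem unfolding characters_def by blast
    moreover have "0 \<le> Re (F a)" if "a \<in> M0" for a
    proof -
      have "0 \<le> f a" using that MM f_nn by blast
      moreover have "F a = of_real (f a)" using that M0 by (intro Fs) auto
      ultimately show ?thesis by simp
    qed
    ultimately show ?thesis by (rule that)
  qed
qed

end

context abelian_subalgebra
begin

lemma left_commute: "x \<in> D \<Longrightarrow> y \<in> D \<Longrightarrow> x * (y * z) = y * (x * z)"
  using commute[of x y] by (simp flip: mult.assoc)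

lemmas D_ac = mult.assoc commute left_commute

lemma positives_mult: "s \<in> positives \<Longrightarrow> t \<in> positives \<Longrightarrow> s * t \<in> positives"
  using positive_mult_commuting[of s t] commute[of s t] by simp

lemma character_positive:
  assumes "\<rho> \<in> characters D" "x \<in> positives"
  shows "0 \<le> Re (\<rho> x)" "\<rho> x = of_real (Re (\<rho> x))"
  using state_positive[OF character_state[OF assms(1)], of x] assms(2)
  by (auto simp: less_eq_complex_def complex_eq_iff)

lemma character_of_selfadjoint:
  assumes "\<rho> \<in> characters D" "x \<in> D" "star x = x"
  shows "\<rho> x = of_real (Re (\<rho> x))"
  using character_selfadjoint[OF assms] by (simp add: complex_eq_iff)

text \<open>
  This is what makes the cone used for the next lemma proper.  With \<open>m\<close> the modulus of \<open>k\<close> and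
  \<open>n = m - k\<close>, multiplying \<open>q k = 1 + p\<close> by \<open>n\<^sup>2\<close> yields \<open>(1 + p) n\<^sup>2 = - q m n\<^sup>2\<close>, so \<open>n\<^sup>2\<close> is
  both positive and negative.
\<close>

lemma positive_if_multiple_ge_one:
  assumes k: "k \<in> D" "star k = k" and pq: "p \<in> positives" "q \<in> positives" "q * k = 1 + p"
  shows "positive k"
proof -
  obtain m where m: "positive m" "m * m = k * k" "m \<in> D"
    using ex_modulus[OF k(2)] closed_subalgebra k(1) by metis
  define n where "n = m - k"
  have n: "n \<in> D" "star n = n"
    using m k by (simp_all add: n_def star_diff positive_selfadjoint)
  have pD: "p \<in> D" "q \<in> D" "positive p" "positive q" using pq by auto
  have nn: "positive (n * n)" "n * n \<in> D" using positive_square[OF n(2)] n(1) by auto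
  have nk: "n * k = - (m * n)"
    using m k by (simp add: n_def algebra_simps commute)
  have "n * n + p * (n * n) = (1 + p) * (n * n)" by (simp add: distrib_right)
  also have "\<dots> = q * (n * (n * k))"
    unfolding pq(3)[symmetric] using k n pD by (simp add: D_ac)
  also have "\<dots> = - (q * m * (n * n))"
    unfolding nk using n pD m by (simp add: D_ac)
  finally have "n * n + p * (n * n) = - (q * m * (n * n))" .
  then have eq: "- (n * n) = p * (n * n) + q * m * (n * n)"
    by (metis add.commute add.inverse_inverse add_diff_cancel_left' diff_conv_add_uminus minus_add_distrib)
  have "positive (p * (n * n) + q * m * (n * n))"
    using positives_mult[of p "n * n"] positives_mult[OF positives_mult[of q m], of "n * n"] pq m nn
    by (intro positive_add) auto
  then have "n * n = 0"
    using positive_antisym[OF nn(1)] eq by simp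
  then have "n = 0" using selfadjoint_square_eq_0[OF n(2)] by simp
  then show ?thesis using m by (simp add: n_def)
qed

text \<open>
  Adjoin \<open>- k\<close> to the cone of positive elements.
\<close>

lemma ex_character_nonpos:
  assumes k: "k \<in> D" "star k = k" and np: "\<not> positive k"
  obtains \<rho> where "\<rho> \<in> characters D" "Re (\<rho> k) \<le> 0"
proof (rule ex_character_nonneg)
  define M0 where "M0 = {p - q * k | p q. p \<in> positives \<and> q \<in> positives}"
  show "M0 \<subseteq> {x \<in> D. star x = x}"
    using k by (auto simp: M0_def star_diff star_mult positive_selfadjoint commute)
  have z: "0 \<in> positives" "1 \<in> positives" by auto
  show "positives \<subseteq> M0"
  proof
    fix p assume "p \<in> positives"
    then show "p \<in> M0"
      unfolding M0_def using z by (intro CollectI exI[of _ p] exI[of _ 0]) auto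
  qed
  show "a + b \<in> M0" if ab: "a \<in> M0" "b \<in> M0" for a b
  proof -
    obtain p q p' q' where *: "a = p - q * k" "b = p' - q' * k"
      "p \<in> positives" "q \<in> positives" "p' \<in> positives" "q' \<in> positives"
      using ab by (auto simp: M0_def)
    then have "a + b = (p + p') - (q + q') * k" by (simp add: distrib_right)
    with * show ?thesis unfolding M0_def using positive_add add_mem by blast
  qed
  show "s * a \<in> M0" if sa: "s \<in> positives" "a \<in> M0" for s a
  proof -
    obtain p q where *: "a = p - q * k" "p \<in> positives" "q \<in> positives"
      using sa by (auto simp: M0_def)
    then have "s * a = s * p - (s * q) * k" by (simp add: right_diff_distrib mult.assoc)
    with * sa positives_mult show ?thesis unfolding M0_def by blast
  qed
  show "- 1 \<notin> M0"
  proof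
    assume "- 1 \<in> M0"
    then obtain p q where pq: "p \<in> positives" "q \<in> positives" "- 1 = p - q * k"
      by (auto simp: M0_def)
    then have "q * k = 1 + p" by (simp add: algebra_simps eq_neg_iff_add_eq_0)
    with positive_if_multiple_ge_one[OF k pq(1,2)] np show False by blast
  qed
  fix \<rho> assume r: "\<rho> \<in> characters D" "\<And>a. a \<in> M0 \<Longrightarrow> 0 \<le> Re (\<rho> a)"
  have "0 - 1 * k \<in> M0" unfolding M0_def using z by blast
  then have "0 \<le> Re (\<rho> (- k))" using r(2)[of "- k"] by simp
  then have "Re (\<rho> k) \<le> 0" using k by (simp add: character_simps[OF r(1)])
  with r(1) show thesis by (rule that)
qed

lemma positive_if_characters_nonneg:
  assumes k: "k \<in> D" "star k = k" and nn: "\<And>\<rho>. \<rho> \<in> characters D \<Longrightarrow> 0 \<le> Re (\<rho> k)"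
  shows "positive k"
proof (rule positive_closed[OF k(2)])
  fix e :: real assume e: "e > 0"
  show "positive (k + of_real e)"
  proof (rule ccontr)
    assume "\<not> positive (k + of_real e)"
    then obtain \<rho> where r: "\<rho> \<in> characters D" "Re (\<rho> (k + of_real e)) \<le> 0"
      by (rule ex_character_nonpos[rotated 2]) (use k in \<open>auto simp: star_add\<close>)
    then show False
      using nn[OF r(1)] e k by (simp add: character_simps[OF r(1)])
  qed
qed

lemma norm_le_if_characters_le:
  assumes x: "x \<in> D" and t: "0 \<le> t" and le: "\<And>\<rho>. \<rho> \<in> characters D \<Longrightarrow> cmod (\<rho> x) \<le> t"
  shows "norm x \<le> t"
proof -
  have "positive (of_real (t\<^sup>2) - star x * x)"
  proof (rule positive_if_characters_nonneg)
    fix \<rho> assume r: "\<rho> \<in> characters D"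
    have "\<rho> (star x * x) = of_real ((cmod (\<rho> x))\<^sup>2)"
      using x complex_norm_square[of "\<rho> x"]
      by (simp add: character_simps[OF r] character_star[OF r] mult.commute)
    moreover have "(cmod (\<rho> x))\<^sup>2 \<le> t\<^sup>2" using le[OF r] by (simp add: power_mono)
    ultimately show "0 \<le> Re (\<rho> (of_real (t\<^sup>2) - star x * x))"
      using x by (simp add: character_simps[OF r] del: of_real_power)
  qed (use x in \<open>simp_all add: star_diff star_mult star_star del: of_real_power\<close>)
  then have "norm (star x * x) \<le> t\<^sup>2"
    by (intro positive_norm_le positive_star_mult) auto
  then show ?thesis using t by (simp add: cstar_identity power2_le_iff_abs_le)
qed

lemma characters_separate:
  assumes "x \<in> D" "y \<in> D" "\<And>\<rho>. \<rho> \<in> characters D \<Longrightarrow> \<rho> x = \<rho> y"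
  shows "x = y"
  using norm_le_if_characters_le[of "x - y" 0] assms by (simp add: character_simps)

lemma ex_inverse_add_of_real:
  assumes W: "W \<in> positives" and t: "t > 0"
  obtains y where "y \<in> D" "star y = y" "y * (W + of_real t) = 1"
proof -
  obtain T where T: "T \<ge> 0" "norm (of_real T - W) \<le> T"
    using W by (auto simp: positive_def)
  \<comment> \<open>The element \<open>W + t\<close> is within \<open>T < N\<close> of the scalar \<open>N\<close>, so the Neumann series applies.\<close>
  define N where "N = T + t"
  have N: "N > 0" using T t by (simp add: N_def)
  define k where "k = (1 / N) *\<^sub>R (of_real T - W)"
  have "norm k = norm (of_real T - W) / N" using N by (simp add: k_def)
  also have "\<dots> \<le> T / N" using T N by (simp add: divide_right_mono)
  also have "\<dots> < 1" using N t by (simp add: N_def)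
  finally have k: "norm k < 1" "k \<in> D" using W by (auto simp: k_def)
  obtain z where z: "z \<in> D" "z * (1 - k) = 1" using ex_inverse_one_minus[OF k(2,1)] .
  have "N *\<^sub>R (1 - k) = N *\<^sub>R 1 - (N * (1 / N)) *\<^sub>R (of_real T - W)"
    by (simp add: k_def scaleR_diff_right)
  also have "\<dots> = W + of_real t"
    using N by (simp add: N_def of_real_def scaleR_add_left)
  finally have Wt: "W + of_real t = N *\<^sub>R (1 - k)" ..
  define y where "y = (1 / N) *\<^sub>R z"
  have y: "y \<in> D" "y * (W + of_real t) = 1"
    using z N unfolding Wt y_def by simp_all
  have sW: "star (W + of_real t) = W + of_real t" "W + of_real t \<in> D"
    using W by (auto simp: star_add positive_selfadjoint)
  have "star y * (W + of_real t) = star (y * (W + of_real t))"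
    using y(1) sW by (simp add: star_mult commute)
  then have sy: "star y * (W + of_real t) = 1" using y(2) by simp
  have "star y = star y * (y * (W + of_real t))" using y by simp
  also have "\<dots> = y * (star y * (W + of_real t))" using y(1) by (simp add: left_commute)
  also have "\<dots> = y" using sy by simp
  finally show ?thesis using that y by blast
qed

text \<open>
  Take \<open>e = (w + t) / (W + t)\<close> with \<open>w = \<rho> W\<close>.  At a character where \<open>W\<close> has the value \<open>u\<close>, the
  element \<open>W e\<^sup>2\<close> has the value \<open>u (w + t)\<^sup>2 / (u + t)\<^sup>2\<close>, which is at most \<open>t\<close> since \<open>w \<le> t\<close> and
  \<open>4 u t \<le> (u + t)\<^sup>2\<close>.
\<close>

lemma ex_peak:
  assumes r: "\<rho> \<in> characters D" and W: "W \<in> positives" and t: "t > 0" "Re (\<rho> W) \<le> t"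
  obtains e where "e \<in> D" "star e = e" "\<rho> e = 1" "norm (W * (e * e)) \<le> t"
proof -
  obtain y where y: "y \<in> D" "star y = y" "y * (W + of_real t) = 1"
    using ex_inverse_add_of_real[OF W t(1)] .
  define w where "w = Re (\<rho> W)"
  define e where "e = (w + t) *\<^sub>R y"
  have e: "e \<in> D" "star e = e" using y by (simp_all add: e_def star_scaleR)
  have val: "\<sigma> y * of_real (Re (\<sigma> W) + t) = 1" "0 \<le> Re (\<sigma> W)" "\<sigma> W = of_real (Re (\<sigma> W))"
    if s: "\<sigma> \<in> characters D" for \<sigma>
  proof -
    show p: "0 \<le> Re (\<sigma> W)" "\<sigma> W = of_real (Re (\<sigma> W))" using character_positive[OF s W] by auto
    have "\<sigma> (y * (W + of_real t)) = \<sigma> y * (\<sigma> W + of_real t)"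
      using y(1) W by (simp add: character_simps[OF s])
    also have "\<sigma> W + of_real t = of_real (Re (\<sigma> W) + t)" using p(2) by (simp add: complex_eq_iff)
    finally show "\<sigma> y * of_real (Re (\<sigma> W) + t) = 1"
      using y(3) character_one[OF s] by simp
  qed
  have "\<rho> e = 1"
    using val(1)[OF r] y(1) by (simp add: e_def w_def character_simps[OF r] mult.commute)
  moreover have "norm (W * (e * e)) \<le> t"
  proof (rule norm_le_if_characters_le)
    fix \<sigma> assume s: "\<sigma> \<in> characters D"
    define u where "u = Re (\<sigma> W)"
    have u: "0 \<le> u" "\<sigma> W = of_real u" using val[OF s] by (simp_all add: u_def)
    have w: "0 \<le> w" "w \<le> t" using val(2)[OF r] t by (simp_all add: w_def)
    have ut: "u + t > 0" using u t by simp
    then have nz: "complex_of_real (u + t) \<noteq> 0" by (simp only: of_real_eq_0_iff)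
    have "\<sigma> y = of_real (1 / (u + t))"
      using val(1)[OF s] nz unfolding u_def[symmetric] by (simp add: field_simps)
    then have "\<sigma> (W * (e * e)) = of_real (u * ((w + t) / (u + t))\<^sup>2)"
      using W y(1) u(2) by (simp add: e_def character_simps[OF s] power2_eq_square)
    then have "cmod (\<sigma> (W * (e * e))) = u * ((w + t) / (u + t))\<^sup>2"
      using u(1) by (simp only: norm_of_real) simp
    also have "\<dots> \<le> u * ((2 * t) / (u + t))\<^sup>2"
      using w u t ut by (intro mult_left_mono power_mono divide_right_mono) auto
    also have "\<dots> \<le> t"
    proof -
      have "4 * u * t \<le> (u + t)\<^sup>2"
        using zero_le_power2[of "u - t"] by (simp add: power2_eq_square algebra_simps)
      then have "t * (4 * u * t) \<le> t * (u + t)\<^sup>2" using t by simp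
      then have "u * (2 * t)\<^sup>2 \<le> t * (u + t)\<^sup>2" by (simp add: power2_eq_square algebra_simps)
      then show ?thesis using ut by (simp add: power_divide pos_divide_le_eq)
    qed
    finally show "cmod (\<sigma> (W * (e * e))) \<le> t" .
  qed (use W e t in auto)
  ultimately show ?thesis using that e by blast
qed

lemma ex_positive_part:
  assumes k: "k \<in> D" "star k = k"
  obtains g where "g \<in> positives" "\<And>\<rho>. \<rho> \<in> characters D \<Longrightarrow> Re (\<rho> g) = max 0 (Re (\<rho> k))"
proof -
  obtain m where m: "positive m" "m * m = k * k" "m \<in> D"
    using ex_modulus[OF k(2)] closed_subalgebra k(1) by metis
  define g where "g = (1/2) *\<^sub>R (m + k)"
  have g: "g \<in> D" "star g = g"
    using m k by (simp_all add: g_def star_add star_scaleR positive_selfadjoint)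
  have val: "Re (\<rho> g) = max 0 (Re (\<rho> k))" if r: "\<rho> \<in> characters D" for \<rho>
  proof -
    obtain a b where ab: "\<rho> m = of_real a" "0 \<le> a" "\<rho> k = of_real b"
      using character_positive[OF r, of m] m character_of_selfadjoint[OF r k] by blast
    have "\<rho> m * \<rho> m = \<rho> k * \<rho> k"
      using character_mult[OF r] m k by metis
    then have "a * a = b * b" unfolding ab by (metis of_real_eq_iff of_real_mult)
    then have "a = \<bar>b\<bar>" using ab(2) by (metis abs_mult_self_eq abs_of_nonneg power2_eq_iff_nonneg power2_eq_square abs_ge_zero)
    then show ?thesis
      using m k ab by (simp add: g_def character_simps[OF r])
  qed
  have "positive g"
    by (rule positive_if_characters_nonneg[OF g]) (simp add: val)
  with g val show ?thesis using that by blast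
qed

text \<open>
  This takes the place of a partition of unity on the compact character space.  Call \<open>g \<ge> 0\<close> good
  if \<open>F g\<close> is approximated within \<open>e g\<close> by an element of \<open>D\<close>.  Good elements are stable under sums
  and under multiplication by positive elements.  If no good element had the form \<open>1 + p\<close> with
  \<open>p \<ge> 0\<close>, then some character would be nonpositive at all good elements, contrary to the
  hypothesis.  Dividing by such a \<open>1 + p\<close> gives the desired element.
\<close>

lemma ex_element_near:
  fixes F :: "('a \<Rightarrow> complex) \<Rightarrow> real"
  assumes loc: "\<And>\<rho>. \<rho> \<in> characters D \<Longrightarrow> \<exists>g\<in>positives. \<exists>d\<in>D. star d = d \<and> 0 < Re (\<rho> g) \<and>
        (\<forall>\<sigma>\<in>characters D. \<bar>Re (\<sigma> d) - F \<sigma> * Re (\<sigma> g)\<bar> \<le> e * Re (\<sigma> g))"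
  obtains d where "d \<in> D" "star d = d" "\<And>\<sigma>. \<sigma> \<in> characters D \<Longrightarrow> \<bar>Re (\<sigma> d) - F \<sigma>\<bar> \<le> e"
proof -
  define good where "good g d \<longleftrightarrow> d \<in> D \<and> star d = d \<and>
    (\<forall>\<sigma>\<in>characters D. \<bar>Re (\<sigma> d) - F \<sigma> * Re (\<sigma> g)\<bar> \<le> e * Re (\<sigma> g))" for g d
  define J where "J = {g \<in> positives. \<exists>d. good g d}"
  have J_add: "g + h \<in> J" if gh: "g \<in> J" "h \<in> J" for g h
  proof -
    obtain c d where "good g c" "good h d" using gh by (auto simp: J_def)
    then have "good (g + h) (c + d)"
      unfolding good_def
    proof (intro conjI ballI; elim conjE)
      fix \<sigma> assume s: "\<sigma> \<in> characters D" and D: "c \<in> D" "d \<in> D"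
        and "\<forall>\<sigma>\<in>characters D. \<bar>Re (\<sigma> c) - F \<sigma> * Re (\<sigma> g)\<bar> \<le> e * Re (\<sigma> g)"
        and "\<forall>\<sigma>\<in>characters D. \<bar>Re (\<sigma> d) - F \<sigma> * Re (\<sigma> h)\<bar> \<le> e * Re (\<sigma> h)"
      then have "\<bar>Re (\<sigma> c) - F \<sigma> * Re (\<sigma> g)\<bar> \<le> e * Re (\<sigma> g)"
        "\<bar>Re (\<sigma> d) - F \<sigma> * Re (\<sigma> h)\<bar> \<le> e * Re (\<sigma> h)" by auto
      then show "\<bar>Re (\<sigma> (c + d)) - F \<sigma> * Re (\<sigma> (g + h))\<bar> \<le> e * Re (\<sigma> (g + h))"
        using D gh by (simp add: J_def character_simps[OF s] distrib_left)
    qed (auto simp: star_add)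
    then show ?thesis using gh positive_add by (auto simp: J_def)
  qed
  have J_mult: "q * g \<in> J" if qg: "q \<in> positives" "g \<in> J" for q g
  proof -
    obtain d where d: "good g d" using qg by (auto simp: J_def)
    have "good (q * g) (q * d)"
      unfolding good_def
    proof (intro conjI ballI)
      show "star (q * d) = q * d"
        using d qg by (simp add: good_def star_mult positive_selfadjoint commute)
      show "q * d \<in> D" using d qg by (simp add: good_def)
      fix \<sigma> assume s: "\<sigma> \<in> characters D"
      obtain a where a: "\<sigma> q = of_real a" "0 \<le> a" using character_positive[OF s qg(1)] by blast
      have "\<bar>Re (\<sigma> d) - F \<sigma> * Re (\<sigma> g)\<bar> \<le> e * Re (\<sigma> g)" using d s by (simp add: good_def)
      then have "\<bar>a * (Re (\<sigma> d) - F \<sigma> * Re (\<sigma> g))\<bar> \<le> a * (e * Re (\<sigma> g))"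
        using a(2) by (simp add: abs_mult mult_left_mono)
      then show "\<bar>Re (\<sigma> (q * d)) - F \<sigma> * Re (\<sigma> (q * g))\<bar> \<le> e * Re (\<sigma> (q * g))"
        using d qg a by (simp add: good_def J_def character_simps[OF s] algebra_simps)
    qed
    then show ?thesis using positives_mult qg by (auto simp: J_def)
  qed
  have "good 0 0" by (simp add: good_def character_simps)
  then have J0: "0 \<in> J" by (auto simp: J_def)
  define M0 where "M0 = {p - g | p g. p \<in> positives \<and> g \<in> J}"
  have "- 1 \<in> M0"
  proof (rule ccontr)
    assume "- 1 \<notin> M0"
    moreover have "M0 \<subseteq> {x \<in> D. star x = x}"
      by (auto simp: M0_def J_def star_diff positive_selfadjoint)
    moreover have pos_M0: "positives \<subseteq> M0"
      unfolding M0_def using J0 by (force intro: exI[of _ 0])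
    moreover have "a + b \<in> M0" if ab: "a \<in> M0" "b \<in> M0" for a b
    proof -
      obtain p g p' g' where *: "a = p - g" "b = p' - g'" "p \<in> positives" "p' \<in> positives" "g \<in> J" "g' \<in> J"
        using ab by (auto simp: M0_def)
      then have "a + b = (p + p') - (g + g')" by simp
      with * J_add show ?thesis unfolding M0_def using positive_add add_mem by blast
    qed
    moreover have "s * a \<in> M0" if sa: "s \<in> positives" "a \<in> M0" for s a
    proof -
      obtain p g where *: "a = p - g" "p \<in> positives" "g \<in> J" using sa by (auto simp: M0_def)
      then have "s * a = s * p - s * g" by (simp add: right_diff_distrib)
      with * sa positives_mult J_mult show ?thesis unfolding M0_def by blast
    qed
    ultimately obtain \<rho> where r: "\<rho> \<in> characters D" "\<And>a. a \<in> M0 \<Longrightarrow> 0 \<le> Re (\<rho> a)"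
      using ex_character_nonneg[of M0] by blast
    obtain g d where g: "g \<in> positives" "good g d" "0 < Re (\<rho> g)"
      using loc[OF r(1)] unfolding good_def by blast
    moreover have "0 \<in> positives" by simp
    ultimately have "0 - g \<in> M0" unfolding M0_def J_def by blast
    then have "0 \<le> Re (\<rho> (- g))" using r(2)[of "- g"] by simp
    then show False using \<open>g \<in> positives\<close> \<open>0 < Re (\<rho> g)\<close> by (simp add: character_simps[OF r(1)])
  qed
  then obtain p g where pg: "p \<in> positives" "g \<in> J" "- 1 = p - g" by (auto simp: M0_def)
  then have g: "g = p + of_real 1" by (simp add: algebra_simps eq_neg_iff_add_eq_0)
  obtain d where d: "good g d" using pg by (auto simp: J_def)
  obtain y where y: "y \<in> D" "star y = y" "y * g = 1"
    using ex_inverse_add_of_real[OF pg(1), of 1] unfolding g by auto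
  have dD: "d \<in> D" "star d = d" using d by (auto simp: good_def)
  show ?thesis
  proof (rule that)
    show "y * d \<in> D" "star (y * d) = y * d" using y dD by (auto simp: star_mult commute)
    fix \<sigma> assume s: "\<sigma> \<in> characters D"
    define b where "b = Re (\<sigma> p) + 1"
    have b: "b \<ge> 1" "Re (\<sigma> g) = b" "\<sigma> g = of_real b"
      using character_positive[OF s pg(1)] pg(1) by (simp_all add: b_def g character_simps[OF s] complex_eq_iff)
    have "\<sigma> y * \<sigma> g = 1"
      using y pg by (metis (no_types, lifting) J_def mem_Collect_eq character_mult[OF s] character_one[OF s])
    then have "\<sigma> y = of_real (1 / b)" using b by (simp add: field_simps)
    then have *: "Re (\<sigma> (y * d)) = Re (\<sigma> d) / b"
      using y dD by (simp add: character_simps[OF s])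
    have "\<bar>Re (\<sigma> d) - F \<sigma> * b\<bar> \<le> e * b" using d s unfolding good_def b(2)[symmetric] by blast
    then have "\<bar>Re (\<sigma> d) - F \<sigma> * b\<bar> / b \<le> e" using b by (simp add: pos_divide_le_eq)
    moreover have "\<bar>Re (\<sigma> d) - F \<sigma> * b\<bar> / b = \<bar>(Re (\<sigma> d) - F \<sigma> * b) / b\<bar>" using b by simp
    moreover have "(Re (\<sigma> d) - F \<sigma> * b) / b = Re (\<sigma> (y * d)) - F \<sigma>"
      using b * by (simp add: diff_divide_distrib)
    ultimately show "\<bar>Re (\<sigma> (y * d)) - F \<sigma>\<bar> \<le> e" by simp
  qed
qed

text \<open>
  Since the norm is the supremum over the characters, approximations of \<open>F\<close> within \<open>1 / (n + 1)\<close> form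
  a Cauchy sequence.
\<close>

lemma ex_element_of_local_approximations:
  fixes F :: "('a \<Rightarrow> complex) \<Rightarrow> real"
  assumes loc: "\<And>\<rho> e. \<rho> \<in> characters D \<Longrightarrow> e > 0 \<Longrightarrow>
      \<exists>g\<in>positives. \<exists>d\<in>D. star d = d \<and> 0 < Re (\<rho> g) \<and>
        (\<forall>\<sigma>\<in>characters D. \<bar>Re (\<sigma> d) - F \<sigma> * Re (\<sigma> g)\<bar> \<le> e * Re (\<sigma> g))"
  obtains d where "d \<in> D" "\<And>\<sigma>. \<sigma> \<in> characters D \<Longrightarrow> \<sigma> d = of_real (F \<sigma>)"
proof -
  have "\<exists>d. d \<in> D \<and> (\<forall>\<sigma>\<in>characters D. cmod (\<sigma> d - of_real (F \<sigma>)) \<le> inverse (real (Suc n)))" for n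
  proof -
    obtain d where d: "d \<in> D" "star d = d"
      "\<And>\<sigma>. \<sigma> \<in> characters D \<Longrightarrow> \<bar>Re (\<sigma> d) - F \<sigma>\<bar> \<le> inverse (real (Suc n))"
      by (rule ex_element_near[of F "inverse (real (Suc n))"]) (use loc in auto)
    have "cmod (\<sigma> d - of_real (F \<sigma>)) \<le> inverse (real (Suc n))" if s: "\<sigma> \<in> characters D" for \<sigma>
    proof -
      have "\<sigma> d - of_real (F \<sigma>) = of_real (Re (\<sigma> d) - F \<sigma>)"
        using character_of_selfadjoint[OF s d(1,2)] by (simp add: complex_eq_iff)
      then show ?thesis using d(3)[OF s] by (simp only: norm_of_real)
    qed
    with d show ?thesis by blast
  qed
  then obtain X where XD: "\<And>n. X n \<in> D"
    and X: "\<And>n \<sigma>. \<sigma> \<in> characters D \<Longrightarrow> cmod (\<sigma> (X n) - of_real (F \<sigma>)) \<le> inverse (real (Suc n))"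
    by metis
  have diff: "norm (X m - X n) \<le> inverse (real (Suc m)) + inverse (real (Suc n))" for m n
  proof (rule norm_le_if_characters_le)
    fix \<sigma> assume s: "\<sigma> \<in> characters D"
    have "\<sigma> (X m - X n) = (\<sigma> (X m) - of_real (F \<sigma>)) - (\<sigma> (X n) - of_real (F \<sigma>))"
      using XD by (simp add: character_simps[OF s])
    then show "cmod (\<sigma> (X m - X n)) \<le> inverse (real (Suc m)) + inverse (real (Suc n))"
      using X[OF s, of m] X[OF s, of n] norm_triangle_ineq4[of "\<sigma> (X m) - of_real (F \<sigma>)" "\<sigma> (X n) - of_real (F \<sigma>)"]
      by simp
  qed (use XD in auto)
  have "Cauchy X"
  proof (rule CauchyI)
    fix e :: real assume "e > 0"
    then obtain N where N: "inverse (real (Suc N)) < e / 2" using reals_Archimedean[of "e / 2"] by auto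
    show "\<exists>M. \<forall>m\<ge>M. \<forall>n\<ge>M. norm (X m - X n) < e"
    proof (intro exI[of _ N] allI impI)
      fix m n assume "N \<le> m" "N \<le> n"
      then have "inverse (real (Suc m)) \<le> inverse (real (Suc N))" "inverse (real (Suc n)) \<le> inverse (real (Suc N))"
        by (simp_all add: le_imp_inverse_le)
      then show "norm (X m - X n) < e" using diff[of m n] N by linarith
    qed
  qed
  then obtain L where L: "X \<longlonglongrightarrow> L" using Cauchy_convergent convergent_def by blast
  have LD: "L \<in> D" using closed_sequentially[OF closed XD L] .
  have "\<sigma> L = of_real (F \<sigma>)" if s: "\<sigma> \<in> characters D" for \<sigma>
  proof (rule LIMSEQ_unique)
    have "(\<lambda>n. \<sigma> (X n) - \<sigma> L) \<longlonglongrightarrow> 0"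
    proof (rule Lim_null_comparison)
      show "\<forall>\<^sub>F n in sequentially. cmod (\<sigma> (X n) - \<sigma> L) \<le> norm (X n - L)"
        using character_norm_le[OF s, of "X _ - L"] XD LD by (simp add: character_simps[OF s])
      show "(\<lambda>n. norm (X n - L)) \<longlonglongrightarrow> 0"
        using L by (simp add: LIM_zero tendsto_norm_zero)
    qed
    then show "(\<lambda>n. \<sigma> (X n)) \<longlonglongrightarrow> \<sigma> L" by (rule LIM_zero_cancel)
    have "(\<lambda>n. \<sigma> (X n) - of_real (F \<sigma>)) \<longlonglongrightarrow> 0"
      by (rule Lim_null_comparison[OF _ LIMSEQ_inverse_real_of_nat]) (use X[OF s] in simp)
    then show "(\<lambda>n. \<sigma> (X n)) \<longlonglongrightarrow> of_real (F \<sigma>)" by (rule LIM_zero_cancel)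
  qed
  with LD show ?thesis by (rule that)
qed

end

section \<open>The extension property\<close>

interpretation whole: unital_subalgebra "UNIV :: 'a::unital_cstar_algebra set"
  by (rule unital_subalgebra_UNIV)

locale extension_inclusion = abelian_subalgebra +
  assumes extension: "extension_property D"
begin

definition unique_ext :: "('a \<Rightarrow> complex) \<Rightarrow> 'a \<Rightarrow> complex" where
  "unique_ext \<rho> = (THE g. g \<in> states UNIV \<and> (\<forall>d\<in>D. g d = \<rho> d))"

context
  fixes \<rho> assumes \<rho>: "\<rho> \<in> characters D"
begin

lemma ex1_ext: "\<exists>!g. g \<in> states UNIV \<and> (\<forall>d\<in>D. g d = \<rho> d)"
  using extension character_pure[OF \<rho>] by (simp add: extension_property_def)

lemma ext_state: "unique_ext \<rho> \<in> states UNIV"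
  and ext_eq: "d \<in> D \<Longrightarrow> unique_ext \<rho> d = \<rho> d"
  using theI'[OF ex1_ext] by (auto simp: unique_ext_def)

lemma ext_unique: "g \<in> states UNIV \<Longrightarrow> (\<And>d. d \<in> D \<Longrightarrow> g d = \<rho> d) \<Longrightarrow> g = unique_ext \<rho>"
  using ex1_ext ext_state ext_eq by blast

lemmas ext_simps = whole.functional_simps[OF whole.state_linear[OF ext_state], simplified]

lemma ext_star: "unique_ext \<rho> (star x) = cnj (unique_ext \<rho> x)"
  by (rule whole.state_star[OF ext_state UNIV_I])

lemma ext_selfadjoint: "star h = h \<Longrightarrow> unique_ext \<rho> h = of_real (Re (unique_ext \<rho> h))"
  using ext_star[of h] by (simp add: complex_eq_iff)

lemma ext_positive: "positive x \<Longrightarrow> 0 \<le> Re (unique_ext \<rho> x)"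
  using whole.state_positive[OF ext_state, of x] by (simp add: less_eq_complex_def)

text \<open>
  The Cauchy-Schwarz inequality puts \<open>d - \<rho> d\<close> into the multiplicative domain.
\<close>

lemma ext_mult_left:
  assumes d: "d \<in> D"
  shows "unique_ext \<rho> (d * x) = \<rho> d * unique_ext \<rho> x"
proof -
  define c where "c = d - \<rho> d *\<^sub>C 1"
  have c: "c \<in> D" using d by (simp add: c_def)
  have "\<rho> c = 0" using d by (simp add: c_def character_simps[OF \<rho>])
  then have "unique_ext \<rho> (c * star c) = 0" using c by (simp add: ext_eq character_simps[OF \<rho>])
  then have "unique_ext \<rho> (c * x) = 0"
    using whole.state_Cauchy_Schwarz[OF ext_state, of "star c" x] by (simp add: star_star)
  moreover have "c * x = d * x - \<rho> d *\<^sub>C x"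
    by (simp add: c_def left_diff_distrib mult_scaleC_left)
  ultimately show ?thesis by (simp add: ext_simps)
qed

lemma ext_mult_right:
  assumes d: "d \<in> D"
  shows "unique_ext \<rho> (x * d) = unique_ext \<rho> x * \<rho> d"
proof -
  have "unique_ext \<rho> (x * d) = cnj (unique_ext \<rho> (star d * star x))"
    by (simp add: ext_star star_star flip: star_mult)
  also have "\<dots> = unique_ext \<rho> x * \<rho> d"
    using d by (simp add: ext_mult_left character_star[OF \<rho>] ext_star)
  finally show ?thesis .
qed

text \<open>
  If every \<open>d \<ge> h\<close> in \<open>D\<close> had \<open>\<rho> d \<ge> \<alpha>\<close>, then adjoining \<open>h - \<alpha>\<close> and the elements of \<open>D\<close> on which \<open>\<rho>\<close>
  is nonnegative to the positive cone would leave it proper.  The resulting state extends \<open>\<rho>\<close> and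
  is at least \<open>\<alpha>\<close> at \<open>h\<close>, so it differs from the unique extension.
\<close>

lemma ex_upper_approximation:
  assumes h: "star h = h" and e: "e > 0"
  shows "\<exists>d\<in>D. star d = d \<and> positive (d - h) \<and> Re (\<rho> d) < Re (unique_ext \<rho> h) + e"
proof (rule ccontr)
  assume th: "\<not> ?thesis"
  have neg: "\<not> Re (\<rho> d) < Re (unique_ext \<rho> h) + e" if "d \<in> D" "star d = d" "positive (d - h)" for d
    using that th by blast
  define \<alpha> where "\<alpha> = Re (unique_ext \<rho> h) + e"
  define V where "V = {x::'a. star x = x}"
  define S where "S = {of_real r :: 'a | r. 0 \<le> r}"
  define M0 where "M0 = {p + d + r *\<^sub>R (h - of_real \<alpha>) | p d r.
      positive p \<and> d \<in> D \<and> star d = d \<and> 0 \<le> Re (\<rho> d) \<and> 0 \<le> r}"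
  have M0I: "p + d + r *\<^sub>R (h - of_real \<alpha>) \<in> M0"
    if "positive p" "d \<in> D" "star d = d" "0 \<le> Re (\<rho> d)" "0 \<le> r" for p d r
    using that unfolding M0_def by blast
  have \<rho>0: "\<rho> 0 = 0" by (rule character_simps[OF \<rho>])
  have M0_pos: "p \<in> M0" if "positive p" for p
    using M0I[of p 0 0] that \<rho>0 by simp
  have proper: "- 1 \<notin> M0"
  proof
    assume "- 1 \<in> M0"
    then obtain p d r where *: "- 1 = p + d + r *\<^sub>R (h - of_real \<alpha>)" "positive p" "d \<in> D" "star d = d"
      "0 \<le> Re (\<rho> d)" "0 \<le> r" by (auto simp: M0_def)
    have p: "p = - 1 - d - r *\<^sub>R (h - of_real \<alpha>)" unfolding *(1) by simp
    show False
    proof (cases "r = 0")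
      case True
      then have p: "p = - 1 - d" using p by simp
      then have "p \<in> D" using *(3) by simp
      then have "0 \<le> Re (\<rho> p)" using *(2) by (intro character_positive[OF \<rho>]) simp
      then show False using * unfolding p by (simp add: character_simps[OF \<rho>])
    next
      case False
      then have r: "r > 0" using * by simp
      define d' where "d' = of_real \<alpha> - (1 / r) *\<^sub>R (1 + d)"
      have "d' - h = (1 / r) *\<^sub>R p"
        using r unfolding p d'_def by (simp add: scaleR_diff_right scaleR_add_right scaleR_minus_right)
      then have "positive (d' - h)" using * r by (simp add: positive_scaleR)
      moreover have "d' \<in> D" "star d' = d'"
        using * by (simp_all add: d'_def star_diff star_scaleR star_add)
      ultimately have "\<alpha> \<le> Re (\<rho> d')" using neg[of d'] by (simp add: \<alpha>_def)
      moreover have "Re (\<rho> d') = \<alpha> - (1 / r) * (1 + Re (\<rho> d))"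
        using * by (simp add: d'_def character_simps[OF \<rho>])
      moreover have "0 < (1 / r) * (1 + Re (\<rho> d))" using * r by (intro mult_pos_pos) auto
      ultimately show False by simp
    qed
  qed
  interpret archimedean_cone V S M0
  proof
    show "M0 \<subseteq> V"
      by (auto simp: M0_def V_def star_add star_scaleR star_diff h positive_selfadjoint)
    show "1 \<in> M0" by (rule M0_pos) simp
    show "- 1 \<notin> M0" by (rule proper)
    show "a + b \<in> M0" if ab: "a \<in> M0" "b \<in> M0" for a b
    proof -
      obtain p d r where *: "a = p + d + r *\<^sub>R (h - of_real \<alpha>)" "positive p" "d \<in> D" "star d = d"
        "0 \<le> Re (\<rho> d)" "0 \<le> r" using ab(1) by (auto simp: M0_def)
      obtain p' d' r' where **: "b = p' + d' + r' *\<^sub>R (h - of_real \<alpha>)" "positive p'" "d' \<in> D" "star d' = d'"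
        "0 \<le> Re (\<rho> d')" "0 \<le> r'" using ab(2) by (auto simp: M0_def)
      have "a + b = (p + p') + (d + d') + (r + r') *\<^sub>R (h - of_real \<alpha>)"
        unfolding *(1) **(1) by (simp add: scaleR_add_left)
      then show ?thesis
        using * ** by (simp only:) (intro M0I, auto simp: positive_add star_add character_simps[OF \<rho>])
    qed
    show "s * a \<in> M0" if sa: "s \<in> S" "a \<in> M0" for s a
    proof -
      obtain p d r where *: "a = p + d + r *\<^sub>R (h - of_real \<alpha>)" "positive p" "d \<in> D" "star d = d"
        "0 \<le> Re (\<rho> d)" "0 \<le> r" using sa(2) by (auto simp: M0_def)
      obtain u where u: "s = of_real u" "0 \<le> u" using sa(1) by (auto simp: S_def)
      have "s * a = u *\<^sub>R p + u *\<^sub>R d + (u * r) *\<^sub>R (h - of_real \<alpha>)"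
        unfolding *(1) u by (simp add: of_real_def scaleR_add_right)
      then show ?thesis
        using * u by (simp only:) (intro M0I, auto simp: positive_scaleR star_scaleR character_simps[OF \<rho>])
    qed
    show "\<exists>N\<ge>0. \<forall>s\<in>S. N *\<^sub>R s - s * a \<in> M0" if a: "a \<in> V" for a
    proof (intro exI[of _ "norm a"] conjI ballI)
      fix s assume "s \<in> S"
      then obtain u where u: "s = of_real u" "0 \<le> u" by (auto simp: S_def)
      have "norm a *\<^sub>R s - s * a = u *\<^sub>R (of_real (norm a) - a)"
        by (simp add: u of_real_def scaleR_diff_right mult.commute)
      also have "\<dots> \<in> M0"
        using positive_norm_minus[of a "norm a"] a u by (intro M0_pos positive_scaleR) (auto simp: V_def)
      finally show "norm a *\<^sub>R s - s * a \<in> M0" .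
    qed simp
    show "s + t \<in> S" if "s \<in> S" "t \<in> S" for s t
      using that unfolding S_def by (auto simp flip: of_real_add intro: add_nonneg_nonneg)
    show "s * t \<in> S" if "s \<in> S" "t \<in> S" for s t
      using that unfolding S_def by (auto simp flip: of_real_mult intro: mult_nonneg_nonneg)
    show "s * t = t * s" if "s \<in> S" "t \<in> S" for s t
      using that by (auto simp: S_def mult.commute simp flip: of_real_mult)
    show "s * a \<in> V" if "s \<in> S" "a \<in> V" for s a
      using that by (auto simp: S_def V_def of_real_def star_scaleR)
    show "of_real r \<in> S" if "0 \<le> r" for r using that by (auto simp: S_def)
  qed (auto simp: V_def star_add star_scaleR)
  show False
  proof (rule ex_positive_functional)
    fix f :: "'a \<Rightarrow> real" and M
    assume f_add: "\<And>a b. a \<in> V \<Longrightarrow> b \<in> V \<Longrightarrow> f (a + b) = f a + f b"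
      and f_scale: "\<And>a r. a \<in> V \<Longrightarrow> f (r *\<^sub>R a) = r * f a"
      and f1: "f 1 = 1" and MM: "M0 \<subseteq> M" and f_M: "\<And>a. a \<in> M \<Longrightarrow> 0 \<le> f a"
    have f_nn: "0 \<le> f a" if "a \<in> M0" for a using f_M MM that by blast
    have f_of_real: "f (of_real r) = r" for r
      using f_scale[OF V_one, of r] f1 by (simp add: of_real_def)
    have f_diff: "f (a - b) = f a - f b" if "a \<in> V" "b \<in> V" for a b
      using f_add[of a "- b"] f_scale[of b "-1"] that V_uminus by simp
    obtain F where F: "linear_functional_on UNIV F"
      and Fp: "\<And>x. F x = Complex (f (re_part x)) (f (im_part x))"
      and Fs: "\<And>x. star x = x \<Longrightarrow> F x = of_real (f x)"
      using whole.complexification[of f] f_add f_scale by (auto simp: V_def)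
    have "F \<in> states UNIV"
      unfolding states_def
    proof (intro CollectI conjI ballI F)
      show "F 1 = 1" using Fs[of 1] f1 by simp
      show "0 \<le> F (star x * x)" for x
        using Fs[of "star x * x"] f_nn[OF M0_pos[OF positive_star_mult, of x]]
        by (simp add: star_mult star_star less_eq_complex_def)
    qed
    moreover have "F d = \<rho> d" if d: "d \<in> D" for d
    proof -
      have f_D: "\<rho> c = of_real (f c)" if c: "c \<in> D" "star c = c" for c
      proof -
        define b where "b = c - of_real (Re (\<rho> c))"
        have b: "b \<in> D" "star b = b" using c by (simp_all add: b_def star_diff)
        have "Re (\<rho> b) = 0" using c by (simp add: b_def character_simps[OF \<rho>])
        then have "0 \<le> f b" "0 \<le> f (- b)"
          using M0I[of 0 b 0] M0I[of 0 "- b" 0] b f_nn by (auto simp: character_simps[OF \<rho>])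
        then have "f b = 0" using f_scale[of b "-1"] b by (simp add: V_def)
        then have "f c = Re (\<rho> c)"
          using f_diff[OF _ V_of_real, of c] c by (simp add: b_def V_def f_of_real)
        then show ?thesis using character_of_selfadjoint[OF \<rho> c] by simp
      qed
      have "\<rho> (re_part d + \<i> *\<^sub>C im_part d) = of_real (f (re_part d)) + \<i> * of_real (f (im_part d))"
        using d f_D[OF parts_mem(1)[OF d] star_re_part] f_D[OF parts_mem(2)[OF d] star_im_part]
        by (simp add: character_simps[OF \<rho>])
      then show ?thesis
        unfolding re_part_plus_im_part Fp by (simp add: complex_eq_iff)
    qed
    ultimately have "F = unique_ext \<rho>" by (rule ext_unique)
    then have "f h = Re (unique_ext \<rho> h)" using Fs[OF h] by simp
    moreover have "0 \<le> f (h - of_real \<alpha>)" using M0I[of 0 0 1] f_nn \<rho>0 by simp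
    moreover have "f (h - of_real \<alpha>) = f h - \<alpha>"
      using f_diff[OF _ V_of_real, of h \<alpha>] h by (simp add: V_def f_of_real)
    ultimately show False using e by (simp add: \<alpha>_def)
  qed
qed

lemma ex_sandwich:
  assumes h: "star h = h" and e: "e > 0"
  obtains c d where "c \<in> D" "star c = c" "positive (h - c)" "d \<in> D" "star d = d" "positive (d - h)"
    "Re (unique_ext \<rho> h) - e < Re (\<rho> c)" "Re (\<rho> c) \<le> Re (unique_ext \<rho> h)" "Re (\<rho> d) < Re (unique_ext \<rho> h) + e"
proof -
  obtain d where d: "d \<in> D" "star d = d" "positive (d - h)" "Re (\<rho> d) < Re (unique_ext \<rho> h) + e"
    using ex_upper_approximation[OF h e] by blast
  have h': "star (- h) = - h" using h by simp
  obtain b where b: "b \<in> D" "star b = b" "positive (b - (- h))" "Re (\<rho> b) < Re (unique_ext \<rho> (- h)) + e"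
    using ex_upper_approximation[OF h' e] by blast
  have p: "positive (h - (- b))" using b(3) by (simp add: add.commute)
  have "Re (\<rho> (- b)) \<le> Re (unique_ext \<rho> h)"
    using ext_positive[OF p] b(1) by (simp add: ext_simps ext_eq character_simps[OF \<rho>])
  then show ?thesis
    using that[of "- b" d] b d p by (simp add: ext_simps character_simps[OF \<rho>])
qed

text \<open>
  For self-adjoint \<open>h\<close> choose \<open>c \<le> h \<le> d\<close> in \<open>D\<close> with \<open>\<rho> (d - c)\<close> small, and let \<open>p\<close> peak at \<open>\<rho>\<close> for
  \<open>W = d - c\<close>.  Then \<open>\<psi> (h - c) = \<psi> (p (h - c) p)\<close>, and \<open>0 \<le> p (h - c) p \<le> W p\<^sup>2\<close> has small norm, so
  \<open>\<psi> h\<close> is close to \<open>\<psi> c = \<psi> 1 \<rho> c\<close>, and \<open>\<rho> c\<close> is close to the value at \<open>h\<close> of the extension.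
\<close>

lemma central_functional_eq:
  assumes \<psi>: "\<psi> \<in> bounded_functionals"
    and left: "\<And>d x. d \<in> D \<Longrightarrow> \<psi> (d * x) = \<rho> d * \<psi> x"
    and right: "\<And>d x. d \<in> D \<Longrightarrow> \<psi> (x * d) = \<psi> x * \<rho> d"
  shows "\<psi> x = \<psi> 1 * unique_ext \<rho> x"
proof -
  have lin: "bounded_linear \<psi>" and scaleC: "\<And>c x. \<psi> (c *\<^sub>C x) = c * \<psi> x"
    using \<psi> by (auto simp: bounded_functionals_def)
  interpret bounded_linear \<psi> by (rule lin)
  obtain K where K: "K \<ge> 0" "\<And>x. cmod (\<psi> x) \<le> norm x * K" using nonneg_bounded by blast
  have sa: "\<psi> h = \<psi> 1 * unique_ext \<rho> h" if h: "star h = h" for h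
  proof -
    define s where "s = Re (unique_ext \<rho> h)"
    have s: "unique_ext \<rho> h = of_real s" using ext_selfadjoint[OF h] by (simp add: s_def)
    have le: "cmod (\<psi> h - \<psi> 1 * of_real s) \<le> (2 * K + cmod (\<psi> 1)) * e" if e: "e > 0" for e
    proof -
      obtain c d where cd: "c \<in> D" "star c = c" "positive (h - c)" "d \<in> D" "star d = d" "positive (d - h)"
        "s - e < Re (\<rho> c)" "Re (\<rho> c) \<le> s" "Re (\<rho> d) < s + e"
        using ex_sandwich[OF h e] unfolding s_def .
      define W where "W = d - c"
      have "positive ((d - h) + (h - c))" by (intro positive_add cd)
      then have W: "W \<in> positives" using cd by (simp add: W_def)
      have "Re (\<rho> W) \<le> 2 * e" using cd by (simp add: W_def character_simps[OF \<rho>])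
      then obtain p where p: "p \<in> D" "star p = p" "\<rho> p = 1" "norm (W * (p * p)) \<le> 2 * e"
        using ex_peak[OF \<rho> W, of "2 * e"] e by auto
      define k where "k = p * (h - c) * p"
      have Wpp: "W * (p * p) = p * W * p" using W p by (simp add: D_ac)
      have "positive k" using positive_conjugate[OF cd(3), of p] p by (simp add: k_def)
      moreover have "positive (of_real (2 * e) - k)"
      proof -
        have "positive (p * (d - h) * p)" using positive_conjugate[OF cd(6), of p] p by simp
        moreover have "positive (of_real (2 * e) - W * (p * p))"
          by (rule positive_norm_minus) (use p W Wpp in \<open>simp_all add: star_mult positive_selfadjoint mult.assoc\<close>)
        ultimately have "positive ((of_real (2 * e) - W * (p * p)) + p * (d - h) * p)"
          by (intro positive_add)
        moreover have "(of_real (2 * e) - W * (p * p)) + p * (d - h) * p = of_real (2 * e) - k"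
          unfolding Wpp unfolding W_def k_def by (simp add: algebra_simps)
        ultimately show ?thesis by metis
      qed
      ultimately have nk: "norm k \<le> 2 * e" using e by (intro positive_norm_le) auto
      have "\<psi> k = \<psi> (h - c)"
        using p by (simp add: k_def left right mult.assoc)
      also have "\<dots> = \<psi> h - \<psi> 1 * \<rho> c"
        using cd left[of c 1] by (simp add: diff)
      finally have eq: "\<psi> h - \<psi> 1 * of_real s = \<psi> k + \<psi> 1 * (\<rho> c - of_real s)"
        by (simp add: algebra_simps)
      have "\<rho> c - of_real s = of_real (Re (\<rho> c) - s)"
        using character_of_selfadjoint[OF \<rho> cd(1,2)] by (simp add: complex_eq_iff)
      then have "cmod (\<rho> c - of_real s) \<le> e"
        using cd by (simp only: norm_of_real)
      then have 1: "cmod (\<psi> 1 * (\<rho> c - of_real s)) \<le> cmod (\<psi> 1) * e"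
        by (simp add: norm_mult mult_left_mono)
      have 2: "cmod (\<psi> k) \<le> 2 * e * K"
        using K(2)[of k] mult_right_mono[OF nk K(1)] by linarith
      have "cmod (\<psi> h - \<psi> 1 * of_real s) \<le> cmod (\<psi> k) + cmod (\<psi> 1 * (\<rho> c - of_real s))"
        unfolding eq by (rule norm_triangle_ineq)
      with 1 2 show ?thesis by (simp add: algebra_simps)
    qed
    have "cmod (\<psi> h - \<psi> 1 * of_real s) \<le> 0 + e" if "e > 0" for e
    proof -
      define L where "L = 2 * K + cmod (\<psi> 1) + 1"
      have L: "L > 0" "2 * K + cmod (\<psi> 1) \<le> L" using K by (auto simp: L_def add_nonneg_pos)
      have "cmod (\<psi> h - \<psi> 1 * of_real s) \<le> (2 * K + cmod (\<psi> 1)) * (e / L)"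
        using that L by (intro le) auto
      also have "\<dots> \<le> L * (e / L)" using that L by (intro mult_right_mono) auto
      finally show ?thesis using L by simp
    qed
    then have "cmod (\<psi> h - \<psi> 1 * of_real s) \<le> 0" by (rule field_le_epsilon)
    then show ?thesis by (simp add: s)
  qed
  have "\<psi> (re_part x + \<i> *\<^sub>C im_part x) = \<psi> 1 * unique_ext \<rho> (re_part x + \<i> *\<^sub>C im_part x)"
    by (simp add: add scaleC ext_simps sa[OF star_re_part[of x]] sa[OF star_im_part[of x]] algebra_simps)
  then show ?thesis by (simp only: re_part_plus_im_part)
qed

end

section \<open>The conditional expectation\<close>

text \<open>
  Let \<open>c \<le> h \<le> d\<close> with \<open>\<rho> (d - c) < e\<close>, and let \<open>g\<close> be the positive part of \<open>e - (d - c)\<close>.  Wherever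
  \<open>g\<close> is nonzero, \<open>c\<close> and \<open>d\<close> differ by less than \<open>e\<close>, and the value of the extension at \<open>h\<close> lies
  between them; so \<open>g c\<close> is a local approximation near \<open>\<rho>\<close>.
\<close>

lemma ex_expectation_selfadjoint:
  assumes h: "star h = h"
  shows "\<exists>y\<in>D. \<forall>\<rho>\<in>characters D. \<rho> y = unique_ext \<rho> h"
proof -
  have local: "\<exists>g\<in>positives. \<exists>d\<in>D. star d = d \<and> 0 < Re (\<rho> g) \<and>
      (\<forall>\<sigma>\<in>characters D. \<bar>Re (\<sigma> d) - Re (unique_ext \<sigma> h) * Re (\<sigma> g)\<bar> \<le> e * Re (\<sigma> g))"
    if r: "\<rho> \<in> characters D" and e: "e > 0" for \<rho> and e :: real
  proof -
    obtain c d where cd: "c \<in> D" "star c = c" "positive (h - c)" "d \<in> D" "star d = d" "positive (d - h)"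
      "Re (unique_ext \<rho> h) - e / 2 < Re (\<rho> c)" "Re (\<rho> c) \<le> Re (unique_ext \<rho> h)" "Re (\<rho> d) < Re (unique_ext \<rho> h) + e / 2"
      using ex_sandwich[OF r h, of "e / 2"] e by auto
    define k where "k = of_real e - (d - c)"
    have "k \<in> D" "star k = k" using cd by (simp_all add: k_def star_diff)
    then obtain g where g: "g \<in> positives" "\<And>\<sigma>. \<sigma> \<in> characters D \<Longrightarrow> Re (\<sigma> g) = max 0 (Re (\<sigma> k))"
      using ex_positive_part by blast
    have k: "Re (\<sigma> k) = e - (Re (\<sigma> d) - Re (\<sigma> c))" if "\<sigma> \<in> characters D" for \<sigma>
      using cd by (simp add: k_def character_simps[OF that])
    show ?thesis
    proof (rule bexI[OF _ g(1)], rule bexI[of _ "g * c"], intro conjI ballI)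
      show "star (g * c) = g * c" "g * c \<in> D"
        using g(1) cd by (simp_all add: star_mult positive_selfadjoint commute)
      show "0 < Re (\<rho> g)" using g(2)[OF r] k[OF r] cd by simp
      fix \<sigma> assume s: "\<sigma> \<in> characters D"
      have gpos: "\<sigma> g = of_real (Re (\<sigma> g))" "0 \<le> Re (\<sigma> g)" using character_positive[OF s g(1)] by auto
      have "Re (\<sigma> c) \<le> Re (unique_ext \<sigma> h)" "Re (unique_ext \<sigma> h) \<le> Re (\<sigma> d)"
        using ext_positive[OF s cd(3)] ext_positive[OF s cd(6)] cd
        by (simp_all add: ext_simps[OF s] ext_eq[OF s])
      then have "\<bar>Re (\<sigma> c) - Re (unique_ext \<sigma> h)\<bar> \<le> e" if "Re (\<sigma> g) \<noteq> 0"
        using g(2)[OF s] k[OF s] that by (simp add: max_def split: if_splits)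
      then have "\<bar>Re (\<sigma> c) - Re (unique_ext \<sigma> h)\<bar> * Re (\<sigma> g) \<le> e * Re (\<sigma> g)"
        using gpos(2) by (cases "Re (\<sigma> g) = 0") (auto intro: mult_right_mono)
      moreover have "\<sigma> (g * c) = of_real (Re (\<sigma> g)) * \<sigma> c"
        using g(1) cd(1) gpos(1) by (simp add: character_simps[OF s])
      then have "Re (\<sigma> (g * c)) - Re (unique_ext \<sigma> h) * Re (\<sigma> g) = (Re (\<sigma> c) - Re (unique_ext \<sigma> h)) * Re (\<sigma> g)"
        by (simp add: algebra_simps)
      ultimately show "\<bar>Re (\<sigma> (g * c)) - Re (unique_ext \<sigma> h) * Re (\<sigma> g)\<bar> \<le> e * Re (\<sigma> g)"
        using gpos(2) by (simp add: abs_mult)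
    qed
  qed
  obtain y where "y \<in> D" and y: "\<And>\<sigma>. \<sigma> \<in> characters D \<Longrightarrow> \<sigma> y = of_real (Re (unique_ext \<sigma> h))"
    using ex_element_of_local_approximations[of "\<lambda>\<sigma>. Re (unique_ext \<sigma> h)", OF local] by blast
  then show ?thesis using ext_selfadjoint[OF _ h] by metis
qed

lemma ex_expectation: "\<exists>y\<in>D. \<forall>\<rho>\<in>characters D. \<rho> y = unique_ext \<rho> x"
proof -
  obtain a b where ab: "a \<in> D" "b \<in> D" "\<And>\<rho>. \<rho> \<in> characters D \<Longrightarrow> \<rho> a = unique_ext \<rho> (re_part x)"
    "\<And>\<rho>. \<rho> \<in> characters D \<Longrightarrow> \<rho> b = unique_ext \<rho> (im_part x)"
    using ex_expectation_selfadjoint[OF star_re_part] ex_expectation_selfadjoint[OF star_im_part] by metis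
  have "\<rho> (a + \<i> *\<^sub>C b) = unique_ext \<rho> (re_part x + \<i> *\<^sub>C im_part x)" if r: "\<rho> \<in> characters D" for \<rho>
    using ab(1,2) by (simp add: character_simps[OF r] ext_simps[OF r] ab(3,4)[OF r])
  then show ?thesis using ab(1,2) re_part_plus_im_part[of x] by (intro bexI[of _ "a + \<i> *\<^sub>C b"]) auto
qed

definition expect :: "'a \<Rightarrow> 'a" where
  "expect x = (SOME y. y \<in> D \<and> (\<forall>\<rho>\<in>characters D. \<rho> y = unique_ext \<rho> x))"

lemma expect_mem: "expect x \<in> D"
  and character_expect: "\<rho> \<in> characters D \<Longrightarrow> \<rho> (expect x) = unique_ext \<rho> x"
  using someI_ex[of "\<lambda>y. y \<in> D \<and> (\<forall>\<rho>\<in>characters D. \<rho> y = unique_ext \<rho> x)"] ex_expectation[of x]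
  unfolding expect_def by blast+

lemma expect_eqI:
  "y \<in> D \<Longrightarrow> (\<And>\<rho>. \<rho> \<in> characters D \<Longrightarrow> unique_ext \<rho> x = \<rho> y) \<Longrightarrow> expect x = y"
  using characters_separate[OF expect_mem] character_expect by metis

lemma conditional_expectation_expect: "conditional_expectation D expect"
  unfolding conditional_expectation_def
proof (intro conjI ballI allI)
  show "Vector_Spaces.linear scaleC scaleC expect"
    unfolding Vector_Spaces.linear_iff
  proof (intro conjI allI complex_vector.vector_space_axioms)
    show "expect (x + y) = expect x + expect y" for x y
      by (rule expect_eqI) (simp_all add: expect_mem character_simps character_expect ext_simps)
    show "expect (c *\<^sub>C x) = c *\<^sub>C expect x" for c x
      by (rule expect_eqI) (simp_all add: expect_mem character_simps character_expect ext_simps)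
  qed
  show "range expect \<subseteq> D" using expect_mem by blast
  show "expect d = d" if "d \<in> D" for d
    by (rule expect_eqI) (use that in \<open>simp_all add: ext_eq\<close>)
  show "norm (expect x) \<le> norm x" for x
    by (rule norm_le_if_characters_le)
      (simp_all add: expect_mem character_expect whole.state_norm_le[OF ext_state])
  show "\<exists>y\<in>D. expect (star x * x) = star y * y" for x
  proof -
    have sa: "star (expect (star x * x)) = expect (star x * x)"
      by (rule characters_separate)
        (simp_all add: expect_mem character_star character_expect star_mult star_star flip: ext_star)
    have "positive (expect (star x * x))"
      by (rule positive_if_characters_nonneg[OF expect_mem sa])
        (simp add: character_expect ext_positive positive_star_mult)
    from ex_sqrt_mem[OF this expect_mem] show ?thesis
      by (metis positive_selfadjoint)
  qed
  show "expect (d * x) = d * expect x" "expect (x * d) = expect x * d" if "d \<in> D" for d x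
    by (rule expect_eqI; use that in \<open>simp add: expect_mem character_simps character_expect ext_mult_left ext_mult_right\<close>)+
qed

text \<open>
  For a character \<open>\<rho>\<close> the functional \<open>\<rho> \<circ> E\<close> is a state that extends \<open>\<rho>\<close>.
\<close>

lemma conditional_expectation_unique:
  assumes E: "conditional_expectation D E"
  shows "E = expect"
proof (rule ext)
  have lin: "E (x + y) = E x + E y" "E (c *\<^sub>C x) = c *\<^sub>C E x" for x y c
    using E unfolding conditional_expectation_def Vector_Spaces.linear_iff by auto
  have mem: "E x \<in> D" for x using E by (auto simp: conditional_expectation_def)
  have id: "E d = d" if "d \<in> D" for d using E that by (auto simp: conditional_expectation_def)
  fix x
  have "(\<lambda>x. \<rho> (E x)) = unique_ext \<rho>" if r: "\<rho> \<in> characters D" for \<rho>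
  proof (rule ext_unique[OF r])
    have "0 \<le> \<rho> (E (star x * x))" for x
    proof -
      obtain y where "y \<in> D" "E (star x * x) = star y * y"
        using E unfolding conditional_expectation_def by blast
      then show ?thesis using state_star_mult[OF character_state[OF r]] by simp
    qed
    then show "(\<lambda>x. \<rho> (E x)) \<in> states UNIV"
      by (simp add: states_def linear_functional_on_def lin mem id character_simps[OF r])
  qed (simp add: id)
  then show "E x = expect x"
    using characters_separate[OF mem expect_mem, of x x] character_expect by (metis (no_types))
qed

lemma cond_exp_eq: "cond_exp D = expect"
  unfolding cond_exp_def
  by (rule the_equality) (fact conditional_expectation_expect, rule conditional_expectation_unique)

lemma character_cond_exp: "\<rho> \<in> characters D \<Longrightarrow> \<rho> (cond_exp D x) = unique_ext \<rho> x"
  by (simp add: cond_exp_eq character_expect)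

end

section \<open>Eigenfunctionals and the twist\<close>

lemma onorm_le_one_bound:
  "\<phi> \<in> bounded_functionals \<Longrightarrow> onorm \<phi> = 1 \<Longrightarrow> cmod (\<phi> x) \<le> norm x"
  using onorm[of \<phi> x] by (simp add: bounded_functionals_def)

context unital_subalgebra
begin

lemma normalizers_mem:
  assumes v: "v \<in> normalizers A"
  shows "d \<in> A \<Longrightarrow> star v * d * v \<in> A" "d \<in> A \<Longrightarrow> v * d * star v \<in> A"
    "star v * v \<in> A" "v * star v \<in> A"
  using v one_mem unfolding normalizers_def by (auto dest: bspec[where x=1])

lemma star_normalizers: "v \<in> normalizers A \<Longrightarrow> star v \<in> normalizers A"
  by (auto simp: normalizers_def star_star)

lemma scaleC_normalizers: "v \<in> normalizers A \<Longrightarrow> c *\<^sub>C v \<in> normalizers A"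
  by (auto simp: normalizers_def star_scaleC mult_scaleC_left mult_scaleC_right)

end

context abelian_subalgebra
begin

lemma left_eigenvalue_character:
  assumes \<phi>: "\<phi> \<in> bounded_functionals" "\<phi> x0 \<noteq> 0"
    and r: "r \<in> extensional D" "\<And>d x. d \<in> D \<Longrightarrow> \<phi> (d * x) = r d * \<phi> x"
  shows "r \<in> characters D"
proof -
  have add: "\<phi> (x + y) = \<phi> x + \<phi> y" and scale: "\<phi> (c *\<^sub>C x) = c * \<phi> x" for x y c
    using \<phi>(1) by (auto simp: bounded_functionals_def linear_simps(1))
  have "r (x + y) * \<phi> x0 = (r x + r y) * \<phi> x0" "r (c *\<^sub>C x) * \<phi> x0 = (c * r x) * \<phi> x0"
    "r (x * y) * \<phi> x0 = (r x * r y) * \<phi> x0" if "x \<in> D" "y \<in> D" for x y c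
    using that
    by (simp_all add: distrib_right mult_scaleC_left mult.assoc add scale flip: r(2))
  moreover have "r 1 * \<phi> x0 = \<phi> x0" by (simp flip: r(2))
  ultimately show ?thesis
    using \<phi>(2) r(1) by (auto simp: characters_def linear_functional_on_def intro!: bexI[of _ 1])
qed

lemma right_eigenvalue_character:
  assumes \<phi>: "\<phi> \<in> bounded_functionals" "\<phi> x0 \<noteq> 0"
    and s: "s \<in> extensional D" "\<And>d x. d \<in> D \<Longrightarrow> \<phi> (x * d) = \<phi> x * s d"
  shows "s \<in> characters D"
proof -
  have add: "\<phi> (x + y) = \<phi> x + \<phi> y" and scale: "\<phi> (c *\<^sub>C x) = c * \<phi> x" for x y c
    using \<phi>(1) by (auto simp: bounded_functionals_def linear_simps(1))
  have "\<phi> x0 * s (x + y) = \<phi> x0 * (s x + s y)" "\<phi> x0 * s (c *\<^sub>C x) = \<phi> x0 * (c * s x)"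
    if "x \<in> D" "y \<in> D" for x y c
    using that
    by (simp_all add: distrib_left mult_scaleC_right add scale mult.left_commute flip: s(2))
  moreover have "\<phi> x0 * s (x * y) = \<phi> x0 * (s x * s y)" if "x \<in> D" "y \<in> D" for x y
  proof -
    have "\<phi> x0 * s (x * y) = \<phi> (x0 * x * y)" using that by (simp add: mult.assoc flip: s(2))
    also have "\<dots> = \<phi> x0 * (s x * s y)" using that by (simp add: s(2))
    finally show ?thesis .
  qed
  moreover have "\<phi> x0 * s 1 = \<phi> x0" by (simp flip: s(2))
  ultimately show ?thesis
    using \<phi>(2) s(1) by (auto simp: characters_def linear_functional_on_def intro!: bexI[of _ 1])
qed

lemma eigen_range_eqI:
  assumes r: "r \<in> characters D" "\<And>d x. d \<in> D \<Longrightarrow> \<phi> (d * x) = r d * \<phi> x" and nz: "\<phi> x0 \<noteq> 0"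
  shows "eigen_range D \<phi> = r"
  unfolding eigen_range_def
proof (rule the_equality)
  fix r' assume r': "r' \<in> characters D \<and> (\<forall>d\<in>D. \<forall>x. \<phi> (d * x) = r' d * \<phi> x)"
  show "r' = r"
  proof (rule functional_eqI[OF character_linear character_linear])
    fix d assume "d \<in> D"
    then have "r' d * \<phi> x0 = r d * \<phi> x0" using r r' by metis
    then show "r' d = r d" using nz by simp
  qed (use r r' in auto)
qed (use r in auto)

lemma eigen_source_eqI:
  assumes s: "s \<in> characters D" "\<And>d x. d \<in> D \<Longrightarrow> \<phi> (x * d) = \<phi> x * s d" and nz: "\<phi> x0 \<noteq> 0"
  shows "eigen_source D \<phi> = s"
  unfolding eigen_source_def
proof (rule the_equality)
  fix s' assume s': "s' \<in> characters D \<and> (\<forall>d\<in>D. \<forall>x. \<phi> (x * d) = \<phi> x * s' d)"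
  show "s' = s"
  proof (rule functional_eqI[OF character_linear character_linear])
    fix d assume "d \<in> D"
    then have "\<phi> x0 * s' d = \<phi> x0 * s d" using s s' by metis
    then show "s' d = s d" using nz by simp
  qed (use s s' in auto)
qed (use s in auto)

lemma eigenfunctional_characters:
  assumes \<phi>: "\<phi> \<in> eigenfunctionals D"
  obtains r s where "r \<in> characters D" "s \<in> characters D"
    "\<And>d x. d \<in> D \<Longrightarrow> \<phi> (d * x) = r d * \<phi> x" "\<And>d x. d \<in> D \<Longrightarrow> \<phi> (x * d) = \<phi> x * s d"
proof -
  have b: "\<phi> \<in> bounded_functionals" and L: "\<And>d. d \<in> D \<Longrightarrow> \<exists>c. \<forall>x. \<phi> (d * x) = c * \<phi> x"
    and R: "\<And>d. d \<in> D \<Longrightarrow> \<exists>c. \<forall>x. \<phi> (x * d) = \<phi> x * c"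
    using \<phi> by (auto simp: eigenfunctionals_def mult.commute)
  obtain x0 where x0: "\<phi> x0 \<noteq> 0" using \<phi> by (auto simp: eigenfunctionals_def)
  obtain r0 where r0: "\<And>d x. d \<in> D \<Longrightarrow> \<phi> (d * x) = r0 d * \<phi> x" using L by metis
  obtain s0 where s0: "\<And>d x. d \<in> D \<Longrightarrow> \<phi> (x * d) = \<phi> x * s0 d" using R by metis
  have r: "\<phi> (d * x) = restrict r0 D d * \<phi> x" and s: "\<phi> (x * d) = \<phi> x * restrict s0 D d"
    if "d \<in> D" for d x using that r0 s0 by auto
  show ?thesis
    using that[OF left_eigenvalue_character[OF b x0 restrict_extensional r]
        right_eigenvalue_character[OF b x0 restrict_extensional s] r s] .
qed

text \<open>
  This turns a peak element for \<open>v\<^sup>* v\<close> into a bound on \<open>v e\<close>.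
\<close>

lemma norm_mult_peak:
  assumes e: "star e = e" "norm (star v * v * (e * e)) \<le> t" "e \<in> D" "star v * v \<in> D"
  shows "norm (v * e) \<le> sqrt t"
proof -
  have "(norm (v * e))\<^sup>2 = norm (star (v * e) * (v * e))" by (simp add: cstar_identity)
  also have "star (v * e) * (v * e) = e * (star v * v) * e" by (simp add: star_mult e mult.assoc)
  also have "\<dots> = star v * v * (e * e)"
    using commute[OF e(3,4)] by (simp add: mult.assoc)
  finally show ?thesis using e(2) by (simp add: real_le_rsqrt)
qed

end

context extension_inclusion
begin

context
  fixes v \<rho> assumes pair: "(v, \<rho>) \<in> twist_pairs D"
begin

lemma pair_normalizer: "v \<in> normalizers D"
  and pair_character: "\<rho> \<in> characters D"
  and pair_pos: "0 < Re (\<rho> (star v * v))"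
  and pair_value: "\<rho> (star v * v) = of_real (Re (\<rho> (star v * v)))"
  using pair by (auto simp: twist_pairs_def less_complex_def complex_eq_iff)

lemma twist_functional_eq:
  "twist_functional D v \<rho> x = unique_ext \<rho> (star v * x) / of_real (sqrt (Re (\<rho> (star v * v))))"
proof -
  have "csqrt (\<rho> (star v * v)) = of_real (sqrt (Re (\<rho> (star v * v))))"
    using pair_value pair_pos by (metis csqrt_of_real_nonneg less_imp_le Re_complex_of_real Im_complex_of_real)
  then show ?thesis
    by (simp add: twist_functional_def character_cond_exp[OF pair_character])
qed

lemma twist_functional_bounded: "twist_functional D v \<rho> \<in> bounded_functionals"
  and twist_functional_le: "cmod (twist_functional D v \<rho> x) \<le> norm x"
proof -
  note r = pair_character
  note es = ext_simps[OF r]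
  have le: "cmod (twist_functional D v \<rho> x) \<le> norm x" for x
  proof -
    define t where "t = Re (\<rho> (star v * v))"
    have t: "t > 0" using pair_pos by (simp add: t_def)
    have "(cmod (unique_ext \<rho> (star v * x)))\<^sup>2 \<le> Re (unique_ext \<rho> (star v * v)) * Re (unique_ext \<rho> (star x * x))"
      by (rule whole.state_Cauchy_Schwarz[OF ext_state[OF r]]) auto
    also have "Re (unique_ext \<rho> (star v * v)) = t"
      using ext_eq[OF r] normalizers_mem(3)[OF pair_normalizer] by (simp add: t_def)
    also have "t * Re (unique_ext \<rho> (star x * x)) \<le> t * (norm x)\<^sup>2"
      using whole.state_norm_le[OF ext_state[OF r], of "star x * x"] t
        abs_Re_le_cmod[of "unique_ext \<rho> (star x * x)"] by (simp add: cstar_identity)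
    also have "\<dots> = (sqrt t * norm x)\<^sup>2" using t by (simp add: power_mult_distrib)
    finally have "cmod (unique_ext \<rho> (star v * x)) \<le> sqrt t * norm x"
      by (rule power2_le_imp_le) (use t in simp)
    then show ?thesis
      using t unfolding twist_functional_eq t_def[symmetric]
      by (simp add: norm_divide pos_divide_le_eq mult.commute)
  qed
  then show "cmod (twist_functional D v \<rho> x) \<le> norm x" .
  have "bounded_linear (twist_functional D v \<rho>)"
  proof (rule bounded_linear_intro[where K=1])
    show "twist_functional D v \<rho> (x + y) = twist_functional D v \<rho> x + twist_functional D v \<rho> y" for x y
      by (simp add: twist_functional_eq distrib_left es add_divide_distrib)
    show "twist_functional D v \<rho> (c *\<^sub>R x) = c *\<^sub>R twist_functional D v \<rho> x" for x c
      by (simp add: twist_functional_eq es) (simp add: scaleR_conv_of_real)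
    show "norm (twist_functional D v \<rho> x) \<le> norm x * 1" for x using le by simp
  qed
  then show "twist_functional D v \<rho> \<in> bounded_functionals"
    by (simp add: bounded_functionals_def twist_functional_eq es mult_scaleC_right)
qed

lemma twist_functional_right:
  "d \<in> D \<Longrightarrow> twist_functional D v \<rho> (x * d) = twist_functional D v \<rho> x * \<rho> d"
  by (simp add: twist_functional_eq ext_mult_right[OF pair_character] flip: mult.assoc)

text \<open>
  All of \<open>v\<^sup>* v\<close>, \<open>v v\<^sup>*\<close> and \<open>v\<^sup>* d v\<close> lie in \<open>D\<close>, and \<open>d\<close> commutes with \<open>v v\<^sup>*\<close>; therefore
  \<open>v\<^sup>* v v\<^sup>* d = v\<^sup>* d v v\<^sup>*\<close>, and \<open>\<rho>\<close> can be applied to the factors in \<open>D\<close>.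
\<close>

lemma twist_functional_left:
  assumes d: "d \<in> D"
  shows "twist_functional D v \<rho> (d * x) = twist_beta D v \<rho> d * twist_functional D v \<rho> x"
proof -
  note r = pair_character
  note n = normalizers_mem[OF pair_normalizer]
  have eq: "star v * v * (star v * (d * x)) = star v * d * v * (star v * x)"
    using commute[OF d n(4)] by (simp add: mult.assoc) (metis mult.assoc)
  have "\<rho> (star v * v) * unique_ext \<rho> (star v * (d * x)) = \<rho> (star v * d * v) * unique_ext \<rho> (star v * x)"
    using ext_mult_left[OF r n(3)] ext_mult_left[OF r n(1)[OF d]] eq by metis
  moreover have "\<rho> (star v * v) \<noteq> 0" using pair_pos by auto
  ultimately have "unique_ext \<rho> (star v * (d * x)) = twist_beta D v \<rho> d * unique_ext \<rho> (star v * x)"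
    using d by (simp add: twist_beta_def field_simps)
  then show ?thesis by (simp add: twist_functional_eq)
qed

lemma twist_functional_self: "twist_functional D v \<rho> v = of_real (sqrt (Re (\<rho> (star v * v))))"
proof -
  define t where "t = Re (\<rho> (star v * v))"
  have t: "t > 0" using pair_pos by (simp add: t_def)
  have "unique_ext \<rho> (star v * v) = of_real t"
    using ext_eq[OF pair_character normalizers_mem(3)[OF pair_normalizer]] pair_value by (simp add: t_def)
  then have "twist_functional D v \<rho> v = of_real (t / sqrt t)"
    unfolding twist_functional_eq t_def[symmetric] by simp
  also have "t / sqrt t = sqrt t" using t by (simp add: real_div_sqrt)
  finally show ?thesis by (simp add: t_def)
qed

lemma twist_functional_self_nonzero: "twist_functional D v \<rho> v \<noteq> 0"
  using pair_pos by (simp add: twist_functional_self)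

text \<open>
  With \<open>t = \<rho> (v\<^sup>* v)\<close> and \<open>e\<close> peaking at \<open>\<rho>\<close> for \<open>v\<^sup>* v\<close>, the element \<open>v e\<close> has norm at most \<open>sqrt t\<close>
  while the functional takes the value \<open>sqrt t\<close> there.
\<close>

lemma onorm_twist_functional: "onorm (twist_functional D v \<rho>) = 1"
proof (rule antisym)
  show "onorm (twist_functional D v \<rho>) \<le> 1"
    by (rule onorm_le) (simp add: twist_functional_le)
  define t where "t = Re (\<rho> (star v * v))"
  have t: "t > 0" using pair_pos by (simp add: t_def)
  note n = normalizers_mem[OF pair_normalizer]
  have "star v * v \<in> positives" using n positive_star_mult by simp
  then obtain e where e: "e \<in> D" "star e = e" "\<rho> e = 1" "norm (star v * v * (e * e)) \<le> t"
    using ex_peak[OF pair_character _ t, of "star v * v"] by (auto simp: t_def)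
  have lin: "bounded_linear (twist_functional D v \<rho>)"
    using twist_functional_bounded by (simp add: bounded_functionals_def)
  have "twist_functional D v \<rho> (v * e) = of_real (sqrt t)"
    using e by (simp add: twist_functional_right twist_functional_self t_def)
  then have "sqrt t \<le> onorm (twist_functional D v \<rho>) * norm (v * e)"
    using onorm[OF lin, of "v * e"] t by simp
  also have "\<dots> \<le> onorm (twist_functional D v \<rho>) * sqrt t"
    using norm_mult_peak[OF e(2,4,1) n(3)] onorm_pos_le[OF lin] by (intro mult_left_mono)
  finally show "1 \<le> onorm (twist_functional D v \<rho>)" using t by simp
qed

lemma twist_beta_character: "twist_beta D v \<rho> \<in> characters D"
  by (rule left_eigenvalue_character[OF twist_functional_bounded twist_functional_self_nonzero])
    (simp_all add: twist_functional_left, simp add: twist_beta_def)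

lemma twist_functional_eigenfunctional: "twist_functional D v \<rho> \<in> unit_eigenfunctionals D"
proof -
  have "\<exists>x. twist_functional D v \<rho> x \<noteq> 0" using twist_functional_self_nonzero by blast
  moreover have "\<exists>c. \<forall>x. twist_functional D v \<rho> (d * x) = c * twist_functional D v \<rho> x"
    "\<exists>c. \<forall>x. twist_functional D v \<rho> (x * d) = c * twist_functional D v \<rho> x" if "d \<in> D" for d
    using that twist_functional_left twist_functional_right by (auto simp: mult.commute)
  ultimately show ?thesis
    using twist_functional_bounded onorm_twist_functional
    by (simp add: unit_eigenfunctionals_def eigenfunctionals_def)
qed

lemma eigen_source_twist: "eigen_source D (twist_functional D v \<rho>) = \<rho>"
  by (rule eigen_source_eqI[OF pair_character twist_functional_right twist_functional_self_nonzero])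

lemma eigen_range_twist: "eigen_range D (twist_functional D v \<rho>) = twist_beta D v \<rho>"
  by (rule eigen_range_eqI[OF twist_beta_character twist_functional_left twist_functional_self_nonzero])

lemma twist_beta_star: "twist_beta D v \<rho> (v * star v) = \<rho> (star v * v)"
proof -
  note n = normalizers_mem[OF pair_normalizer]
  have "star v * (v * star v) * v = (star v * v) * (star v * v)" by (simp add: mult.assoc)
  then show ?thesis
    using n pair_pos by (auto simp: twist_beta_def character_mult[OF pair_character])
qed

lemma star_pair: "(star v, twist_beta D v \<rho>) \<in> twist_pairs D"
  using pair star_normalizers[OF pair_normalizer] twist_beta_character twist_beta_star
  by (simp add: twist_pairs_def star_star)

text \<open>
  The right-hand side is a state that restricts to \<open>twist_beta D v \<rho>\<close> on \<open>D\<close>.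
\<close>

lemma ext_twist_beta: "unique_ext (twist_beta D v \<rho>) x = unique_ext \<rho> (star v * x * v) / \<rho> (star v * v)"
proof -
  note r = pair_character
  note n = normalizers_mem[OF pair_normalizer]
  define t where "t = Re (\<rho> (star v * v))"
  have t: "t > 0" using pair_pos by (simp add: t_def)
  have rt: "\<rho> (star v * v) = of_real t" using pair_value by (simp add: t_def)
  define g where "g = (\<lambda>x. unique_ext \<rho> (star v * x * v) / \<rho> (star v * v))"
  have "g \<in> states UNIV"
    unfolding states_def linear_functional_on_def
  proof (intro CollectI conjI ballI allI)
    show "g (x + y) = g x + g y" "g (c *\<^sub>C x) = c * g x" for x y c
      by (simp_all add: g_def distrib_left distrib_right mult_scaleC_left mult_scaleC_right
          ext_simps[OF r] add_divide_distrib)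
    show "g 1 = 1" using n(3) t by (simp add: g_def ext_eq[OF r] rt)
    fix x
    have "0 \<le> unique_ext \<rho> (star (x * v) * (x * v))"
      by (rule whole.state_star_mult[OF ext_state[OF r]]) simp
    then have "0 \<le> unique_ext \<rho> (star v * (star x * x) * v)" by (simp add: star_mult mult.assoc)
    then show "0 \<le> g (star x * x)" using t by (simp add: g_def rt less_eq_complex_def)
  qed simp
  moreover have "g d = twist_beta D v \<rho> d" if "d \<in> D" for d
    using that n(1)[OF that] by (simp add: g_def twist_beta_def ext_eq[OF r])
  ultimately have "g = unique_ext (twist_beta D v \<rho>)" by (rule ext_unique[OF twist_beta_character])
  then show ?thesis by (metis g_def)
qed

end

lemma eigen_star_twist:
  assumes pair: "(v, \<rho>) \<in> twist_pairs D"
  shows "eigen_star (twist_functional D v \<rho>) = twist_functional D (star v) (twist_beta D v \<rho>)"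
proof (rule ext)
  fix x
  note r = pair_character[OF pair]
  note n = normalizers_mem[OF pair_normalizer[OF pair]]
  define t where "t = Re (\<rho> (star v * v))"
  have t: "t > 0" using pair_pos[OF pair] by (simp add: t_def)
  have rt: "\<rho> (star v * v) = of_real t" using pair_value[OF pair] by (simp add: t_def)
  have "star v * (v * x) * v = (star v * v) * (x * v)" by (simp add: mult.assoc)
  then have "unique_ext (twist_beta D v \<rho>) (v * x) = unique_ext \<rho> (x * v)"
    using t by (simp add: ext_twist_beta[OF pair] ext_mult_left[OF r n(3)] rt)
  then have "twist_functional D (star v) (twist_beta D v \<rho>) x = unique_ext \<rho> (x * v) / of_real (sqrt t)"
    unfolding twist_functional_eq[OF star_pair[OF pair]] star_star twist_beta_star[OF pair]
    by (simp add: rt)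
  moreover have "unique_ext \<rho> (star v * star x) = cnj (unique_ext \<rho> (x * v))"
    using ext_star[OF r, of "x * v"] by (simp add: star_mult)
  then have "eigen_star (twist_functional D v \<rho>) x = unique_ext \<rho> (x * v) / of_real (sqrt t)"
    unfolding eigen_star_def twist_functional_eq[OF pair] t_def[symmetric] by simp
  ultimately show "eigen_star (twist_functional D v \<rho>) x = twist_functional D (star v) (twist_beta D v \<rho>) x"
    by simp
qed

text \<open>
  Otherwise there are \<open>e\<close> in \<open>D\<close> with \<open>s e = 1\<close> and \<open>v e\<close> of arbitrarily small norm, while
  \<open>\<phi> (v e) = \<phi> v\<close>.
\<close>

lemma eigenfunctional_source_pos:
  assumes \<phi>: "\<phi> \<in> bounded_functionals" "onorm \<phi> = 1"
    and s: "s \<in> characters D" "\<And>d x. d \<in> D \<Longrightarrow> \<phi> (x * d) = \<phi> x * s d"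
    and v: "star v * v \<in> D" "\<phi> v \<noteq> 0"
  shows "0 < Re (s (star v * v))"
proof (rule ccontr)
  assume "\<not> ?thesis"
  \<comment> \<open>Any positive value below \<open>(cmod (\<phi> v))\<^sup>2\<close> leads to a contradiction.\<close>
  moreover define t where "t = (cmod (\<phi> v) / 2)\<^sup>2"
  moreover have "t > 0" using v(2) by (simp add: t_def)
  ultimately have t: "t > 0" "Re (s (star v * v)) \<le> t" by linarith+
  have "star v * v \<in> positives" using v(1) positive_star_mult by simp
  then obtain e where e: "e \<in> D" "star e = e" "s e = 1" "norm (star v * v * (e * e)) \<le> t"
    using ex_peak[OF s(1) _ t] by blast
  have "cmod (\<phi> v) = cmod (\<phi> (v * e))" using e by (simp add: s(2))
  also have "\<dots> \<le> norm (v * e)" by (rule onorm_le_one_bound[OF \<phi>])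
  also have "\<dots> \<le> sqrt t" by (rule norm_mult_peak[OF e(2,4,1) v(1)])
  also have "\<dots> = cmod (\<phi> v) / 2" by (simp add: t_def)
  finally show False using v(2) by simp
qed

text \<open>
  Evaluating \<open>\<phi> (v d v\<^sup>* v)\<close> from the left and from the right gives
  \<open>r (v d v\<^sup>*) = s d s (v\<^sup>* v)\<close>.  Hence \<open>\<psi> x = \<phi> (v x)\<close> transforms under \<open>D\<close> by \<open>s\<close> on both sides,
  and is \<open>\<phi> v\<close> times the state extending \<open>s\<close>.  The functional \<open>\<phi>\<close> is recovered from
  \<open>\<psi> (v\<^sup>* x) = r (v v\<^sup>*) \<phi> x\<close>.
\<close>

lemma eigenfunctional_eq_twist_multiple:
  assumes \<phi>: "\<phi> \<in> unit_eigenfunctionals D" and v: "v \<in> normalizers D" "\<phi> v \<noteq> 0"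
  obtains \<rho> c where "(v, \<rho>) \<in> twist_pairs D" "\<And>x. \<phi> x = c * twist_functional D v \<rho> x"
proof -
  have e: "\<phi> \<in> eigenfunctionals D" and on: "onorm \<phi> = 1"
    using \<phi> by (auto simp: unit_eigenfunctionals_def)
  have b: "\<phi> \<in> bounded_functionals" using e by (simp add: eigenfunctionals_def)
  obtain r s where rs: "r \<in> characters D" "s \<in> characters D"
    and L: "\<And>d x. d \<in> D \<Longrightarrow> \<phi> (d * x) = r d * \<phi> x"
    and R: "\<And>d x. d \<in> D \<Longrightarrow> \<phi> (x * d) = \<phi> x * s d"
    using eigenfunctional_characters[OF e] by metis
  note n = normalizers_mem[OF v(1)]
  define a where "a = star v * v"
  have a: "a \<in> D" using n(3) by (simp add: a_def)
  define t where "t = Re (s a)"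
  have t: "t > 0"
    using eigenfunctional_source_pos[OF b on rs(2) R n(3) v(2)] by (simp add: t_def a_def)
  have "a \<in> positives" using a positive_star_mult by (simp add: a_def)
  then have st: "s a = of_real t" using character_positive(2)[OF rs(2)] by (simp add: t_def)
  have conj: "r (v * d * star v) = s d * s a" if d: "d \<in> D" for d
  proof -
    have "r (v * d * star v) * \<phi> v = \<phi> (v * (d * a))"
      using L[OF n(2)[OF d], of v] by (simp add: a_def mult.assoc)
    also have "\<dots> = \<phi> v * (s d * s a)"
      using R[of "d * a" v] d a by (simp add: character_mult[OF rs(2)])
    finally show ?thesis using v(2) by simp
  qed
  define \<psi> where "\<psi> = (\<lambda>x. \<phi> (v * x))"
  have \<psi>: "\<psi> \<in> bounded_functionals"
    using b by (auto simp: bounded_functionals_def \<psi>_def mult_scaleC_right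
        intro: bounded_linear_compose[OF _ bounded_linear_mult_right])
  have \<psi>_da: "\<psi> (d * a * x) = s d * s a * \<psi> x" if d: "d \<in> D" for d x
  proof -
    have "\<psi> (d * a * x) = \<phi> (v * d * star v * (v * x))" by (simp add: \<psi>_def a_def mult.assoc)
    also have "\<dots> = r (v * d * star v) * \<phi> (v * x)" by (rule L[OF n(2)[OF d]])
    finally show ?thesis using conj[OF d] by (simp add: \<psi>_def)
  qed
  have left: "\<psi> (d * x) = s d * \<psi> x" if d: "d \<in> D" for d x
  proof -
    have "s 1 * s a * \<psi> (d * x) = \<psi> (1 * a * (d * x))" by (rule \<psi>_da[OF one_mem, symmetric])
    also have "1 * a * (d * x) = d * a * x" using commute[OF d a] by (simp flip: mult.assoc)
    also have "\<psi> (d * a * x) = s d * s a * \<psi> x" by (rule \<psi>_da[OF d])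
    finally show ?thesis using st t by (simp add: character_one[OF rs(2)])
  qed
  have right: "\<psi> (x * d) = \<psi> x * s d" if d: "d \<in> D" for d x
    using R[OF d, of "v * x"] by (simp add: \<psi>_def mult.assoc)
  have \<psi>_eq: "\<psi> x = \<phi> v * unique_ext s x" for x
    using central_functional_eq[OF rs(2) \<psi> left right, of x] by (simp add: \<psi>_def)
  have pair: "(v, s) \<in> twist_pairs D"
    using v(1) rs(2) st t by (simp add: twist_pairs_def a_def less_complex_def)
  have "\<phi> x = (\<phi> v / of_real (sqrt t)) * twist_functional D v s x" for x
  proof -
    have "of_real t * \<phi> x = \<phi> (v * star v * x)"
      using L[OF n(4), of x] conj[of 1] by (simp add: character_one[OF rs(2)] st)
    also have "\<dots> = \<phi> v * unique_ext s (star v * x)" using \<psi>_eq[of "star v * x"] by (simp add: \<psi>_def mult.assoc)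
    finally have *: "of_real t * \<phi> x = \<phi> v * unique_ext s (star v * x)" .
    have "of_real (sqrt t) * of_real (sqrt t) = complex_of_real t"
      using t by (simp flip: of_real_mult)
    then have "\<phi> x = \<phi> v * unique_ext s (star v * x) / (of_real (sqrt t) * of_real (sqrt t))"
      using * t by (simp add: field_simps)
    then show ?thesis
      by (simp add: twist_functional_eq[OF pair] t_def[unfolded a_def, symmetric])
  qed
  with pair show ?thesis by (rule that)
qed

text \<open>
  The conjugate appears because \<open>v\<close> enters \<open>[v, \<rho>]\<close> through \<open>v\<^sup>*\<close>.
\<close>

lemma twist_functional_scaleC:
  assumes pair: "(v, \<rho>) \<in> twist_pairs D" and c: "cmod c = 1"
  shows "(cnj c *\<^sub>C v, \<rho>) \<in> twist_pairs D"
    "twist_functional D (cnj c *\<^sub>C v) \<rho> x = c * twist_functional D v \<rho> x"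
proof -
  have "c * cnj c = 1" using c complex_norm_square[of c] by simp
  then have eq: "star (cnj c *\<^sub>C v) * (cnj c *\<^sub>C v) = star v * v"
    by (simp add: star_scaleC mult_scaleC_left mult_scaleC_right scaleC_scaleC mult.commute)
  show p: "(cnj c *\<^sub>C v, \<rho>) \<in> twist_pairs D"
    using pair scaleC_normalizers unfolding twist_pairs_def by (simp add: eq)
  show "twist_functional D (cnj c *\<^sub>C v) \<rho> x = c * twist_functional D v \<rho> x"
    unfolding twist_functional_eq[OF p] twist_functional_eq[OF pair] eq
    by (simp add: star_scaleC mult_scaleC_left ext_simps[OF pair_character[OF pair]])
qed

lemma unit_eigenfunctional_in_twist:
  assumes \<phi>: "\<phi> \<in> unit_eigenfunctionals D" and v: "v \<in> normalizers D" "\<phi> v \<noteq> 0"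
  shows "\<phi> \<in> twist D"
proof -
  have on: "onorm \<phi> = 1" and b: "\<phi> \<in> bounded_functionals"
    using \<phi> by (auto simp: unit_eigenfunctionals_def eigenfunctionals_def)
  obtain \<rho> c where pair: "(v, \<rho>) \<in> twist_pairs D" and eq: "\<And>x. \<phi> x = c * twist_functional D v \<rho> x"
    using eigenfunctional_eq_twist_multiple[OF \<phi> v] by blast
  have c0: "c \<noteq> 0" using v(2) eq[of v] by auto
  have "onorm \<phi> \<le> cmod c"
    by (rule onorm_le) (simp add: eq norm_mult mult_left_mono[OF twist_functional_le[OF pair]])
  moreover have "onorm (twist_functional D v \<rho>) \<le> 1 / cmod c"
  proof (rule onorm_le)
    fix x
    have "cmod c * cmod (twist_functional D v \<rho> x) \<le> norm x"
      using onorm_le_one_bound[OF b on, of x] by (simp add: eq norm_mult)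
    then show "norm (twist_functional D v \<rho> x) \<le> 1 / cmod c * norm x"
      using c0 by (simp add: field_simps)
  qed
  ultimately have c: "cmod c = 1"
    using c0 unfolding on onorm_twist_functional[OF pair] by (simp add: field_simps)
  have "\<phi> = twist_functional D (cnj c *\<^sub>C v) \<rho>"
    by (rule ext) (simp add: eq twist_functional_scaleC(2)[OF pair c])
  then show ?thesis
    using twist_functional_scaleC(1)[OF pair c] unfolding twist_def by blast
qed

lemma twist_subset: "twist D \<subseteq> unit_eigenfunctionals D"
  using twist_functional_eigenfunctional by (auto simp: twist_def)

end

lemma bounded_functional_eq_0:
  assumes \<phi>: "\<phi> \<in> bounded_functionals" and N: "\<And>v. v \<in> N \<Longrightarrow> \<phi> v = 0"
    and dense: "closure (cspan N) = UNIV"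
  shows "\<phi> x = 0"
proof -
  have lin: "bounded_linear \<phi>" and scale: "\<And>c x. \<phi> (c *\<^sub>C x) = c * \<phi> x"
    using \<phi> by (auto simp: bounded_functionals_def)
  have "\<phi> y = 0" if "y \<in> cspan N" for y
    using that
  proof (induction rule: complex_vector.span_induct_alt)
    case base
    show ?case using lin by (simp add: linear_simps)
  next
    case (step c v y)
    then show ?case using lin by (simp add: linear_simps(1) scale N)
  qed
  then have "\<phi> y = 0" if "y \<in> closure (cspan N)" for y
    using that continuous_constant_on_closure[of "cspan N" \<phi> 0]
      linear_continuous_on[OF lin] by blast
  then show ?thesis using dense by blast
qed

lemma regular_inclusion_extension:
  assumes "regular_inclusion D"
  shows "extension_inclusion D"
proof
  show "cstar_subalgebra D" "1 \<in> D" "extension_property D"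
    using assms by (auto simp: regular_inclusion_def maximal_abelian_def abelian_cstar_subalgebra_def)
  show "x * y = y * x" if "x \<in> D" "y \<in> D" for x y
    using assms that
    by (auto simp: regular_inclusion_def maximal_abelian_def abelian_cstar_subalgebra_def)
qed

theorem theorem4p10:
  fixes D :: "'a::unital_cstar_algebra set"
  assumes "regular_inclusion D"
  shows "unit_eigenfunctionals D = twist D \<and>
         unit_eigenfunctional_topology D = twist_topology D \<and>
         (\<forall>(v, \<rho>)\<in>twist_pairs D.
            eigen_source D (twist_functional D v \<rho>) = \<rho> \<and>
            eigen_range D (twist_functional D v \<rho>) = twist_beta D v \<rho> \<and>
            eigen_star (twist_functional D v \<rho>) =
              twist_functional D (star v) (twist_beta D v \<rho>))"
proof -
  interpret extension_inclusion D by (rule regular_inclusion_extension[OF assms])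
  have "\<phi> \<in> twist D" if \<phi>: "\<phi> \<in> unit_eigenfunctionals D" for \<phi>
  proof -
    have "\<phi> \<in> bounded_functionals" "\<exists>x. \<phi> x \<noteq> 0"
      using \<phi> by (auto simp: unit_eigenfunctionals_def eigenfunctionals_def)
    moreover have "closure (cspan (normalizers D)) = UNIV"
      using assms by (simp add: regular_inclusion_def)
    ultimately obtain v where "v \<in> normalizers D" "\<phi> v \<noteq> 0"
      using bounded_functional_eq_0 by metis
    then show ?thesis by (rule unit_eigenfunctional_in_twist[OF \<phi>])
  qed
  then have eq: "unit_eigenfunctionals D = twist D" using twist_subset by blast
  then have "unit_eigenfunctional_topology D = twist_topology D"
    by (simp add: unit_eigenfunctional_topology_def twist_topology_def)
  with eq show ?thesis
    using eigen_source_twist eigen_range_twist eigen_star_twist by auto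
qed

end
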